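(* Let $M$ and $M'$ be $\mathrm{GF}(4)$-representable matroids such that $M$ is connected, $M'$ is $3$-connected, and $M'$ is obtained from $M$ by relaxing a circuit-hyperplane $X$. Then $M'$ is either $\{U_{2,4}\}$-fragile or $\{U_{2,5},U_{3,5}\}$-fragile. Moreover, for such a class $\mathcal{N}$ for which $M'$ is $\mathcal{N}$-fragile, $X$ is a basis of $M'$ whose elements are nondeletable and the elements of the cobasis $E(M')-X$ are noncontractible.
   Context: Relaxing a circuit-hyperplane $X$ of $M$ gives the matroid $M'$ on the same ground set with bases $\mathcal{B}(M)\cup\{X\}$. For a set $\mathcal{N}$ of matroids, $M$ has an $\mathcal{N}$-minor if it has a minor isomorphic to some member of $\mathcal{N}$. $M$ is $\mathcal{N}$-fragile if $M$ has an $\mathcal{N}$-minor and, for each element $e$, at most one of $M\backslash e$, $M/e$ has an $\mathcal{N}$-minor. An element $e$ of an $\mathcal{N}$-fragile matroid is nondeletable if $M\backslash e$ has no $\mathcal{N}$-minor, and noncontractible if $M/e$ has no $\mathcal{N}$-minor.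
   Formalization: The "moreover" is proved for at least one of the two classes for which M' is fragile, not for every such class: M' = U_{2,5} is also {U_{2,4}}-fragile, but deleting an element of X leaves U_{2,4}. *)

theory Defs
  imports "HOL-Library.Cardinality"
begin

record 'a matroid_struct =
  ground :: "'a set"
  indeps :: "'a set set"

locale matroid =
  fixes M :: "'a matroid_struct"
  assumes finite_ground: "finite (ground M)"
    and indep_ground: "I \<in> indeps M \<Longrightarrow> I \<subseteq> ground M"
    and indep_empty: "{} \<in> indeps M"
    and indep_subset: "J \<in> indeps M \<Longrightarrow> I \<subseteq> J \<Longrightarrow> I \<in> indeps M"
    and indep_augment: "I \<in> indeps M \<Longrightarrow> J \<in> indeps M \<Longrightarrow> card I < card J \<Longrightarrow>
      \<exists>e \<in> J - I. insert e I \<in> indeps M"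

definition bases :: "'a matroid_struct \<Rightarrow> 'a set set" where
  "bases M = {B \<in> indeps M. \<forall>J \<in> indeps M. B \<subseteq> J \<longrightarrow> J = B}"

definition circuits :: "'a matroid_struct \<Rightarrow> 'a set set" where
  "circuits M = {C. C \<subseteq> ground M \<and> C \<notin> indeps M \<and> (\<forall>D. D \<subset> C \<longrightarrow> D \<in> indeps M)}"

definition rk :: "'a matroid_struct \<Rightarrow> 'a set \<Rightarrow> nat" where
  "rk M X = Max (card ` {I \<in> indeps M. I \<subseteq> X})"

definition cl :: "'a matroid_struct \<Rightarrow> 'a set \<Rightarrow> 'a set" where
  "cl M X = {e \<in> ground M. rk M (insert e X) = rk M X}"

definition flat :: "'a matroid_struct \<Rightarrow> 'a set \<Rightarrow> bool" where
  "flat M X \<longleftrightarrow> X \<subseteq> ground M \<and> cl M X = X"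

definition hyperplane :: "'a matroid_struct \<Rightarrow> 'a set \<Rightarrow> bool" where
  "hyperplane M H \<longleftrightarrow> flat M H \<and> rk M H + 1 = rk M (ground M)"

definition circuit_hyperplane :: "'a matroid_struct \<Rightarrow> 'a set \<Rightarrow> bool" where
  "circuit_hyperplane M X \<longleftrightarrow> X \<in> circuits M \<and> hyperplane M X"

text \<open>\<open>M'\<close> is the matroid obtained from \<open>M\<close> by relaxing \<open>X\<close>. A matroid is determined by its
  ground set and its bases, so for given \<open>M\<close> and \<open>X\<close> at most one matroid \<open>M'\<close> qualifies.\<close>

definition relaxation :: "'a matroid_struct \<Rightarrow> 'a set \<Rightarrow> 'a matroid_struct \<Rightarrow> bool" where
  "relaxation M X M' \<longleftrightarrow>
    circuit_hyperplane M X \<and> ground M' = ground M \<and> bases M' = bases M \<union> {X}"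

definition dual :: "'a matroid_struct \<Rightarrow> 'a matroid_struct" where
  "dual M = \<lparr>ground = ground M, indeps = {I. \<exists>B \<in> bases M. I \<subseteq> ground M - B}\<rparr>"

definition deletion :: "'a matroid_struct \<Rightarrow> 'a set \<Rightarrow> 'a matroid_struct" where
  "deletion M D = \<lparr>ground = ground M - D, indeps = {I \<in> indeps M. I \<subseteq> ground M - D}\<rparr>"

definition contraction :: "'a matroid_struct \<Rightarrow> 'a set \<Rightarrow> 'a matroid_struct" where
  "contraction M C = dual (deletion (dual M) C)"

definition minor :: "'a matroid_struct \<Rightarrow> 'a matroid_struct \<Rightarrow> bool" where
  "minor N M \<longleftrightarrow> (\<exists>C D. C \<subseteq> ground M \<and> D \<subseteq> ground M \<and> C \<inter> D = {} \<and>
    N = deletion (contraction M C) D)"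

definition isomorphic :: "'a matroid_struct \<Rightarrow> 'b matroid_struct \<Rightarrow> bool" where
  "isomorphic M N \<longleftrightarrow> (\<exists>f. bij_betw f (ground M) (ground N) \<and>
    (\<forall>I. I \<subseteq> ground M \<longrightarrow> (I \<in> indeps M \<longleftrightarrow> f ` I \<in> indeps N)))"

text \<open>\<open>U\<^bsub>r,n\<^esub>\<close>, on the ground set \<open>{0, \<dots>, n - 1}\<close>.\<close>

definition uniform :: "nat \<Rightarrow> nat \<Rightarrow> nat matroid_struct" where
  "uniform r n = \<lparr>ground = {..<n}, indeps = {I. I \<subseteq> {..<n} \<and> card I \<le> r}\<rparr>"

definition has_minor :: "'b matroid_struct set \<Rightarrow> 'a matroid_struct \<Rightarrow> bool" where
  "has_minor \<N> M \<longleftrightarrow> (\<exists>N \<in> \<N>. \<exists>K. minor K M \<and> isomorphic K N)"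

definition fragile :: "'b matroid_struct set \<Rightarrow> 'a matroid_struct \<Rightarrow> bool" where
  "fragile \<N> M \<longleftrightarrow> has_minor \<N> M \<and>
    (\<forall>e \<in> ground M. \<not> (has_minor \<N> (deletion M {e}) \<and> has_minor \<N> (contraction M {e})))"

definition nondeletable :: "'b matroid_struct set \<Rightarrow> 'a matroid_struct \<Rightarrow> 'a \<Rightarrow> bool" where
  "nondeletable \<N> M e \<longleftrightarrow> e \<in> ground M \<and> \<not> has_minor \<N> (deletion M {e})"

definition noncontractible :: "'b matroid_struct set \<Rightarrow> 'a matroid_struct \<Rightarrow> 'a \<Rightarrow> bool" where
  "noncontractible \<N> M e \<longleftrightarrow> e \<in> ground M \<and> \<not> has_minor \<N> (contraction M {e})"

definition connected_matroid :: "'a matroid_struct \<Rightarrow> bool" where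
  "connected_matroid M \<longleftrightarrow> (\<forall>e \<in> ground M. \<forall>f \<in> ground M. e \<noteq> f \<longrightarrow>
    (\<exists>C \<in> circuits M. e \<in> C \<and> f \<in> C))"

text \<open>The condition on ranks says that the connectivity
  \<open>\<lambda>(X) = r(X) + r(E - X) - r(M)\<close> is less than \<open>k\<close>.\<close>

definition separation :: "nat \<Rightarrow> 'a matroid_struct \<Rightarrow> 'a set \<Rightarrow> bool" where
  "separation k M X \<longleftrightarrow> X \<subseteq> ground M \<and> k \<le> card X \<and> k \<le> card (ground M - X) \<and>
    rk M X + rk M (ground M - X) < rk M (ground M) + k"

text \<open>Tutte's \<open>n\<close>-connectivity.\<close>

definition n_connected :: "nat \<Rightarrow> 'a matroid_struct \<Rightarrow> bool" where
  "n_connected n M \<longleftrightarrow> (\<forall>k X. 1 \<le> k \<and> k < n \<longrightarrow> \<not> separation k M X)"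

text \<open>Linear independence of the family of columns of \<open>A\<close> (with \<open>m\<close> rows) indexed by \<open>X\<close>;
  in particular, repeated columns at distinct indices are dependent.\<close>

definition independent_columns :: "nat \<Rightarrow> (nat \<Rightarrow> 'a \<Rightarrow> 'f::field) \<Rightarrow> 'a set \<Rightarrow> bool" where
  "independent_columns m A X \<longleftrightarrow>
    (\<forall>c. (\<forall>i<m. (\<Sum>e\<in>X. c e * A i e) = 0) \<longrightarrow> (\<forall>e\<in>X. c e = 0))"

definition representable :: "'f::field itself \<Rightarrow> 'a matroid_struct \<Rightarrow> bool" where
  "representable F M \<longleftrightarrow> (\<exists>m. \<exists>A :: nat \<Rightarrow> 'a \<Rightarrow> 'f.
    indeps M = {X. X \<subseteq> ground M \<and> independent_columns m A X})"

end

theory Submission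
  imports Defs "HOL-Combinatorics.Permutations"
begin

text \<open>A matroid that is representable over \<open>GF(4)\<close> is encoded by a function \<open>p\<close> on sets, the maximal minors of a
  representation, which is non-zero exactly on the bases and satisfies the Grassmann--Pluecker relations.
  Let \<open>p\<close> and \<open>p'\<close> belong to \<open>M\<close> and \<open>M'\<close>; they have the same support except that \<open>p X = 0 \<noteq> p' X\<close>.

  The main point is that \<open>M\<close> has no minor \<open>U\<^bsub>2,5\<^esub>\<close> or \<open>U\<^bsub>3,5\<^esub>\<close>; by duality it suffices to exclude the first.
  Let such a minor arise by contracting \<open>S\<close> and restricting to \<open>P\<close>, with \<open>|S - X| + |X - (S \<union> P)|\<close> minimal.
  By minimality each element of \<open>X - (S \<union> P)\<close> is parallel to a point of \<open>P \<inter> X\<close>, and no element of \<open>S - X\<close>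
  is in series with one. As \<open>U\<^bsub>2,5\<^esub>\<close> is uniquely representable and a line over \<open>GF(4)\<close> has only five
  points, \<open>p\<close> and \<open>p'\<close> then agree, after scaling, on all neighbours of a basis. By Laplace expansion
  they agree at \<open>X\<close>, a contradiction.

  Minors of \<open>M' \ x\<close> with \<open>x \<in> X\<close> and of \<open>M' / y\<close> with \<open>y \<notin> X\<close> are minors of \<open>M\<close>. This settles the
  case that \<open>M'\<close> has a minor \<open>U\<^bsub>2,5\<^esub>\<close> or \<open>U\<^bsub>3,5\<^esub>\<close>. In the other case \<open>p\<close> can be scaled to take values
  in \<open>{0, 1}\<close>, so \<open>M\<close> is binary and has no minor \<open>U\<^bsub>2,4\<^esub>\<close>, while \<open>M'\<close> has one because it is 3-connected.\<close>

section \<open>Fields with four elements and determinants without signs\<close>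

text \<open>Nothing relates the two representations at the start: they may differ by a change of
  coordinates, by column scalings and by the Frobenius map. The five points on a line remove this
  freedom. Once all pair values on the line are aligned, a further value can differ between
  \<open>p\<close> and \<open>p'\<close> only by a common shift of three normalised values. If the
  two functions also vanish together, a nonzero shift produces five distinct elements in a field of
  four. This argument needs equal zero patterns and so fails exactly at the set \<open>X\<close>.
  Hence the pair \<open>(S, P)\<close> has to be moved close to \<open>X\<close>, but the sets used
  in the comparison have to keep an element outside \<open>X\<close>; the number of elements of
  \<open>S - X\<close> decides how the minimal case is closed.

  Functions on subsets are used instead of matrices because \<open>X\<close> is a basis of only one
  of the two matroids, so no standard form with respect to \<open>X\<close> serves both.
  Characteristic 2 removes all signs, hence any ordering of the ground set, and duality becomes
  plain complementation.\<close>

text \<open>The orbits of \<open>h\<close> are pairs, and each contributes \<open>f a + f a\<close>.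
  This replaces sign bookkeeping in the determinant identities.\<close>

lemma sum_involution_char_2:
  fixes f :: "'b \<Rightarrow> 'f::comm_monoid_add"
  assumes "finite A" and char2: "\<And>z::'f. z + z = 0"
    and "\<And>a. a \<in> A \<Longrightarrow> h a \<in> A" "\<And>a. a \<in> A \<Longrightarrow> h (h a) = a"
    and "\<And>a. a \<in> A \<Longrightarrow> h a \<noteq> a" "\<And>a. a \<in> A \<Longrightarrow> f (h a) = f a"
  shows "sum f A = 0"
  using assms(1,3-)
proof (induction "card A" arbitrary: A rule: less_induct)
  case less
  show ?case
  proof (cases "A = {}")
    case False
    then obtain a where a: "a \<in> A" by blast
    let ?A = "A - {a, h a}"
    have ha: "h a \<in> A" "h a \<noteq> a" using less a by auto
    have "sum f ?A = 0"
    proof (rule less.hyps)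
      show "card ?A < card A" using less.prems(1) a by (intro psubset_card_mono) auto
      fix b assume b: "b \<in> ?A"
      have "h b \<noteq> a" "h b \<noteq> h a" using b a less.prems(3) by (metis Diff_iff insertCI)+
      then show "h b \<in> ?A" using b less.prems(2) by auto
    qed (use less.prems in auto)
    moreover have "sum f A = sum f ?A + sum f {a, h a}"
      using less.prems(1) a ha by (subst sum.subset_diff[of "{a, h a}"]) auto
    moreover have "sum f {a, h a} = 0"
      using ha less.prems(5)[OF a] char2 by simp
    ultimately show ?thesis by simp
  qed simp
qed

lemma card_exchange: "finite B \<Longrightarrow> b \<in> B \<Longrightarrow> x \<notin> B \<Longrightarrow> card (insert x (B - {b})) = card B"
  using card_gt_0_iff[of B] by auto

locale gf4 =
  fixes F :: "'f::field itself"
  assumes card_F: "CARD('f) = 4"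
begin

lemma finite_F: "finite (UNIV :: 'f set)"
  using card_F by (metis card.infinite zero_neq_numeral)

text \<open>Translation by 1 permutes the field, so the sum of all elements absorbs four extra ones;
  hence \<open>2 * 2 = 0\<close>.\<close>

lemma add_self [simp]: "(x::'f) + x = 0"
proof -
  have "(\<Sum>x\<in>(UNIV::'f set). x) = (\<Sum>x\<in>UNIV. x + 1)"
    by (rule sum.reindex_bij_witness[of _ "\<lambda>x. x + 1" "\<lambda>x. x - 1"]) auto
  also have "\<dots> = (\<Sum>x\<in>(UNIV::'f set). x) + of_nat 4"
    by (simp add: sum.distrib card_F)
  finally have "(2::'f) * 2 = 0" by simp
  then have "(2::'f) = 0" by (metis mult_eq_0_iff)
  then show ?thesis by (metis mult_2 mult_zero_left)
qed

lemma minus_char_2 [simp]: "- (x::'f) = x"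
  by (metis add_self minus_unique)

lemma diff_char_2 [simp]: "(x::'f) - y = x + y"
  by (simp add: diff_conv_add_uminus del: add_uminus_conv_diff)

lemma add_eq_0_iff_eq: "(x::'f) + y = 0 \<longleftrightarrow> x = y"
  by (metis add_self minus_char_2 minus_unique)

text \<open>The pigeonhole principle in which the rigidity arguments below end.\<close>

lemma not_five_distinct: "\<not> distinct [a, b, c, d, e :: 'f]"
proof
  assume "distinct [a, b, c, d, e]"
  then have "card (set [a, b, c, d, e]) = 5" by (subst distinct_card) auto
  moreover have "card (set [a, b, c, d, e]) \<le> 4"
    unfolding card_F[symmetric] by (rule card_mono[OF finite_F]) auto
  ultimately show False by linarith
qed

lemma square_add: "((x::'f) + y)\<^sup>2 = x\<^sup>2 + y\<^sup>2"
  proof -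
  have "(x + y)\<^sup>2 = x\<^sup>2 + y\<^sup>2 + (x * y + x * y)"
    unfolding power2_eq_square by (simp only: distrib_left distrib_right mult.commute ac_simps)
  then show ?thesis by (simp only: add_self add_0_right)
qed

lemma square_sum: "(\<Sum>i\<in>A. g i :: 'f)\<^sup>2 = (\<Sum>i\<in>A. (g i)\<^sup>2)"
  by (induction A rule: infinite_finite_induct) (auto simp: square_add)

lemma char_2_eqI:
  assumes "(x::'f) + y = 0" shows "x = y"
  using assms by (simp add: add_eq_0_iff_eq)

end

text \<open>In characteristic 2 the permanent is the determinant.\<close>

definition pdet :: "'a set \<Rightarrow> ('a \<Rightarrow> 'a \<Rightarrow> 'f) \<Rightarrow> 'f::field" where
  "pdet R w = (\<Sum>\<pi> | \<pi> permutes R. \<Prod>i\<in>R. w i (\<pi> i))"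

lemma pdet_cong:
  assumes "\<And>i r. i \<in> R \<Longrightarrow> r \<in> R \<Longrightarrow> w i r = w' i r"
  shows "pdet R w = pdet R w'"
  unfolding pdet_def using assms by (intro sum.cong prod.cong) (auto simp: permutes_in_image)

lemma pdet_permute:
  assumes "\<rho> permutes R"
  shows "pdet R (\<lambda>i. w (\<rho> i)) = pdet R w"
proof -
  have "pdet R (\<lambda>i. w (\<rho> i)) = (\<Sum>\<pi> | \<pi> permutes R. \<Prod>i\<in>R. w (\<rho> i) ((\<pi> \<circ> \<rho>) i))"
    unfolding pdet_def by (rule sum.reindex_bij_witness
       [of _ "\<lambda>\<pi>. \<pi> \<circ> \<rho>" "\<lambda>\<pi>. \<pi> \<circ> inv \<rho>"])
      (use assms in \<open>auto simp: permutes_compose permutes_inv o_assoc[symmetric] permutes_inv_o\<close>)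
  also have "\<dots> = pdet R w"
    unfolding pdet_def
  proof (rule sum.cong[OF refl])
    fix \<pi> 
    show "(\<Prod>i\<in>R. w (\<rho> i) ((\<pi> \<circ> \<rho>) i)) = (\<Prod>i\<in>R. w i (\<pi> i))"
      using prod.permute[OF assms, of "\<lambda>i. w i (\<pi> i)"] by (simp add: comp_def)
  qed
  finally show ?thesis .
qed

lemma pdet_linear:
  assumes "finite R" "i \<in> R"
  shows "pdet R (w(i := \<lambda>r. \<Sum>k\<in>K. c k * u k r)) = (\<Sum>k\<in>K. c k * pdet R (w(i := u k)))"
proof -
  have *: "(\<Prod>j\<in>R. (w(i := v)) j (\<pi> j)) = v (\<pi> i) * (\<Prod>j\<in>R-{i}. w j (\<pi> j))" for v \<pi>
    using assms by (subst prod.remove[of _ i]) auto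
  have "pdet R (w(i := \<lambda>r. \<Sum>k\<in>K. c k * u k r)) =
    (\<Sum>\<pi> | \<pi> permutes R. \<Sum>k\<in>K. c k * (u k (\<pi> i) * (\<Prod>j\<in>R-{i}. w j (\<pi> j))))"
    unfolding pdet_def * by (simp add: sum_distrib_right mult.assoc)
  also have "\<dots> = (\<Sum>k\<in>K. \<Sum>\<pi> | \<pi> permutes R. c k * (u k (\<pi> i) * (\<Prod>j\<in>R-{i}. w j (\<pi> j))))"
    by (rule sum.swap)
  also have "\<dots> = (\<Sum>k\<in>K. c k * pdet R (w(i := u k)))"
    unfolding pdet_def * by (simp add: sum_distrib_left)
  finally show ?thesis .
qed

lemma pdet_scale:
  assumes "finite R" "i \<in> R"
  shows "pdet R (w(i := \<lambda>r. c * u r)) = c * pdet R (w(i := u))"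
  using pdet_linear[OF assms, of w "\<lambda>_. c" "\<lambda>_. u" "{()}"] by simp

lemma pdet_unit:
  assumes "finite R"
  shows "pdet R (\<lambda>i r. if r = i then 1 else 0) = (1 :: 'f::field)"
proof -
  have "(\<Prod>i\<in>R. if \<pi> i = i then 1 else 0 :: 'f) = (if \<pi> = id then 1 else 0)" if "\<pi> permutes R" for \<pi>
    using that assms by (auto simp: permutes_def fun_eq_iff)
  then have "pdet R (\<lambda>i r. if r = i then 1 else 0) = (\<Sum>\<pi> | \<pi> permutes R. if \<pi> = id then 1 else 0 :: 'f)"
    unfolding pdet_def by (intro sum.cong) auto
  then show ?thesis
    using assms by (simp add: finite_permutations permutes_id)
qed

context gf4
begin

text \<open>Composing a permutation with the transposition of \<open>i\<close> and \<open>j\<close>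
  pairs off equal terms.\<close>

lemma pdet_alternating:
  fixes w :: "'a \<Rightarrow> 'a \<Rightarrow> 'f"
  assumes R: "finite R" "i \<in> R" "j \<in> R" "i \<noteq> j" and eq: "\<And>r. r \<in> R \<Longrightarrow> w i r = w j r"
  shows "pdet R w = 0"
  unfolding pdet_def
proof (rule sum_involution_char_2[where h = "\<lambda>\<pi>. \<pi> \<circ> transpose i j"])
  fix \<pi> assume "\<pi> \<in> {\<pi>. \<pi> permutes R}"
  then have \<pi>: "\<pi> permutes R" by simp
  show "\<pi> \<circ> transpose i j \<in> {\<pi>. \<pi> permutes R}"
    using \<pi> R by (auto intro!: permutes_compose permutes_swap_id)
  show "\<pi> \<circ> transpose i j \<noteq> \<pi>"
    using \<pi> R(4) by (metis comp_apply inj_eq permutes_inj transpose_apply_first)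
  have inv: "transpose i j permutes R" using R by (intro permutes_swap_id)
  have "(\<Prod>k\<in>R. w k ((\<pi> \<circ> transpose i j) k)) = (\<Prod>k\<in>R. w (transpose i j k) (\<pi> k))"
    using prod.permute[OF inv, of "\<lambda>k. w k ((\<pi> \<circ> transpose i j) k)"] by (simp add: comp_def)
  also have "\<dots> = (\<Prod>k\<in>R. w k (\<pi> k))"
    using eq \<pi> by (intro prod.cong) (auto simp: transpose_def permutes_in_image)
  finally show "(\<Prod>k\<in>R. w k ((\<pi> \<circ> transpose i j) k)) = (\<Prod>k\<in>R. w k (\<pi> k))" .
qed (auto simp: R finite_permutations o_assoc[symmetric])

text \<open>Cramer's rule for expressing the vector \<open>x\<close> by the rows of
  \<open>w\<close>, cleared of denominators. It is proved by cancelling terms directly, without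
  cofactors.\<close>

lemma pdet_cramer:
  fixes w :: "'a \<Rightarrow> 'a \<Rightarrow> 'f"
  assumes R: "finite R" "r \<in> R"
  shows "pdet R w * x r = (\<Sum>i\<in>R. pdet R (w(i := x)) * w i r)"
proof -
  let ?P = "{\<pi>. \<pi> permutes R}"
  let ?f = "\<lambda>(i, \<pi>). x (\<pi> i) * (\<Prod>j\<in>R-{i}. w j (\<pi> j)) * w i r"
  let ?A = "{(i, \<pi>). i \<in> R \<and> \<pi> \<in> ?P \<and> \<pi> i \<noteq> r}"
  let ?B = "{(i, \<pi>). i \<in> R \<and> \<pi> \<in> ?P \<and> \<pi> i = r}"
  have fin: "finite (R \<times> ?P)" using R by (simp add: finite_permutations)
  have split: "R \<times> ?P = ?A \<union> ?B" by auto
  have "(\<Sum>i\<in>R. pdet R (w(i := x)) * w i r) = (\<Sum>i\<in>R. \<Sum>\<pi>\<in>?P. ?f (i, \<pi>))"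
  proof (rule sum.cong[OF refl])
    fix i assume i: "i \<in> R"
    have "(\<Prod>j\<in>R. (w(i := x)) j (\<pi> j)) = x (\<pi> i) * (\<Prod>j\<in>R-{i}. w j (\<pi> j))" for \<pi>
      using R(1) i by (subst prod.remove[of _ i]) auto
    then show "pdet R (w(i := x)) * w i r = (\<Sum>\<pi>\<in>?P. ?f (i, \<pi>))"
      unfolding pdet_def by (simp add: sum_distrib_right)
  qed
  also have "\<dots> = sum ?f (R \<times> ?P)" by (simp add: sum.cartesian_product)
  also have "\<dots> = sum ?f ?A + sum ?f ?B"
    using fin unfolding split by (intro sum.union_disjoint) auto
  also have "sum ?f ?A = 0"
  \<comment> \<open>With \<open>k = inv \<pi> r\<close>, the term of \<open>(i, \<pi>)\<close>
    contains both \<open>w i r\<close> and \<open>w k r\<close>. Exchanging the roles of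
    \<open>i\<close> and \<open>k\<close> therefore gives the same product.\<close>
  proof (rule sum_involution_char_2[where h = "\<lambda>(i, \<pi>). (inv \<pi> r, \<pi> \<circ> transpose i (inv \<pi> r))"])
    show "finite ?A" using fin unfolding split by simp
    fix a assume "a \<in> ?A"
    then obtain i \<pi> where a: "a = (i, \<pi>)" and i: "i \<in> R" and \<pi>: "\<pi> permutes R" and ne: "\<pi> i \<noteq> r"
      by auto
    define k where "k = inv \<pi> r"
    have k: "\<pi> k = r" "k \<in> R" "k \<noteq> i"
      using \<pi> ne R(2) unfolding k_def by (auto simp: permutes_inverses permutes_in_image permutes_inv)
    define \<pi>' where "\<pi>' = \<pi> \<circ> transpose i k"
    have \<pi>': "\<pi>' permutes R" unfolding \<pi>'_def
      using \<pi> i k by (intro permutes_compose permutes_swap_id)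
    have inv': "inv \<pi>' r = i"
      by (metis \<pi>' \<pi>'_def comp_apply k(1) permutes_inverses(2) transpose_apply_first)
    have h: "(case a of (i, \<pi>) \<Rightarrow> (inv \<pi> r, \<pi> \<circ> transpose i (inv \<pi> r))) = (k, \<pi>')"
      unfolding a k_def \<pi>'_def by simp
    have "\<pi>' k = \<pi> i" unfolding \<pi>'_def by simp
    then show "(case a of (i, \<pi>) \<Rightarrow> (inv \<pi> r, \<pi> \<circ> transpose i (inv \<pi> r))) \<in> ?A"
      unfolding h using k \<pi>' ne by simp
    show "(case case a of (i, \<pi>) \<Rightarrow> (inv \<pi> r, \<pi> \<circ> transpose i (inv \<pi> r)) of
         (i, \<pi>) \<Rightarrow> (inv \<pi> r, \<pi> \<circ> transpose i (inv \<pi> r))) = a"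
      unfolding h using inv' by (simp add: a \<pi>'_def o_assoc[symmetric] transpose_commute[of k i])
    show "(case a of (i, \<pi>) \<Rightarrow> (inv \<pi> r, \<pi> \<circ> transpose i (inv \<pi> r))) \<noteq> a"
      unfolding h unfolding a using k by simp
    have 1: "(\<Prod>j\<in>R-{k}. w j (\<pi>' j)) = w i r * (\<Prod>j\<in>R-{k}-{i}. w j (\<pi> j))"
      using R(1) i k by (subst prod.remove[of _ i]) (auto simp: \<pi>'_def transpose_def intro!: prod.cong)
    have 2: "(\<Prod>j\<in>R-{i}. w j (\<pi> j)) = w k r * (\<Prod>j\<in>R-{i}-{k}. w j (\<pi> j))"
      using R(1) i k by (subst prod.remove[of _ k]) auto
    have 3: "R-{i}-{k} = R-{k}-{i}" by blast
    show "?f (case a of (i, \<pi>) \<Rightarrow> (inv \<pi> r, \<pi> \<circ> transpose i (inv \<pi> r))) = ?f a"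
      unfolding h using \<open>\<pi>' k = \<pi> i\<close> by (simp add: a 1 2 3 mult_ac)
  qed simp
  also have "sum ?f ?B = (\<Sum>\<pi>\<in>?P. x r * (\<Prod>j\<in>R. w j (\<pi> j)))"
  proof (rule sum.reindex_bij_witness[of _ "\<lambda>\<pi>. (inv \<pi> r, \<pi>)" snd])
    fix a assume "a \<in> ?B"
    then obtain i \<pi> where a: "a = (i, \<pi>)" and i: "i \<in> R" and \<pi>: "\<pi> permutes R" and eq: "\<pi> i = r"
      by auto
    show "(inv (snd a) r, snd a) = a"
      using \<pi> eq by (auto simp: a permutes_inverses)
    show "x r * (\<Prod>j\<in>R. w j (snd a j)) = ?f a"
      using R(1) i eq by (simp add: a prod.remove[of _ i] mult_ac)
  qed (use R in \<open>auto simp: permutes_inverses permutes_in_image permutes_inv\<close>)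
  also have "\<dots> = x r * pdet R w" unfolding pdet_def by (simp add: sum_distrib_left)
  finally show ?thesis by (simp only: mult.commute[of "pdet R w"] add_0_left)
qed

end

section \<open>Signless Pluecker functions\<close>

text \<open>The Grassmann--Pluecker exchange relation in characteristic 2, where it needs no signs. It can be
  imposed on arbitrary sets, since both sides vanish unless \<open>B\<close> and \<open>B'\<close> have the right cardinality.\<close>

definition pluecker :: "('a set \<Rightarrow> 'f::field) \<Rightarrow> bool" where
  "pluecker p \<longleftrightarrow> (\<forall>B B' x. x \<in> B' - B \<longrightarrow>
    p B * p B' = (\<Sum>b\<in>B-B'. p (insert x (B - {b})) * p (insert b (B' - {x}))))"

text \<open>The columns \<open>v b\<close> of \<open>B\<close> are matched with the rows \<open>R\<close> by an arbitrary bijection; in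
  characteristic 2 its choice does not matter.\<close>

definition maximal_minor :: "'a set \<Rightarrow> 'a set \<Rightarrow> ('a \<Rightarrow> 'a \<Rightarrow> 'f) \<Rightarrow> 'a set \<Rightarrow> 'f::field" where
  "maximal_minor E R v B = (if B \<subseteq> E \<and> card B = card R
    then pdet R (\<lambda>i. v ((SOME \<beta>. bij_betw \<beta> R B) i)) else 0)"

text \<open>Two bijections from \<open>R\<close> to \<open>B\<close> differ by a permutation of
  \<open>R\<close>, under which \<open>pdet\<close> is invariant.\<close>

lemma maximal_minor_eq:
  assumes "finite E" "B \<subseteq> E" and \<beta>: "bij_betw \<beta> R B"
  shows "maximal_minor E R v B = pdet R (\<lambda>i. v (\<beta> i))"
proof -
  define \<beta>' where "\<beta>' = (SOME \<beta>. bij_betw \<beta> R B)"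
  have \<beta>': "bij_betw \<beta>' R B" unfolding \<beta>'_def using \<beta> by (rule someI[of "\<lambda>\<beta>. bij_betw \<beta> R B"])
  define \<rho> where "\<rho> i = (if i \<in> R then inv_into R \<beta>' (\<beta> i) else i)" for i
  have "bij_betw (inv_into R \<beta>' \<circ> \<beta>) R R"
    using \<beta> \<beta>' by (meson bij_betw_inv_into bij_betw_trans)
  then have "bij_betw \<rho> R R"
    by (rule iffD1[OF bij_betw_cong, rotated]) (simp add: \<rho>_def)
  then have \<rho>: "\<rho> permutes R" by (rule bij_imp_permutes) (simp add: \<rho>_def)
  have "\<beta>' (\<rho> i) = \<beta> i" if "i \<in> R" for i
    using that \<beta> \<beta>' unfolding \<rho>_def by (simp add: bij_betw_inv_into_right bij_betwE)
  then have "pdet R (\<lambda>i. v (\<beta> i)) = pdet R (\<lambda>i. v (\<beta>' (\<rho> i)))"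
    by (intro pdet_cong) simp
  also have "\<dots> = pdet R (\<lambda>i. v (\<beta>' i))" using pdet_permute[OF \<rho>, of "\<lambda>i. v (\<beta>' i)"] .
  finally show ?thesis
    using assms bij_betw_same_card[OF \<beta>] by (simp add: maximal_minor_def \<beta>'_def)
qed

context gf4
begin

lemma maximal_minor_cramer:
  fixes v :: "'a \<Rightarrow> 'a \<Rightarrow> 'f"
  assumes E: "finite E" "finite R" "r \<in> R" and B: "B \<subseteq> E" "card B = card R" and x: "x \<in> E" "x \<notin> B"
  shows "maximal_minor E R v B * v x r = (\<Sum>b\<in>B. maximal_minor E R v (insert x (B - {b})) * v b r)"
proof -
  have "finite B" using B E finite_subset by blast
  then obtain \<beta> where \<beta>: "bij_betw \<beta> R B" using B E by (metis finite_same_card_bij)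
  let ?W = "\<lambda>i. v (\<beta> i)"
  have p1: "maximal_minor E R v (insert x (B - {\<beta> i})) = pdet R (?W(i := v x))" if i: "i \<in> R" for i
  proof -
    have "bij_betw (\<beta>(i := x)) R (insert x (B - {\<beta> i}))"
      using \<beta> i x(2) by (auto simp: bij_betw_def inj_on_def)
    moreover have "(\<lambda>k. v ((\<beta>(i := x)) k)) = ?W(i := v x)" by auto
    ultimately show ?thesis
      using maximal_minor_eq[OF E(1), of "insert x (B - {\<beta> i})" "\<beta>(i := x)" R v] B x by fastforce
  qed
  have "maximal_minor E R v B * v x r = (\<Sum>i\<in>R. pdet R (?W(i := v x)) * v (\<beta> i) r)"
    unfolding maximal_minor_eq[OF E(1) B(1) \<beta>] by (rule pdet_cramer[OF E(2,3)])
  also have "\<dots> = (\<Sum>i\<in>R. maximal_minor E R v (insert x (B - {\<beta> i})) * v (\<beta> i) r)"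
    using p1 by simp
  also have "\<dots> = (\<Sum>b\<in>B. maximal_minor E R v (insert x (B - {b})) * v b r)"
    by (rule sum.reindex_bij_betw[OF \<beta>])
  finally show ?thesis .
qed

text \<open>In the minor of \<open>B'\<close>, the column of \<open>x\<close> is expanded over the
  columns of \<open>B\<close> by Cramer's rule. By linearity this gives one term for each
  \<open>b\<close> in \<open>B\<close>; those with \<open>b\<close> in \<open>B'\<close> repeat a
  column and vanish.\<close>

lemma pluecker_maximal_minor:
  fixes v :: "'a \<Rightarrow> 'a \<Rightarrow> 'f"
  assumes E: "finite E" and R: "finite R"
  shows "pluecker (maximal_minor E R v)"
  unfolding pluecker_def
proof (intro allI impI)
  fix B B' :: "'a set" and x assume x: "x \<in> B' - B"
  let ?p = "maximal_minor E R v"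
  let ?S = "\<Sum>b\<in>B-B'. ?p (insert x (B - {b})) * ?p (insert b (B' - {x}))"
  show "?p B * ?p B' = ?S"
  proof (cases "B \<subseteq> E \<and> card B = card R \<and> B' \<subseteq> E \<and> card B' = card R")
    case False
    have "?p (insert x (B - {b})) * ?p (insert b (B' - {x})) = 0" if b: "b \<in> B - B'" for b
    proof (rule ccontr)
      assume "\<not> ?thesis"
      then have *: "insert x (B - {b}) \<subseteq> E" "card (insert x (B - {b})) = card R"
        "insert b (B' - {x}) \<subseteq> E" "card (insert b (B' - {x})) = card R"
        by (auto simp: maximal_minor_def split: if_splits)
      then have "B \<subseteq> E" "B' \<subseteq> E" "finite B" "finite B'" using E x b by (auto intro: finite_subset)
      moreover from this have "card (insert x (B - {b})) = card B" "card (insert b (B' - {x})) = card B'"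
        using x b by (meson DiffD1 DiffD2 card_exchange)+
      ultimately show False using False * by metis
    qed
    then have "?S = 0" by (intro sum.neutral) auto
    then show ?thesis using False by (auto simp: maximal_minor_def)
  next
    case True
    then have fin: "finite B" "finite B'" using E by (auto intro: finite_subset)
    obtain \<beta> \<beta>' where \<beta>: "bij_betw \<beta> R B" and \<beta>': "bij_betw \<beta>' R B'"
      using True fin R by (metis finite_same_card_bij)
    let ?W' = "\<lambda>i. v (\<beta>' i)"
    obtain j where j: "j \<in> R" "\<beta>' j = x" using \<beta>' x by (auto simp: bij_betw_def)
    have upd: "bij_betw (\<gamma>(i := y)) R (insert y (C - {\<gamma> i}))"
      if "bij_betw \<gamma> R C" "i \<in> R" "y \<notin> C" for \<gamma> :: "'a \<Rightarrow> 'a" and C i y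
      using that by (auto simp: bij_betw_def inj_on_def)
    have upd_v: "(\<lambda>k. v ((\<gamma>(i := y)) k)) = (\<lambda>k. v (\<gamma> k))(i := v y)" for \<gamma> :: "'a \<Rightarrow> 'a" and i y
      by auto
    have pB': "?p B' = pdet R (?W'(j := v x))"
      using maximal_minor_eq[OF E _ \<beta>'] True j by (simp add: fun_upd_idem)
    have in_E: "x \<in> E" "\<beta> i \<in> E" if "i \<in> R" for i
      using True x bij_betwE[OF \<beta>] that by auto
    have p2: "?p (insert (\<beta> i) (B' - {x})) = pdet R (?W'(j := v (\<beta> i)))"
      if "i \<in> R" "\<beta> i \<notin> B'" for i
      using maximal_minor_eq[OF E _ upd[OF \<beta>' j(1) that(2)], of v] True in_E that
      unfolding upd_v j(2) by blast
    have p3: "pdet R (?W'(j := v (\<beta> i))) = 0" if i: "i \<in> R" "\<beta> i \<in> B'" for i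
    proof -
      obtain k where k: "k \<in> R" "\<beta>' k = \<beta> i"
        using \<beta>' i(2) unfolding bij_betw_def by force
      then have "k \<noteq> j" using j x bij_betwE[OF \<beta>] i by auto
      then show ?thesis using k j R by (intro pdet_alternating[of R k j]) auto
    qed
    have "?p B * ?p B' = pdet R (?W'(j := \<lambda>r. ?p B * v x r))"
      unfolding pB' by (rule pdet_scale[symmetric, OF R j(1)])
    also have "\<dots> = pdet R (?W'(j := \<lambda>r. \<Sum>i\<in>R. ?p (insert x (B - {\<beta> i})) * v (\<beta> i) r))"
    proof (rule pdet_cong)
      fix i r assume "i \<in> R" and r: "r \<in> R"
      have "?p B * v x r = (\<Sum>b\<in>B. ?p (insert x (B - {b})) * v b r)"
        using True x by (intro maximal_minor_cramer[OF E R r]) auto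
      also have "\<dots> = (\<Sum>i\<in>R. ?p (insert x (B - {\<beta> i})) * v (\<beta> i) r)"
        by (rule sum.reindex_bij_betw[OF \<beta>, symmetric])
      finally show "(?W'(j := \<lambda>r. ?p B * v x r)) i r =
        (?W'(j := \<lambda>r. \<Sum>i\<in>R. ?p (insert x (B - {\<beta> i})) * v (\<beta> i) r)) i r"
        by simp
    qed
    also have "\<dots> = (\<Sum>i\<in>R. ?p (insert x (B - {\<beta> i})) * pdet R (?W'(j := v (\<beta> i))))"
      by (rule pdet_linear[OF R j(1)])
    also have "\<dots> = (\<Sum>i\<in>R. if \<beta> i \<in> B' then 0
       else ?p (insert x (B - {\<beta> i})) * ?p (insert (\<beta> i) (B' - {x})))"
      by (rule sum.cong) (auto simp: p2 p3)
    also have "\<dots> = (\<Sum>b\<in>B. if b \<in> B' then 0 else ?p (insert x (B - {b})) * ?p (insert b (B' - {x})))"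
      by (rule sum.reindex_bij_betw[OF \<beta>])
    also have "\<dots> = ?S"
      using fin(1) by (intro sum.mono_neutral_cong_right) auto
    finally show ?thesis .
  qed
qed

end

section \<open>Consequences of the exchange relation\<close>

lemma plueckerD:
  "pluecker p \<Longrightarrow> x \<in> B' - B \<Longrightarrow>
    p B * p B' = (\<Sum>b\<in>B-B'. p (insert x (B - {b})) * p (insert b (B' - {x})))"
  unfolding pluecker_def by blast

lemma pluecker_exchange:
  assumes "pluecker p" "p B \<noteq> 0" "p B' \<noteq> 0" "x \<in> B' - B"
  shows "\<exists>b \<in> B - B'. p (insert x (B - {b})) \<noteq> 0 \<and> p (insert b (B' - {x})) \<noteq> 0"
proof (rule ccontr)
  assume "\<not> ?thesis"
  then have "p (insert x (B - {b})) * p (insert b (B' - {x})) = 0" if "b \<in> B - B'" for b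
    using that by auto
  then have "(\<Sum>b\<in>B-B'. p (insert x (B - {b})) * p (insert b (B' - {x}))) = 0"
    by (rule sum.neutral[OF ballI])
  then show False using plueckerD[OF assms(1,4)] assms(2,3) by simp
qed

lemma pluecker_three_term:
  assumes "pluecker p" "distinct [a, b, c, d]" "a \<notin> T" "b \<notin> T" "c \<notin> T" "d \<notin> T"
  shows "p (insert a (insert b T)) * p (insert c (insert d T)) =
    p (insert a (insert c T)) * p (insert b (insert d T)) +
    p (insert a (insert d T)) * p (insert b (insert c T))"
proof -
  define B B' where "B = insert a (insert b T)" and "B' = insert c (insert d T)"
  have d: "c \<in> B' - B" "B - B' = {a, b}" "a \<noteq> b" using assms(2-) unfolding B_def B'_def by auto
  have "p B * p B' = (\<Sum>x\<in>{a, b}. p (insert c (B - {x})) * p (insert x (B' - {c})))"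
    unfolding plueckerD[OF assms(1) d(1)] d(2) ..
  also have "\<dots> = p (insert c (B - {a})) * p (insert a (B' - {c})) + p (insert c (B - {b})) * p (insert b (B' - {c}))"
    using d by simp
  finally have *: "p B * p B' = \<dots>" .
  have "insert c (B - {a}) = insert b (insert c T)" "insert c (B - {b}) = insert a (insert c T)"
      "insert a (B' - {c}) = insert a (insert d T)" "insert b (B' - {c}) = insert b (insert d T)"
    using assms(2-) unfolding B_def B'_def by auto
  from *[unfolded this] show ?thesis unfolding B_def B'_def
    by (simp only: mult.commute[of "p (insert b (insert c T))"] add.commute[of "p (insert a (insert d T)) * _"])
qed

text \<open>The three-term relation over \<open>insert h T\<close>, with \<open>h\<close> moved to
  the front to match the way triples are written later.\<close>

lemma pluecker_three_term_base:
  assumes "pluecker p" "distinct [h, i, j, k, l]" "i \<notin> T" "j \<notin> T" "k \<notin> T" "l \<notin> T"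
  shows "p (insert h (insert i (insert j T))) * p (insert h (insert k (insert l T))) =
    p (insert h (insert i (insert k T))) * p (insert h (insert j (insert l T))) +
    p (insert h (insert i (insert l T))) * p (insert h (insert j (insert k T)))"
proof -
  have "distinct [i, j, k, l]" "i \<notin> insert h T" "j \<notin> insert h T" "k \<notin> insert h T" "l \<notin> insert h T"
    using assms(2-) by auto
  from pluecker_three_term[OF assms(1) this] show ?thesis
    by (simp only: insert_commute[of h])
qed

text \<open>The relation for \<open>B\<^sub>0\<close> and \<open>B\<close> expresses
  \<open>p B\<close> by neighbours of \<open>B\<^sub>0\<close> and by sets one step closer to
  \<open>B\<^sub>0\<close>. \<open>R\<close> and \<open>Q\<close> record which elements leave and
  enter, because agreement will be known only for some of the neighbours.\<close>

lemma pluecker_laplace: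
  assumes "pluecker p" "pluecker p'" and B0: "p B\<^sub>0 = p' B\<^sub>0" "p B\<^sub>0 \<noteq> 0" "finite B\<^sub>0"
    and neighbours: "\<And>b x. b \<in> R \<Longrightarrow> x \<in> Q \<Longrightarrow>
      p (insert x (B\<^sub>0 - {b})) = p' (insert x (B\<^sub>0 - {b}))"
    and "finite B" "card B = card B\<^sub>0" "B - B\<^sub>0 \<subseteq> Q" "B\<^sub>0 - B \<subseteq> R"
  shows "p B = p' B"
  using assms(7-)
proof (induction "card (B - B\<^sub>0)" arbitrary: B)
  case 0
  then have "B \<subseteq> B\<^sub>0" by auto
  then have "B = B\<^sub>0" using 0 B0(3) by (metis card_subset_eq)
  then show ?case using B0 by simp
next
  case (Suc n)
  then have "B - B\<^sub>0 \<noteq> {}" by (metis card.empty nat.distinct(1))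
  then obtain x where x: "x \<in> B - B\<^sub>0" by blast
  have "p (insert x (B\<^sub>0 - {b})) * p (insert b (B - {x})) = p' (insert x (B\<^sub>0 - {b})) * p' (insert b (B - {x}))"
    if b: "b \<in> B\<^sub>0 - B" for b
  proof -
    have "insert b (B - {x}) - B\<^sub>0 = B - B\<^sub>0 - {x}" using b by auto
    then have "card (insert b (B - {x}) - B\<^sub>0) = n" using Suc.hyps(2) x by simp
    moreover have "card (insert b (B - {x})) = card B\<^sub>0"
      using card_exchange[of B x b] Suc.prems(1,2) x b by (metis Diff_iff)
    ultimately have "p (insert b (B - {x})) = p' (insert b (B - {x}))"
      using Suc.prems x b by (intro Suc.hyps(1)) auto
    then show ?thesis using neighbours[of b x] Suc.prems x b by auto
  qed
  then have "p B\<^sub>0 * p B = p' B\<^sub>0 * p' B"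
    unfolding plueckerD[OF assms(1) x] plueckerD[OF assms(2) x] by (rule sum.cong[OF refl])
  then show ?case using B0 by simp
qed

text \<open>Scaling each column \<open>u\<close> by \<open>\<nu> u\<close> and all values by
  \<open>\<kappa>\<close>: both sides of a relation involve the same multiset of columns. Finiteness
  is required since \<open>prod\<close> is 1 on infinite sets.\<close>

lemma pluecker_gauge:
  fixes p :: "'a set \<Rightarrow> 'f::field"
  assumes "pluecker p" and fin: "\<And>B. p B \<noteq> 0 \<Longrightarrow> finite B"
  shows "pluecker (\<lambda>B. \<kappa> * prod \<nu> B * p B)"
  unfolding pluecker_def
proof (intro allI impI)
  fix B B' :: "'a set" and x assume x: "x \<in> B' - B"
  let ?q = "\<lambda>B. \<kappa> * prod \<nu> B * p B"
  have gp: "p B * p B' = (\<Sum>b\<in>B-B'. p (insert x (B - {b})) * p (insert b (B' - {x})))"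
    using assms(1) x unfolding pluecker_def by blast
  have "?q (insert x (B - {b})) * ?q (insert b (B' - {x})) =
      \<kappa> * \<kappa> * (prod \<nu> B * prod \<nu> B') * (p (insert x (B - {b})) * p (insert b (B' - {x})))"
    if b: "b \<in> B - B'" for b
  proof (cases "finite B \<and> finite B'")
    case True
    then have "prod \<nu> (insert x (B - {b})) * prod \<nu> (insert b (B' - {x})) =
        (\<nu> x * prod \<nu> (B' - {x})) * (\<nu> b * prod \<nu> (B - {b}))"
      using x b by simp
    also have "\<dots> = prod \<nu> B' * prod \<nu> B"
      using True x b by (simp add: prod.remove[symmetric])
    finally show ?thesis by (simp add: mult_ac)
  next
    case False
    then have "p (insert x (B - {b})) * p (insert b (B' - {x})) = 0"
      using fin by (metis finite_Diff2 finite_insert finite.emptyI mult_eq_0_iff)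
    then show ?thesis by auto
  qed
  then have "(\<Sum>b\<in>B-B'. ?q (insert x (B - {b})) * ?q (insert b (B' - {x}))) =
      \<kappa> * \<kappa> * (prod \<nu> B * prod \<nu> B') * (p B * p B')"
    unfolding gp sum_distrib_left by (rule sum.cong[OF refl])
  then show "?q B * ?q B' = (\<Sum>b\<in>B-B'. ?q (insert x (B - {b})) * ?q (insert b (B' - {x})))"
    by (simp add: mult_ac)
qed

lemma card_5_obtain:
  assumes "card P = 5"
  obtains a b d e f where "P = {a, b, d, e, f}" "distinct [a, b, d, e, f]"
proof -
  obtain xs where xs: "set xs = P" "distinct xs"
    using finite_distinct_list[of P] assms by (metis card.infinite zero_neq_numeral)
  then have "length xs = 5" using assms by (metis distinct_card)
  then obtain a b d e f where "xs = [a, b, d, e, f]"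
    by (auto simp: numeral_eq_Suc length_Suc_conv)
  then show thesis using that xs by auto
qed

lemma card_5_two:
  assumes "card P = 5" obtains a b where "a \<in> P" "b \<in> P" "a \<noteq> b"
proof -
  obtain a b d e f where "P = {a, b, d, e, f}" "distinct [a, b, d, e, f]"
    using card_5_obtain[OF assms] .
  then show thesis by (intro that[of a b]) auto
qed

section \<open>Rigidity over four elements\<close>

context gf4
begin

text \<open>The Frobenius map is additive and multiplicative, so it preserves the relations, and it
  also preserves the zeros.\<close>

lemma pluecker_square:
  fixes p :: "'a set \<Rightarrow> 'f"
  assumes "pluecker p"
  shows "pluecker (\<lambda>B. (p B)\<^sup>2)"
  unfolding pluecker_def power_mult_distrib[symmetric] square_sum[symmetric]
  using plueckerD[OF assms] by (intro allI impI arg_cong[of _ _ "\<lambda>z. z\<^sup>2"])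

text \<open>The values \<open>u / ab\<close>, \<open>v / ad\<close>, \<open>z / bd\<close> are distinct, and the primed ones differ from them by a
  common \<open>\<Delta>\<close>. If \<open>\<Delta> \<noteq> 0\<close>, none of the three is \<open>0\<close> or \<open>\<Delta>\<close>, so the field would have five elements.\<close>

lemma triangle_rigid:
  fixes t u v z u' v' z' :: 'f
  assumes nz: "ab \<noteq> 0" "ad \<noteq> 0" "bd \<noteq> 0" "ax \<noteq> 0" "bx \<noteq> 0" "dx \<noteq> 0" "t \<noteq> 0"
    and r: "ab * v = ad * u + ax * t" "ab * z = bd * u + bx * t" "ad * z = bd * v + dx * t"
    and r': "ab * v' = ad * u' + ax * t" "ab * z' = bd * u' + bx * t" "ad * z' = bd * v' + dx * t"
    and zero: "u = 0 \<longleftrightarrow> u' = 0" "v = 0 \<longleftrightarrow> v' = 0" "z = 0 \<longleftrightarrow> z' = 0"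
  shows "u = u'" "v = v'" "z = z'"
proof -
  define \<Delta> where "\<Delta> = u / ab - u' / ab"
  have v: "v / ad = u / ab + ax * t / (ab * ad)" and z: "z / bd = u / ab + bx * t / (ab * bd)"
    and zv: "z / bd = v / ad + dx * t / (ad * bd)"
    using r nz by (simp_all add: field_simps del: diff_char_2 minus_char_2)
  have v': "v' / ad = u' / ab + ax * t / (ab * ad)" and z': "z' / bd = u' / ab + bx * t / (ab * bd)"
    using r' nz by (simp_all add: field_simps del: diff_char_2 minus_char_2)
  have d: "u / ab = u' / ab + \<Delta>" "v / ad = v' / ad + \<Delta>" "z / bd = z' / bd + \<Delta>"
    unfolding v v' z z' \<Delta>_def by (simp_all add: algebra_simps del: diff_char_2 minus_char_2)
  have "\<Delta> = 0"
  proof (rule ccontr)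
    assume \<Delta>: "\<Delta> \<noteq> 0"
    have nz': "ax * t / (ab * ad) \<noteq> 0" "bx * t / (ab * bd) \<noteq> 0" "dx * t / (ad * bd) \<noteq> 0"
      using nz by auto
    have "u / ab \<noteq> v / ad" "u / ab \<noteq> z / bd" "v / ad \<noteq> z / bd"
      using nz' v z zv by auto
    moreover have "u \<noteq> 0" "v \<noteq> 0" "z \<noteq> 0" using zero d \<Delta> nz by auto
    moreover from this have "u / ab \<noteq> \<Delta>" "v / ad \<noteq> \<Delta>" "z / bd \<noteq> \<Delta>" using zero d nz by auto
    ultimately have "distinct [0, \<Delta>, u / ab, v / ad, z / bd]" using \<Delta> nz by auto
    then show False using not_five_distinct by blast
  qed
  then show "u = u'" "v = v'" "z = z'" using d nz by auto
qed

text \<open>Here and in the next lemmas, \<open>\<tau> i j k\<close> stands for \<open>p (T \<union> {i, j, k})\<close> and \<open>s i j\<close> for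
  \<open>p (T \<union> {c, i, j})\<close>, where \<open>T\<close> and \<open>c \<notin> T\<close> are fixed; \<open>rel\<close> is the three-term relation.\<close>

lemma triples_proportional:
  fixes s :: "'a \<Rightarrow> 'a \<Rightarrow> 'f"
  assumes P: "card P = 5"
    and s: "\<And>i j. s i j = s j i" "\<And>i j. i \<in> P \<Longrightarrow> j \<in> P \<Longrightarrow> i \<noteq> j \<Longrightarrow> s i j \<noteq> 0"
    and sym: "\<And>i j k. \<tau> i j k = \<tau> j i k" "\<And>i j k. \<tau> i j k = \<tau> i k j"
    and sym': "\<And>i j k. \<tau>' i j k = \<tau>' j i k" "\<And>i j k. \<tau>' i j k = \<tau>' i k j"
    and rel: "\<And>i j k l. i \<in> P \<Longrightarrow> j \<in> P \<Longrightarrow> k \<in> P \<Longrightarrow> l \<in> P \<Longrightarrow> distinct [i, j, k, l] \<Longrightarrow>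
      s i j * \<tau> i k l = s i k * \<tau> i j l + s i l * \<tau> i j k"
    and rel': "\<And>i j k l. i \<in> P \<Longrightarrow> j \<in> P \<Longrightarrow> k \<in> P \<Longrightarrow> l \<in> P \<Longrightarrow> distinct [i, j, k, l] \<Longrightarrow>
      s i j * \<tau>' i k l = s i k * \<tau>' i j l + s i l * \<tau>' i j k"
    and zero: "\<And>i j k. i \<in> P \<Longrightarrow> j \<in> P \<Longrightarrow> k \<in> P \<Longrightarrow> distinct [i, j, k] \<Longrightarrow> \<tau> i j k = 0 \<longleftrightarrow> \<tau>' i j k = 0"
    and ex: "a \<in> P" "b \<in> P" "d \<in> P" "distinct [a, b, d]" "\<tau> a b d \<noteq> 0"
  obtains \<rho> where "\<rho> \<noteq> 0" "\<And>i j k. i \<in> P \<Longrightarrow> j \<in> P \<Longrightarrow> k \<in> P \<Longrightarrow> distinct [i, j, k] \<Longrightarrow> \<tau>' i j k = \<rho> * \<tau> i j k"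
proof -
  \<comment> \<open>After division of \<open>\<tau>'\<close> by \<open>\<rho>\<close>, both
    functions have the same value at \<open>a\<close>, \<open>b\<close>, \<open>d\<close>; this is
    the common \<open>t\<close> of \<open>triangle_rigid\<close>.\<close>
  define \<rho> where "\<rho> = \<tau>' a b d / \<tau> a b d"
  have \<rho>: "\<rho> \<noteq> 0" using ex zero unfolding \<rho>_def by auto
  let ?\<sigma> = "\<lambda>i j k. \<tau>' i j k / \<rho>"
  have abd: "?\<sigma> a b d = \<tau> a b d" using ex \<rho> unfolding \<rho>_def by simp
  have rel_\<sigma>: "s i j * ?\<sigma> i k l = s i k * ?\<sigma> i j l + s i l * ?\<sigma> i j k"
    if "i \<in> P" "j \<in> P" "k \<in> P" "l \<in> P" "distinct [i, j, k, l]" for i j k l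
    using rel'[OF that] \<rho> by (simp add: field_simps del: diff_char_2 minus_char_2)
  have step: "?\<sigma> a b x = \<tau> a b x \<and> ?\<sigma> a d x = \<tau> a d x \<and> ?\<sigma> b d x = \<tau> b d x"
    if x: "x \<in> P" "x \<notin> {a, b, d}" for x
  proof -
    have d: "distinct [a, b, d, x]" "distinct [b, a, d, x]" "distinct [d, a, b, x]"
      "distinct [a, b, x]" "distinct [a, d, x]" "distinct [b, d, x]"
      using x ex by auto
    have nz: "s a b \<noteq> 0" "s a d \<noteq> 0" "s b d \<noteq> 0" "s a x \<noteq> 0" "s b x \<noteq> 0" "s d x \<noteq> 0"
      using x ex by (auto simp: s(2))
    have e: "\<tau> b a d = \<tau> a b d" "\<tau> d a b = \<tau> a b d" "\<tau> b a x = \<tau> a b x" "\<tau> d a x = \<tau> a d x" "\<tau> d b x = \<tau> b d x"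
      "\<tau>' b a d = \<tau>' a b d" "\<tau>' d a b = \<tau>' a b d" "\<tau>' b a x = \<tau>' a b x" "\<tau>' d a x = \<tau>' a d x" "\<tau>' d b x = \<tau>' b d x"
      "s b a = s a b" "s d a = s a d" "s d b = s b d"
      by (metis sym sym' s(1))+
    have z0: "\<tau> i j k = 0 \<longleftrightarrow> ?\<sigma> i j k = 0" if "i \<in> P" "j \<in> P" "k \<in> P" "distinct [i, j, k]" for i j k
      using zero[OF that] \<rho> by simp
    note T = triangle_rigid[OF nz ex(5)
      rel[OF ex(1,2,3) x(1) d(1)] rel[OF ex(2,1,3) x(1) d(2), unfolded e] rel[OF ex(3,1,2) x(1) d(3), unfolded e]
      rel_\<sigma>[OF ex(1,2,3) x(1) d(1), unfolded abd] rel_\<sigma>[OF ex(2,1,3) x(1) d(2), unfolded e abd]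
      rel_\<sigma>[OF ex(3,1,2) x(1) d(3), unfolded e abd]
      z0[OF ex(1,2) x(1) d(4)] z0[OF ex(1,3) x(1) d(5)] z0[OF ex(2,3) x(1) d(6)]]
    show ?thesis using T by simp
  qed
  have "card (P - {a, b, d}) = 2" using P ex by (subst card_Diff_subset) auto
  then obtain e f where "P - {a, b, d} = {e, f}" "e \<noteq> f" by (meson card_2_iff)
  then have ef: "P = {a, b, d, e, f}" "distinct [a, b, d, e, f]" using ex by auto
  \<comment> \<open>The remaining triples contain both \<open>e\<close> and \<open>f\<close>; the
    relation based at \<open>x\<close> computes them from triples already settled.\<close>
  have last: "?\<sigma> x e f = \<tau> x e f" if "x \<in> P" "y \<in> P" "distinct [x, y, e, f]"
      "?\<sigma> x y e = \<tau> x y e" "?\<sigma> x y f = \<tau> x y f" for x y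
  proof -
    have "s x y * ?\<sigma> x e f = s x y * \<tau> x e f"
      using rel[OF that(1,2) _ _ that(3)] rel_\<sigma>[OF that(1,2) _ _ that(3)] that(4,5) ef(1) by simp
    moreover have "s x y \<noteq> 0" using s(2)[OF that(1,2)] that(3) by simp
    ultimately show ?thesis using mult_left_cancel by blast
  qed
  have "?\<sigma> a b e = \<tau> a b e" "?\<sigma> a d e = \<tau> a d e" "?\<sigma> b d e = \<tau> b d e"
    "?\<sigma> a b f = \<tau> a b f" "?\<sigma> a d f = \<tau> a d f" "?\<sigma> b d f = \<tau> b d f"
    using step[of e] step[of f] ef by auto
  moreover from this have "?\<sigma> a e f = \<tau> a e f" "?\<sigma> b e f = \<tau> b e f" "?\<sigma> d e f = \<tau> d e f"
    using last[of a b] last[of b a] last[of d a] ef sym sym' by auto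
  moreover note abd
  ultimately have all: "\<tau>' a b e = \<rho> * \<tau> a b e" "\<tau>' a d e = \<rho> * \<tau> a d e" "\<tau>' b d e = \<rho> * \<tau> b d e"
    "\<tau>' a b f = \<rho> * \<tau> a b f" "\<tau>' a d f = \<rho> * \<tau> a d f" "\<tau>' b d f = \<rho> * \<tau> b d f"
    "\<tau>' a e f = \<rho> * \<tau> a e f" "\<tau>' b e f = \<rho> * \<tau> b e f" "\<tau>' d e f = \<rho> * \<tau> d e f" "\<tau>' a b d = \<rho> * \<tau> a b d"
    using \<rho> by (simp_all add: field_simps del: diff_char_2 minus_char_2)
  have "\<tau>' i j k = \<rho> * \<tau> i j k" if "i \<in> P" "j \<in> P" "k \<in> P" "distinct [i, j, k]" for i j k
  proof -
    have perm: "\<tau>' j i k = \<rho> * \<tau> j i k" "\<tau>' i k j = \<rho> * \<tau> i k j" "\<tau>' k j i = \<rho> * \<tau> k j i"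
      "\<tau>' j k i = \<rho> * \<tau> j k i" "\<tau>' k i j = \<rho> * \<tau> k i j" if "\<tau>' i j k = \<rho> * \<tau> i j k" for i j k
      using that by (metis sym sym')+
    show ?thesis
      using that unfolding ef(1)
      by (elim insertE emptyE) (simp_all add: all all[THEN perm(1)] all[THEN perm(2)] all[THEN perm(3)]
        all[THEN perm(4)] all[THEN perm(5)])
  qed
  then show thesis using that \<rho> by blast
qed

text \<open>Adds one point \<open>x\<close> to a configuration on which the two functions already
  agree. Only three of the values \<open>s i x\<close> are required to be nonzero, because
  \<open>x\<close> may be parallel to a point of \<open>P\<close>. One value is fixed by
  \<open>triangle_rigid\<close> and the others follow by the relations.\<close>

lemma triples_extend:
  fixes s :: "'a \<Rightarrow> 'a \<Rightarrow> 'f"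
  assumes x: "x \<notin> P"
    and s: "\<And>i j. s i j = s j i" "\<And>i j. i \<in> P \<Longrightarrow> j \<in> P \<Longrightarrow> i \<noteq> j \<Longrightarrow> s i j \<noteq> 0"
    and sym: "\<And>i j k. \<tau> i j k = \<tau> j i k" "\<And>i j k. \<tau> i j k = \<tau> i k j"
    and sym': "\<And>i j k. \<tau>' i j k = \<tau>' j i k" "\<And>i j k. \<tau>' i j k = \<tau>' i k j"
    and rel: "\<And>i j k. i \<in> P \<Longrightarrow> j \<in> P \<Longrightarrow> k \<in> P \<Longrightarrow> distinct [i, j, k] \<Longrightarrow>
      s i j * \<tau> i k x = s i k * \<tau> i j x + s i x * \<tau> i j k"
    and rel': "\<And>i j k. i \<in> P \<Longrightarrow> j \<in> P \<Longrightarrow> k \<in> P \<Longrightarrow> distinct [i, j, k] \<Longrightarrow>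
      s i j * \<tau>' i k x = s i k * \<tau>' i j x + s i x * \<tau>' i j k"
    and eq: "\<And>i j k. i \<in> P \<Longrightarrow> j \<in> P \<Longrightarrow> k \<in> P \<Longrightarrow> distinct [i, j, k] \<Longrightarrow> \<tau> i j k = \<tau>' i j k"
    and zero: "\<And>i j. i \<in> P \<Longrightarrow> j \<in> P \<Longrightarrow> i \<noteq> j \<Longrightarrow> \<tau> i j x = 0 \<longleftrightarrow> \<tau>' i j x = 0"
    and ex: "a \<in> P" "b \<in> P" "d \<in> P" "distinct [a, b, d]" "\<tau> a b d \<noteq> 0"
    and sx: "s a x \<noteq> 0" "s b x \<noteq> 0" "s d x \<noteq> 0"
    and ij: "i \<in> P" "j \<in> P" "i \<noteq> j"
  shows "\<tau> i j x = \<tau>' i j x"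
proof -
  have d: "distinct [b, a, d]" "distinct [d, a, b]" "a \<noteq> b" "a \<noteq> d" "b \<noteq> d" using ex(4) by auto
  have e: "\<tau> b a d = \<tau> a b d" "\<tau> d a b = \<tau> a b d" "\<tau> b a x = \<tau> a b x" "\<tau> d a x = \<tau> a d x" "\<tau> d b x = \<tau> b d x"
    "\<tau>' b a d = \<tau>' a b d" "\<tau>' d a b = \<tau>' a b d" "\<tau>' b a x = \<tau>' a b x" "\<tau>' d a x = \<tau>' a d x" "\<tau>' d b x = \<tau>' b d x"
    "s b a = s a b" "s d a = s a d" "s d b = s b d"
    by (metis sym sym' s(1))+
  have nz: "s a b \<noteq> 0" "s a d \<noteq> 0" "s b d \<noteq> 0" using ex by (auto simp: s(2))
  have abx: "\<tau> a b x = \<tau>' a b x"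
    using triangle_rigid(1)[OF nz sx ex(5), of "\<tau> a d x" "\<tau> a b x" "\<tau> b d x" "\<tau>' a d x" "\<tau>' a b x" "\<tau>' b d x"]
      rel[OF ex(1-4), unfolded e] rel[OF ex(2,1,3) d(1), unfolded e] rel[OF ex(3,1,2) d(2), unfolded e]
      rel'[OF ex(1-4), unfolded e] rel'[OF ex(2,1,3) d(1), unfolded e] rel'[OF ex(3,1,2) d(2), unfolded e]
      zero[OF ex(1,2) d(3)] zero[OF ex(1,3) d(4)] zero[OF ex(2,3) d(5)] eq[OF ex(1-4)] by simp
  have move: "\<tau> k l x = \<tau>' k l x"
    if "\<tau> k m x = \<tau>' k m x" "k \<in> P" "l \<in> P" "m \<in> P" "k \<noteq> m" "k \<noteq> l" for k l m
  proof (cases "l = m")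
    case False
    then have "distinct [k, m, l]" using that by auto
    then have "s k m * \<tau> k l x = s k m * \<tau>' k l x"
      unfolding rel[OF that(2,4,3) \<open>distinct [k, m, l]\<close>] rel'[OF that(2,4,3) \<open>distinct [k, m, l]\<close>]
      using that(1) eq[OF that(2,4,3) \<open>distinct [k, m, l]\<close>] by simp
    then show ?thesis using s(2)[OF that(2,4,5)] by simp
  qed (use that in simp)
  show ?thesis
  proof (cases "i = a")
    case True
    then show ?thesis using move[OF abx] ex ij by auto
  next
    case False
    then have "\<tau> a i x = \<tau>' a i x" using move[OF abx] ex ij by auto
    then have "\<tau> i a x = \<tau>' i a x" by (metis sym sym')
    then show ?thesis using move[of i a j] ex ij False by auto
  qed
qed

end

section \<open>Five points on a projective line\<close>

text \<open>Contracting \<open>S\<close> and restricting to \<open>P\<close> gives \<open>U\<^bsub>2,5\<^esub>\<close>.\<close>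

definition five_points :: "('a set \<Rightarrow> 'f::zero) \<Rightarrow> 'a set \<Rightarrow> 'a set \<Rightarrow> bool" where
  "five_points p S P \<longleftrightarrow> S \<inter> P = {} \<and> card P = 5 \<and>
    (\<forall>i\<in>P. \<forall>j\<in>P. i \<noteq> j \<longrightarrow> p (insert i (insert j S)) \<noteq> 0)"

lemma five_pointsD:
  assumes "five_points p S P"
  shows "S \<inter> P = {}" "card P = 5" "finite P"
    "\<And>i j. i \<in> P \<Longrightarrow> j \<in> P \<Longrightarrow> i \<noteq> j \<Longrightarrow> p (insert i (insert j S)) \<noteq> 0"
  using assms by (auto simp: five_points_def intro: card_ge_0_finite)

text \<open>Any two pairs of \<open>P\<close> are connected by moves that change one endpoint at a
  time.\<close>

lemma pairs_propagate:
  assumes "\<And>i j. \<Phi> i j \<Longrightarrow> \<Phi> j i"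
    and "\<And>i j k. i \<in> P \<Longrightarrow> j \<in> P \<Longrightarrow> k \<in> P \<Longrightarrow> distinct [i, j, k] \<Longrightarrow> \<Phi> i j \<Longrightarrow> \<Phi> i k"
    and "a \<in> P" "b \<in> P" "a \<noteq> b" "\<Phi> a b" "i \<in> P" "j \<in> P" "i \<noteq> j"
  shows "\<Phi> i j"
proof -
  have 1: "\<Phi> a k" if "k \<in> P" "k \<noteq> a" for k
  proof (cases "k = b")
    case False
    then have "distinct [a, b, k]" using assms(5) that by simp
    then show ?thesis using assms(2)[OF assms(3,4) that(1)] assms(6) by blast
  qed (use assms(6) in simp)
  show ?thesis
  proof (cases "i = a \<or> j = a")
    case False
    then have "\<Phi> i a" using 1[OF assms(7)] assms(1) by blast
    moreover have "distinct [i, a, j]" using False assms(9) by auto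
    ultimately show ?thesis using assms(2)[OF assms(7,3,8)] by blast
  next
    case True
    then show ?thesis using 1[OF assms(8)] 1[OF assms(7)] assms(1)[of j i] assms(9) by blast
  qed
qed

text \<open>The hypothesis \<open>degenerate\<close> kills one product in the relation based at
  \<open>i\<close>. The two remaining products are then equal, so nonvanishing spreads from the pair
  \<open>a\<close>, \<open>b\<close> to all pairs.\<close>

lemma five_points_swap:
  assumes p: "pluecker p" and pts: "five_points p (insert c T) P" and c: "c \<notin> T"
    and x: "x \<notin> insert c T" "x \<notin> P"
    and degenerate: "\<And>i j k. i \<in> P \<Longrightarrow> j \<in> P \<Longrightarrow> k \<in> P \<Longrightarrow> distinct [i, j, k] \<Longrightarrow>
      p (insert i (insert c (insert x T))) = 0 \<or> p (insert i (insert j (insert k T))) = 0"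
    and ab: "a \<in> P" "b \<in> P" "a \<noteq> b" "p (insert a (insert b (insert x T))) \<noteq> 0"
  shows "five_points p (insert x T) P"
  unfolding five_points_def
proof (intro conjI ballI impI)
  note P = five_pointsD[OF pts]
  fix i j assume ij: "i \<in> P" "j \<in> P" "i \<noteq> j"
  show "p (insert i (insert j (insert x T))) \<noteq> 0"
  proof (rule pairs_propagate[of "\<lambda>i j. p (insert i (insert j (insert x T))) \<noteq> 0" P a b i j, OF _ _ ab ij])
    fix i j k assume ijk: "i \<in> P" "j \<in> P" "k \<in> P" "distinct [i, j, k]"
      "p (insert i (insert j (insert x T))) \<noteq> 0"
    have "i \<noteq> c" "j \<noteq> c" "k \<noteq> c" "x \<noteq> c" "i \<noteq> x" "j \<noteq> x" "k \<noteq> x" and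
      nT: "j \<notin> T" "k \<notin> T" "x \<notin> T"
      using ijk(1-3) x P(1) by blast+
    then have d: "distinct [i, c, x, j, k]" using ijk(4) by simp
    have "p (insert i (insert c (insert j T))) \<noteq> 0" "p (insert i (insert c (insert k T))) \<noteq> 0"
      using P(4)[OF ijk(1,2)] P(4)[OF ijk(1,3)] ijk(4) by (simp_all add: insert_commute)
    moreover have "p (insert i (insert x (insert j T))) \<noteq> 0"
      using ijk(5) by (simp add: insert_commute)
    ultimately have "p (insert i (insert x (insert k T))) \<noteq> 0"
      using pluecker_three_term_base[OF p d c nT(3,1,2)] degenerate[OF ijk(1-4)] by auto
    then show "p (insert i (insert k (insert x T))) \<noteq> 0" by (simp add: insert_commute)
  qed (simp add: insert_commute)
qed (use five_pointsD(1,2)[OF pts] x in auto)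

context gf4
begin

text \<open>\<open>r u\<close> is the coordinate of \<open>u\<close> on the line, with
  \<open>a\<close> at 0 and \<open>b\<close> at infinity. A sixth point would give four distinct
  nonzero coordinates besides 0.\<close>

lemma six_points:
  fixes p :: "'a set \<Rightarrow> 'f"
  assumes p: "pluecker p" "five_points p S P" and x: "x \<notin> S" "x \<notin> P"
  shows "\<exists>n\<in>P. p (insert x (insert n S)) = 0"
proof (rule ccontr)
  assume nz: "\<not> ?thesis"
  obtain a b d e f where P: "P = {a, b, d, e, f}" "distinct [a, b, d, e, f]"
    using card_5_obtain five_pointsD(2)[OF p(2)] by metis
  define r where "r u = p (insert a (insert u S)) / p (insert b (insert u S))" for u
  have q: "p (insert i (insert j S)) \<noteq> 0" if "i \<in> insert x P" "j \<in> insert x P" "i \<noteq> j" for i j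
    using that nz five_pointsD(4)[OF p(2)] by (auto simp: insert_commute)
  have notin: "i \<notin> S" if "i \<in> insert x P" for i
    using that x five_pointsD(1)[OF p(2)] by auto
  have abP: "a \<in> insert x P" "b \<in> insert x P" using P by auto
  have ruv: "r u \<noteq> r v" if uv: "u \<in> insert x P" "v \<in> insert x P" "distinct [a, b, u, v]" for u v
  proof
    assume eq: "r u = r v"
    have nz: "p (insert b (insert u S)) \<noteq> 0" "p (insert b (insert v S)) \<noteq> 0"
        "p (insert a (insert b S)) * p (insert u (insert v S)) \<noteq> 0"
      using q[OF abP(2) uv(1)] q[OF abP(2) uv(2)] q[OF abP] q[OF uv(1,2)] uv(3) by auto
    have "p (insert a (insert u S)) * p (insert b (insert v S)) =
        p (insert a (insert v S)) * p (insert b (insert u S))"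
      using eq nz(1,2) unfolding r_def by (simp add: frac_eq_eq)
    then show False
      using pluecker_three_term[OF p(1) uv(3) notin[OF abP(1)] notin[OF abP(2)] notin[OF uv(1)] notin[OF uv(2)]] nz(3)
      by simp
  qed
  have r0: "r u \<noteq> 0" if "u \<in> insert x P" "a \<noteq> u" "b \<noteq> u" for u
    using that q[OF abP(1) that(1)] q[OF abP(2) that(1)] unfolding r_def by auto
  have in_P: "d \<in> insert x P" "e \<in> insert x P" "f \<in> insert x P" "x \<in> insert x P" using P by auto
  have ne: "distinct [a, b, d, e, f, x]" using P x by auto
  have "distinct [0, r d, r e, r f, r x]"
    using ne r0[OF in_P(1)] r0[OF in_P(2)] r0[OF in_P(3)] r0[OF in_P(4)]
      ruv[OF in_P(1,2)] ruv[OF in_P(1,3)] ruv[OF in_P(1,4)] ruv[OF in_P(2,3)] ruv[OF in_P(2,4)] ruv[OF in_P(3,4)]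
    by simp
  then show False using not_five_distinct by blast
qed

text \<open>A point that is not a loop cannot be parallel to both \<open>n\<close> and
  \<open>i\<close>, as these are not parallel to each other.\<close>

lemma parallel_unique:
  fixes p :: "'a set \<Rightarrow> 'f"
  assumes p: "pluecker p" "five_points p S P" and x: "x \<notin> S" "x \<notin> P"
    and n: "n \<in> P" "p (insert x (insert n S)) = 0"
    and j: "j \<in> P" "p (insert x (insert j S)) \<noteq> 0"
    and i: "i \<in> P" "i \<noteq> n"
  shows "p (insert x (insert i S)) \<noteq> 0"
proof
  assume i0: "p (insert x (insert i S)) = 0"
  have "x \<noteq> j" "x \<noteq> n" "x \<noteq> i" using n i j x by blast+
  moreover have "j \<noteq> n" "j \<noteq> i" using n j i0 by blast+
  ultimately have d: "distinct [x, j, n, i]" using i by simp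
  have notin: "j \<notin> S" "n \<notin> S" "i \<notin> S" using five_pointsD(1)[OF p(2)] n i j by blast+
  have "p (insert x (insert j S)) * p (insert n (insert i S)) = 0"
    using pluecker_three_term[OF p(1) d x(1) notin] n(2) i0 by simp
  then show False using j five_pointsD(4)[OF p(2) n(1) i(1)] i by simp
qed

text \<open>In rank 3, the lines through two of \<open>l\<close>, \<open>m\<close>, \<open>c\<close> meet the line of \<open>i\<close>, \<open>j\<close>, \<open>k\<close> in three
  distinct points, and this line has only two points besides \<open>i\<close>, \<open>j\<close>, \<open>k\<close>.\<close>

lemma third_collinear_triple:
  fixes s :: "'a \<Rightarrow> 'a \<Rightarrow> 'f"
  assumes d: "distinct [i, j, k, l, m]" and P: "P = {i, j, k, l, m}"
    and s: "\<And>i j. s i j = s j i" "\<And>i j. i \<in> P \<Longrightarrow> j \<in> P \<Longrightarrow> i \<noteq> j \<Longrightarrow> s i j \<noteq> 0"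
    and sym: "\<And>i j k. \<tau> i j k = \<tau> j i k" "\<And>i j k. \<tau> i j k = \<tau> i k j"
    and ss: "\<And>i j k l. i \<in> P \<Longrightarrow> j \<in> P \<Longrightarrow> k \<in> P \<Longrightarrow> l \<in> P \<Longrightarrow> distinct [i, j, k, l] \<Longrightarrow>
      s i j * s k l = s i k * s j l + s i l * s j k"
    and s\<tau>: "\<And>i j k l. i \<in> P \<Longrightarrow> j \<in> P \<Longrightarrow> k \<in> P \<Longrightarrow> l \<in> P \<Longrightarrow> distinct [i, j, k, l] \<Longrightarrow>
      s i j * \<tau> i k l = s i k * \<tau> i j l + s i l * \<tau> i j k"
    and \<tau>\<tau>: "\<And>h i j k l. h \<in> P \<Longrightarrow> i \<in> P \<Longrightarrow> j \<in> P \<Longrightarrow> k \<in> P \<Longrightarrow> l \<in> P \<Longrightarrow> distinct [h, i, j, k, l] \<Longrightarrow>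
      \<tau> h i j * \<tau> h k l = \<tau> h i k * \<tau> h j l + \<tau> h i l * \<tau> h j k"
    and zero: "\<tau> i j k = 0"
    and nz: "\<tau> i j l \<noteq> 0" "\<tau> i j m \<noteq> 0" "\<tau> i k l \<noteq> 0" "\<tau> i k m \<noteq> 0" "\<tau> j k l \<noteq> 0" "\<tau> j k m \<noteq> 0"
  shows "\<tau> i l m = 0 \<or> \<tau> j l m = 0 \<or> \<tau> k l m = 0"
proof (rule ccontr)
  assume n: "\<not> ?thesis"
  \<comment> \<open>Coordinates on the line of \<open>i\<close> and \<open>j\<close>, with
    \<open>i\<close> at 0 and \<open>j\<close> at infinity: \<open>\<kappa>\<close> is the point
    \<open>k\<close>, \<open>s i l / s j l\<close> is the intersection with the line through
    \<open>c\<close> and \<open>l\<close>, similarly for \<open>m\<close>, and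
    \<open>\<tau> i l m / \<tau> j l m\<close> is the intersection with the line through
    \<open>l\<close> and \<open>m\<close>.\<close>
  define \<kappa> where "\<kappa> = s i k / s j k"
  have in_P: "i \<in> P" "j \<in> P" "k \<in> P" "l \<in> P" "m \<in> P" using P by auto
  have ne: "i \<noteq> j" "i \<noteq> k" "i \<noteq> l" "i \<noteq> m" "j \<noteq> k" "j \<noteq> l" "j \<noteq> m" "k \<noteq> l" "k \<noteq> m" "l \<noteq> m"
    using d by auto
  have sn: "s i j \<noteq> 0" "s i k \<noteq> 0" "s i l \<noteq> 0" "s i m \<noteq> 0" "s j k \<noteq> 0" "s j l \<noteq> 0" "s j m \<noteq> 0"
    "s k l \<noteq> 0" "s k m \<noteq> 0" "s l m \<noteq> 0"
    using ne in_P by (auto simp: s(2))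
  have e: "\<tau> l i j = \<tau> i j l" "\<tau> l m i = \<tau> i l m" "\<tau> l m j = \<tau> j l m" "\<tau> m i j = \<tau> i j m" "\<tau> m l i = \<tau> i l m"
    "\<tau> m l j = \<tau> j l m" "\<tau> l i k = \<tau> i k l" "\<tau> l j k = \<tau> j k l" "\<tau> l k m = \<tau> k l m" "\<tau> k i j = \<tau> i j k"
    "\<tau> k l i = \<tau> i k l" "\<tau> k l j = \<tau> j k l" "\<tau> l j m = \<tau> j l m" "\<tau> l i m = \<tau> i l m"
    "s l i = s i l" "s l j = s j l" "s m i = s i m" "s m j = s j m" "s k i = s i k" "s k j = s j k" "s m l = s l m"
    by (metis sym s(1))+
  have cross: "a / b \<noteq> c / d'" if "u * v = c * b + d' * a" "u \<noteq> 0" "v \<noteq> 0" "b \<noteq> 0" "d' \<noteq> 0" for a b c d' u v :: 'f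
  proof
    assume "a / b = c / d'"
    then have "a * d' = c * b" using that(4,5) by (simp add: frac_eq_eq)
    then have "u * v = 0" using that(1) by (simp add: mult.commute)
    then show False using that by simp
  qed
  have D: "distinct [k, l, i, j]" "distinct [l, m, i, j]" "distinct [m, l, i, j]" "distinct [i, j, k, l]" "distinct [i, j, k, m]"
    "distinct [i, j, l, m]" "distinct [l, i, j, k, m]"
    using ne by auto
  have "s k l * \<tau> i j k = s i k * \<tau> j k l + s j k * \<tau> i k l"
    using s\<tau>[OF in_P(3,4,1,2) D(1)] unfolding e .
  then have "s i k * \<tau> j k l = \<tau> i k l * s j k" using zero by (simp add: add_eq_0_iff_eq mult.commute)
  then have \<kappa>: "\<kappa> = \<tau> i k l / \<tau> j k l" unfolding \<kappa>_def using sn nz by (simp add: frac_eq_eq)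
  have 1: "\<tau> i l m / \<tau> j l m \<noteq> s i l / s j l"
    using s\<tau>[OF in_P(4,5,1,2) D(2), unfolded e] sn nz n by (intro cross[of "s l m" "\<tau> i j l"]) auto
  have 2: "\<tau> i l m / \<tau> j l m \<noteq> s i m / s j m"
    using s\<tau>[OF in_P(5,4,1,2) D(3), unfolded e] sn nz n by (intro cross[of "s l m" "\<tau> i j m"]) auto
  have cross': "a / b \<noteq> c / d'" if "u * v = a * d' + c * b" "u \<noteq> 0" "v \<noteq> 0" "b \<noteq> 0" "d' \<noteq> 0" for a b c d' u v :: 'f
    using that by (intro cross[of u v]) (simp_all add: ac_simps)
  have 3: "s i l / s j l \<noteq> s i m / s j m"
    using ss[OF in_P(1,2,4,5) D(6)] sn by (intro cross'[of "s i j" "s l m"]) auto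
  have 4: "\<kappa> \<noteq> s i l / s j l" unfolding \<kappa>_def
    using ss[OF in_P(1,2,3,4) D(4)] sn by (intro cross'[of "s i j" "s k l"]) auto
  have 5: "\<kappa> \<noteq> s i m / s j m" unfolding \<kappa>_def
    using ss[OF in_P(1,2,3,5) D(5)] sn by (intro cross'[of "s i j" "s k m"]) auto
  have 6: "\<kappa> \<noteq> \<tau> i l m / \<tau> j l m" unfolding \<kappa>
    using \<tau>\<tau>[OF in_P(4,1,2,3,5) D(7), unfolded e] n nz by (intro cross'[of "\<tau> i j l" "\<tau> k l m"]) auto
  have "\<kappa> \<noteq> 0" "\<tau> i l m / \<tau> j l m \<noteq> 0" "s i l / s j l \<noteq> 0" "s i m / s j m \<noteq> 0"
    using sn n unfolding \<kappa>_def by auto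
  then have "distinct [0, \<kappa>, \<tau> i l m / \<tau> j l m, s i l / s j l, s i m / s j m]"
    using 1 2 3 4 5 6 by (auto simp only: distinct.simps list.set insert_iff empty_iff)
  then show False using not_five_distinct by blast
qed

text \<open>\<open>U\<^bsub>2,5\<^esub>\<close> has a unique representation up to scaling and the Frobenius automorphism, which exchanges
  \<open>w\<close> and \<open>w + 1\<close>.\<close>

lemma normal_form:
  fixes p :: "'a set \<Rightarrow> 'f" and w :: 'f
  assumes p: "pluecker p" "\<And>B. p B \<noteq> 0 \<Longrightarrow> finite B" and pts: "five_points p S {a, b, d, e, f}"
    and dist: "distinct [a, b, d, e, f]" and w: "w \<noteq> 0" "w \<noteq> 1"
  obtains q :: "'a set \<Rightarrow> 'f" where "pluecker q" "\<And>B. q B = 0 \<longleftrightarrow> p B = 0"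
    "q (insert a (insert b S)) = 1" "q (insert a (insert d S)) = 1" "q (insert a (insert e S)) = 1"
    "q (insert a (insert f S)) = 1" "q (insert b (insert d S)) = 1" "q (insert b (insert e S)) = w"
    "q (insert b (insert f S)) = w + 1"
proof -
  let ?P = "{a, b, d, e, f}"
  let ?s = "\<lambda>p i j. p (insert i (insert j S))"
  have nz: "?s p i j \<noteq> 0" if "i \<in> ?P" "j \<in> ?P" "i \<noteq> j" for i j
    using five_pointsD(4)[OF pts] that by blast
  have notin: "i \<notin> S" if "i \<in> ?P" for i using five_pointsD(1)[OF pts] that by blast
  have fin: "finite S" using p(2)[OF nz[of a b]] dist by auto
  \<comment> \<open>The factors \<open>\<nu>\<close> turn all pairs containing \<open>a\<close> into
    1, whatever \<open>K\<close> is. The value at \<open>b\<close>, \<open>d\<close> then becomes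
    \<open>?s p b d / (?s p a b * ?s p a d * K)\<close>, so \<open>K\<close> is chosen to make it
    1.\<close>
  define K where "K = ?s p b d / (?s p a b * ?s p a d)"
  define \<nu> where "\<nu> u = (if u = b then 1 / (K * ?s p a b) else if u \<in> {d, e, f} then 1 / (K * ?s p a u) else 1)" for u
  define q where "q B = K * prod \<nu> B * p B" for B
  have K: "K \<noteq> 0" unfolding K_def using nz dist by auto
  have \<nu>: "\<nu> u \<noteq> 0" for u unfolding \<nu>_def using K nz dist by auto
  have q: "pluecker q" unfolding q_def using pluecker_gauge[OF p] .
  have q0: "q B = 0 \<longleftrightarrow> p B = 0" for B
    unfolding q_def using K \<nu> by (cases "finite B") auto
  have \<nu>_simps: "\<nu> a = 1" "\<nu> b = 1 / (K * ?s p a b)" "\<nu> d = 1 / (K * ?s p a d)"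
      "\<nu> e = 1 / (K * ?s p a e)" "\<nu> f = 1 / (K * ?s p a f)"
    using dist unfolding \<nu>_def by simp_all
  have \<nu>1: "\<nu> u = 1" if "u \<in> S" for u
    using notin that unfolding \<nu>_def by auto
  have \<nu>S: "prod \<nu> S = 1" using \<nu>1 by (rule prod.neutral[OF ballI])
  have s: "?s q i j = K * (\<nu> i * \<nu> j) * ?s p i j" if "i \<in> ?P" "j \<in> ?P" "i \<noteq> j" for i j
  proof -
    have "prod \<nu> (insert i (insert j S)) = \<nu> i * \<nu> j"
      using notin[OF that(1)] notin[OF that(2)] that(3) fin \<nu>S by simp
    then show ?thesis unfolding q_def by simp
  qed
  have ne: "a \<noteq> b" "a \<noteq> d" "a \<noteq> e" "a \<noteq> f" "b \<noteq> d" "b \<noteq> e" "b \<noteq> f" "d \<noteq> e" "d \<noteq> f" "e \<noteq> f"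
    using dist by auto
  have nza: "?s p a b \<noteq> 0" "?s p a d \<noteq> 0" "?s p a e \<noteq> 0" "?s p a f \<noteq> 0" "?s p b d \<noteq> 0"
    "?s p b e \<noteq> 0" "?s p b f \<noteq> 0" "?s p d e \<noteq> 0" "?s p d f \<noteq> 0" "?s p e f \<noteq> 0"
    using ne by (intro nz; simp)+
  have au: "?s q a b = 1" "?s q a d = 1" "?s q a e = 1" "?s q a f = 1"
    using s[of a b] s[of a d] s[of a e] s[of a f] ne nza K by (simp_all add: \<nu>_simps)
  have "?s q b d = K * (1 / (K * ?s p a b) * (1 / (K * ?s p a d))) * ?s p b d"
    using s[of b d] ne by (simp add: \<nu>_simps)
  also have "\<dots> = ?s p b d / (?s p a b * ?s p a d) / K" using K nza by (simp add: field_simps)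
  also have "\<dots> = 1" using K unfolding K_def by simp
  finally have bd: "?s q b d = 1" .
  have notin': "a \<notin> S" "b \<notin> S" "d \<notin> S" "e \<notin> S" "f \<notin> S" using notin by simp_all
  have uv: "?s q d e = ?s q b e + ?s q b d" "?s q d f = ?s q b f + ?s q b d" "?s q e f = ?s q b f + ?s q b e"
    using pluecker_three_term[OF q, of a b d e S] pluecker_three_term[OF q, of a b d f S]
      pluecker_three_term[OF q, of a b e f S] au ne notin' by simp_all
  have "?s q d e \<noteq> 0" "?s q d f \<noteq> 0" "?s q e f \<noteq> 0" "?s q b e \<noteq> 0" "?s q b f \<noteq> 0"
    using nza q0 by simp_all
  then have ef: "?s q b e \<notin> {0, 1}" "?s q b f \<notin> {0, 1}" "?s q b e \<noteq> ?s q b f"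
    unfolding uv bd by auto
  have w1: "w + 1 \<noteq> 0" "w + 1 \<noteq> 1" "w + 1 \<noteq> w" using w char_2_eqI[of w 1] by auto
  have four: "x \<in> {0, 1, w, w + 1}" for x :: 'f
    using not_five_distinct[of x 0 1 w "w + 1"] w w1 by auto
  have "w\<^sup>2 \<noteq> 0" "w\<^sup>2 \<noteq> w" using w by (auto simp: power2_eq_square)
  moreover have "w\<^sup>2 \<noteq> 1" using square_add[of w 1] w1 by auto
  ultimately have ww: "w\<^sup>2 = w + 1" using four[of "w\<^sup>2"] by auto
  show thesis
  proof (cases "?s q b e = w")
    case True
    then have "?s q b f = w + 1" using four[of "?s q b f"] ef by auto
    then show thesis using that[OF q q0 au bd True] by simp
  next
    case False
    then have e: "?s q b e = w + 1" using four[of "?s q b e"] ef by auto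
    then have f: "?s q b f = w" using four[of "?s q b f"] ef by auto
    have w12: "(w + 1)\<^sup>2 = w" unfolding square_add ww by (simp add: add.assoc)
    show thesis
      by (rule that[OF pluecker_square[OF q]]) (simp_all add: q0 au bd e f w12 ww)
  qed
qed

text \<open>Both functions are brought to the same normal form with the same \<open>w\<close>. The
  pairs among \<open>d\<close>, \<open>e\<close>, \<open>f\<close> are not listed there but follow
  from the three-term relations.\<close>

lemma common_normal_form:
  fixes p p' :: "'a set \<Rightarrow> 'f"
  assumes p: "pluecker p" "\<And>B. p B \<noteq> 0 \<Longrightarrow> finite B" "five_points p S P"
    and p': "pluecker p'" "\<And>B. p' B \<noteq> 0 \<Longrightarrow> finite B" "five_points p' S P"
  shows "\<exists>q q' :: 'a set \<Rightarrow> 'f. pluecker q \<and> (\<forall>B. q B = 0 \<longleftrightarrow> p B = 0) \<and> pluecker q' \<and> (\<forall>B. q' B = 0 \<longleftrightarrow> p' B = 0) \<and>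
    (\<forall>i\<in>P. \<forall>j\<in>P. i \<noteq> j \<longrightarrow> q (insert i (insert j S)) = q' (insert i (insert j S)))"
proof -
  obtain a b d e f where P: "P = {a, b, d, e, f}" "distinct [a, b, d, e, f]"
    using card_5_obtain five_pointsD(2)[OF p(3)] by metis
  have "\<not> (UNIV :: 'f set) \<subseteq> {0, 1}"
    using card_mono[of "{0, 1}" "UNIV :: 'f set"] card_F by auto
  then obtain w :: 'f where w: "w \<noteq> 0" "w \<noteq> 1" by auto
  obtain q where q: "pluecker q" "\<And>B. q B = 0 \<longleftrightarrow> p B = 0"
    "q (insert a (insert b S)) = 1" "q (insert a (insert d S)) = 1" "q (insert a (insert e S)) = 1"
    "q (insert a (insert f S)) = 1" "q (insert b (insert d S)) = 1" "q (insert b (insert e S)) = w"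
    "q (insert b (insert f S)) = w + 1"
    using normal_form[OF p(1,2) p(3)[unfolded P(1)] P(2) w] by blast
  obtain q' where q': "pluecker q'" "\<And>B. q' B = 0 \<longleftrightarrow> p' B = 0"
    "q' (insert a (insert b S)) = 1" "q' (insert a (insert d S)) = 1" "q' (insert a (insert e S)) = 1"
    "q' (insert a (insert f S)) = 1" "q' (insert b (insert d S)) = 1" "q' (insert b (insert e S)) = w"
    "q' (insert b (insert f S)) = w + 1"
    using normal_form[OF p'(1,2) p'(3)[unfolded P(1)] P(2) w] by blast
  let ?s = "\<lambda>p i j. p (insert i (insert j S))"
  have notin: "a \<notin> S" "b \<notin> S" "d \<notin> S" "e \<notin> S" "f \<notin> S"
    using five_pointsD(1)[OF p(3)] P by auto
  have ne: "a \<noteq> b" "a \<noteq> d" "a \<noteq> e" "a \<noteq> f" "b \<noteq> d" "b \<noteq> e" "b \<noteq> f" "d \<noteq> e" "d \<noteq> f" "e \<noteq> f"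
    using P(2) by auto
  have uv: "?s q d e = ?s q' d e" "?s q d f = ?s q' d f" "?s q e f = ?s q' e f"
    using pluecker_three_term[OF q(1), of a b d e S] pluecker_three_term[OF q'(1), of a b d e S]
      pluecker_three_term[OF q(1), of a b d f S] pluecker_three_term[OF q'(1), of a b d f S]
      pluecker_three_term[OF q(1), of a b e f S] pluecker_three_term[OF q'(1), of a b e f S]
      ne notin q(3-) q'(3-) by simp_all
  have sym: "?s g i j = ?s g j i" for g :: "'a set \<Rightarrow> 'f" and i j by (simp add: insert_commute)
  note eqs = uv q(3-) q'(3-)
  have eq: "?s q i j = ?s q' i j" if "i \<in> P" "j \<in> P" "i \<noteq> j" for i j
    using that unfolding P(1)
    by (elim insertE emptyE)
      (simp_all add: eqs sym[of _ b a] sym[of _ d a] sym[of _ e a] sym[of _ f a]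
        sym[of _ d b] sym[of _ e b] sym[of _ f b] sym[of _ e d] sym[of _ f d] sym[of _ f e])
  show ?thesis
    by (rule exI[of _ q], rule exI[of _ q']) (simp add: q(1,2) q'(1,2) eq)
qed

end

section \<open>Relaxing a circuit-hyperplane\<close>

lemma proportional:
  fixes a :: "'f::field"
  assumes "a * n = b * m" "a' * n = b' * m" "n \<noteq> 0" "b \<noteq> 0"
  shows "a' = b' / b * a"
proof -
  have "a = b * m / n" "a' = b' * m / n" using assms by (simp_all add: eq_divide_eq)
  then show ?thesis using assms by simp
qed

text \<open>A relaxation seen only through the supports of two functions. \<open>exchange_X\<close>
  carries what is needed of the circuit-hyperplane property: replacing an element of
  \<open>X\<close> by one outside gives a basis. In this form the hypotheses are closed under
  duality.\<close>

locale relaxed_pair = gf4 F for F :: "'f::field itself" +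
  fixes E X :: "'a set" and p p' :: "'a set \<Rightarrow> 'f"
  assumes finite_E: "finite E" and X_subset: "X \<subseteq> E"
    and pluecker: "pluecker p" "pluecker p'"
    and support: "\<And>B. p B \<noteq> 0 \<Longrightarrow> B \<subseteq> E \<and> card B = card X"
    and pX: "p X = 0" "p' X \<noteq> 0"
    and zero_iff: "\<And>B. B \<noteq> X \<Longrightarrow> p' B = 0 \<longleftrightarrow> p B = 0"
    and exchange_X: "\<And>x y. x \<in> X \<Longrightarrow> y \<in> E - X \<Longrightarrow> p (insert y (X - {x})) \<noteq> 0"
begin

lemma finite_X: "finite X"
  using X_subset finite_E by (rule finite_subset)

lemma support': "p' B \<noteq> 0 \<Longrightarrow> B \<subseteq> E \<and> card B = card X"
  using support zero_iff X_subset by metis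

lemma finite_support: "p B \<noteq> 0 \<Longrightarrow> finite B" "p' B \<noteq> 0 \<Longrightarrow> finite B"
  using support support' finite_E finite_subset by metis+

lemma five_points_subset:
  assumes "five_points p S P"
  shows "S \<subseteq> E" "P \<subseteq> E" "finite S" "card X = card S + 2"
proof -
  note P = five_pointsD[OF assms]
  obtain a b where ab: "a \<in> P" "b \<in> P" "a \<noteq> b" using card_5_two[OF P(2)] .
  note s = support[OF P(4)[OF ab]]
  show "P \<subseteq> E"
  proof
    fix i assume i: "i \<in> P"
    show "i \<in> E"
    proof (cases "i = a")
      case False
      then show ?thesis using support[OF P(4)[OF i ab(1)]] by blast
    qed (use s in blast)
  qed
  show "S \<subseteq> E" using s by blast
  then show fin: "finite S" using finite_E finite_subset by blast
  have "a \<notin> S" "b \<notin> S" using ab P(1) by blast+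
  then have "card (insert a (insert b S)) = card S + 2" using ab(3) fin by simp
  then show "card X = card S + 2" using s by simp
qed

lemma five_points_p':
  assumes "five_points p S P"
  shows "five_points p' S P"
proof -
  have "p' B \<noteq> 0" if "p B \<noteq> 0" for B
  proof (cases "B = X")
    case False
    then show ?thesis using zero_iff that by blast
  qed (use pX in simp)
  then show ?thesis using assms unfolding five_points_def by blast
qed

text \<open>The next four lemmas replace \<open>(S, P)\<close> by a pair that is closer to \<open>X\<close>: they decrease
  \<open>card (S - X) + card (X - S - P)\<close>, though \<open>swap_parallel\<close> only if \<open>n \<notin> X\<close> and \<open>swap_series\<close> only
  if \<open>n \<in> X\<close>.\<close>

lemma swap_loop:
  assumes pts: "five_points p S P" and x: "x \<in> X" "x \<notin> S" "x \<notin> P"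
    and loop: "\<And>j. j \<in> P \<Longrightarrow> p (insert x (insert j S)) = 0"
  shows "\<exists>c\<in>S - X. five_points p (insert x (S - {c})) P"
proof -
  note P = five_pointsD[OF pts] and sub = five_points_subset[OF pts]
  obtain a b where ab: "a \<in> P" "b \<in> P" "a \<noteq> b"
    using card_5_two[OF P(2)] .
  have "\<not> X \<subseteq> insert x S"
    using card_mono[of "insert x S" X] sub(3,4) x by auto
  then obtain x' where x': "x' \<in> X" "x' \<notin> insert x S" by blast
  have "card (S \<union> P) = card S + 5" using P sub by (simp add: card_Un_disjoint)
  then have "\<not> S \<union> P \<subseteq> X" using card_mono[OF finite_X, of "S \<union> P"] sub(4) by auto
  then obtain y where y: "y \<in> E - X" using sub by blast
  let ?B = "insert a (insert b S)" and ?B' = "insert y (X - {x'})"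
  \<comment> \<open>Exchanging \<open>x\<close> into \<open>?B\<close> cannot remove
    \<open>a\<close> or \<open>b\<close>, because \<open>x\<close> is a loop over \<open>S\<close>.
    Since \<open>x'\<close> is not in \<open>S\<close>, the removed element lies in
    \<open>S - X\<close>.\<close>
  have xS: "x \<in> ?B' - ?B" using x x' ab(1,2) by blast
  obtain c where c: "c \<in> ?B - ?B'" "p (insert x (?B - {c})) \<noteq> 0"
    using pluecker_exchange[OF pluecker(1) P(4)[OF ab] exchange_X[OF x'(1) y] xS] by blast
  have nab: "a \<notin> S" "b \<notin> S" using ab P(1) by blast+
  then have B: "?B - {a} = insert b S" "?B - {b} = insert a S" using ab(3) by blast+
  have "p (insert x (?B - {a})) = 0" "p (insert x (?B - {b})) = 0"
    unfolding B by (rule loop[OF ab(2)], rule loop[OF ab(1)])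
  then have "c \<noteq> a" "c \<noteq> b" using c(2) by blast+
  then have c': "c \<in> S - X" using c(1) x'(2) by blast
  define T where "T = S - {c}"
  have T: "S = insert c T" "c \<notin> T" using c' unfolding T_def by blast+
  have "five_points p (insert x T) P"
  proof (rule five_points_swap[OF pluecker(1) pts[unfolded T(1)] T(2) _ x(3) _ ab])
    show "x \<notin> insert c T" using x(2) T(1) by blast
    have "?B - {c} = insert a (insert b T)" using c' ab P(1) T by blast
    then show "p (insert a (insert b (insert x T))) \<noteq> 0" using c(2) by (simp add: insert_commute)
    show "p (insert i (insert c (insert x T))) = 0 \<or> p (insert i (insert j (insert k T))) = 0"
      if "i \<in> P" for i j k
      using loop[OF that] unfolding T(1) by (simp add: insert_commute)
  qed
  then show ?thesis using c' T_def by blast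
qed

lemma swap_parallel:
  assumes pts: "five_points p S P" and x: "x \<notin> S" "x \<notin> P"
    and nz: "\<And>i. i \<in> P \<Longrightarrow> i \<noteq> n \<Longrightarrow> p (insert x (insert i S)) \<noteq> 0" and n: "n \<in> P"
  shows "five_points p S (insert x (P - {n}))"
  using five_pointsD[OF pts] x nz n unfolding five_points_def
  by (auto simp: card_exchange insert_commute)

lemma swap_coloop:
  assumes pts: "five_points p (insert c T) P" and c: "c \<notin> T" "c \<notin> X"
    and coloop: "\<And>i j k. i \<in> P \<Longrightarrow> j \<in> P \<Longrightarrow> k \<in> P \<Longrightarrow> distinct [i, j, k] \<Longrightarrow>
      p (insert i (insert j (insert k T))) = 0"
  shows "\<exists>e\<in>X - insert c T - P. five_points p (insert e T) P"
proof -
  note P = five_pointsD[OF pts] and sub = five_points_subset[OF pts]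
  obtain a b where ab: "a \<in> P" "b \<in> P" "a \<noteq> b"
    using card_5_two[OF P(2)] .
  have "card (T \<union> P) = card T + 5" using P sub by (subst card_Un_disjoint) auto
  then have "\<not> T \<union> P \<subseteq> X" using card_mono[OF finite_X, of "T \<union> P"] sub(3,4) c by auto
  \<comment> \<open>The exchange below cannot bring in this \<open>y\<close>: an element of
    \<open>T\<close> is already present, and one of \<open>P\<close> is excluded by
    \<open>coloop\<close>. Hence the new element belongs to \<open>X\<close>.\<close>
  then obtain y where y: "y \<in> T \<union> P" "y \<notin> X" by blast
  then have yE: "y \<in> E - X" using sub by auto
  obtain x where x: "x \<in> X" using sub(4) by fastforce
  let ?B = "insert a (insert b (insert c T))" and ?B' = "insert y (X - {x})"
  have cB: "c \<in> ?B - ?B'" using y c P(1) by blast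
  obtain e where e: "e \<in> ?B' - ?B" "p (insert e (?B - {c})) \<noteq> 0"
    using pluecker_exchange[OF pluecker(1) exchange_X[OF x yE] P(4)[OF ab] cB] by blast
  have B: "?B - {c} = insert a (insert b T)" using ab c P(1) by blast
  have eP: "e \<notin> P"
  proof
    assume "e \<in> P"
    moreover have "distinct [e, a, b]" using e(1) ab by auto
    ultimately show False using e(2) coloop[OF _ ab(1,2)] unfolding B by blast
  qed
  then have eX: "e \<in> X - insert c T - P" using e(1) y by blast
  have "five_points p (insert e T) P"
  proof (rule five_points_swap[OF pluecker(1) pts c(1) _ eP _ ab])
    show "e \<notin> insert c T" using eX by blast
    show "p (insert a (insert b (insert e T))) \<noteq> 0"
      using e(2) unfolding B by (simp add: insert_commute)
  qed (simp add: coloop)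
  then show ?thesis using eX by blast
qed

text \<open>After contraction of \<open>T\<close>, the points \<open>P - {n}\<close> lie on a line
  of the rank-3 minor on \<open>insert c P\<close>. So \<open>c\<close> and \<open>n\<close> are in
  series there and can exchange their roles.\<close>

lemma swap_series:
  assumes pts: "five_points p (insert c T) P" and c: "c \<notin> T" and n: "n \<in> P"
    and series: "\<And>i j k. i \<in> P - {n} \<Longrightarrow> j \<in> P - {n} \<Longrightarrow> k \<in> P - {n} \<Longrightarrow> distinct [i, j, k] \<Longrightarrow>
      p (insert i (insert j (insert k T))) = 0"
    and ex: "a \<in> P" "b \<in> P" "d \<in> P" "distinct [a, b, d]" "p (insert a (insert b (insert d T))) \<noteq> 0"
  shows "five_points p (insert n T) (insert c (P - {n}))"
proof -
  note P = five_pointsD[OF pts]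
  \<comment> \<open>One zero would spread over all pairs of \<open>P - {n}\<close>, since the
    triples without \<open>n\<close> vanish as well. Then no triple of \<open>P\<close> would be a
    basis over \<open>T\<close>, against \<open>ex\<close>.\<close>
  have main: "p (insert i (insert j (insert n T))) \<noteq> 0" if ij: "i \<in> P - {n}" "j \<in> P - {n}" "i \<noteq> j" for i j
  proof
    assume 0: "p (insert i (insert j (insert n T))) = 0"
    have all: "p (insert k (insert l (insert n T))) = 0" if kl: "k \<in> P - {n}" "l \<in> P - {n}" "k \<noteq> l" for k l
    proof (rule pairs_propagate[of "\<lambda>i j. p (insert i (insert j (insert n T))) = 0" "P - {n}" i j k l, OF _ _ ij 0 kl])
      fix i j k assume ijk: "i \<in> P - {n}" "j \<in> P - {n}" "k \<in> P - {n}" "distinct [i, j, k]"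
        "p (insert i (insert j (insert n T))) = 0"
      have "i \<noteq> c" "j \<noteq> c" "k \<noteq> c" "n \<noteq> c" "i \<noteq> n" "j \<noteq> n" "k \<noteq> n" and
        nT: "i \<notin> T" "j \<notin> T" "k \<notin> T" "n \<notin> T" and in_P: "i \<in> P" "j \<in> P"
        using ijk(1-3) n P(1) by blast+
      then have d: "distinct [i, c, j, k, n]" using ijk(4) by simp
      have "p (insert i (insert c (insert j T))) \<noteq> 0"
        using P(4)[OF in_P] ijk(4) by (simp add: insert_commute)
      moreover have "p (insert i (insert j (insert k T))) = 0" using series[OF ijk(1-4)] .
      ultimately show "p (insert i (insert k (insert n T))) = 0"
        using pluecker_three_term_base[OF pluecker(1) d c nT(2,3,4)] ijk(5) by simp
    qed (simp add: insert_commute)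
    have d: "a \<noteq> b" "a \<noteq> d" "b \<noteq> d" using ex(4) by auto
    consider "a = n" | "b = n" | "d = n" | "a \<in> P - {n}" "b \<in> P - {n}" "d \<in> P - {n}"
      using ex(1-3) by blast
    then show False
    proof cases
      case 1
      then show False using all[of b d] ex(2,3,5) d by (simp add: insert_commute)
    next
      case 2
      then show False using all[of a d] ex(1,3,5) d by (simp add: insert_commute)
    next
      case 3
      then show False using all[of a b] ex(1,2,5) d by (simp add: insert_commute)
    next
      case 4
      then show False using series[OF 4 ex(4)] ex(5) by blast
    qed
  qed
  have cP: "c \<notin> P" using P(1) by blast
  have cn: "p (insert c (insert j (insert n T))) \<noteq> 0" if "j \<in> P - {n}" for j
    using P(4)[of n j] n that by (auto simp: insert_commute)
  show ?thesis
    unfolding five_points_def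
  proof (intro conjI ballI impI)
    show "insert n T \<inter> insert c (P - {n}) = {}" using P(1) c n by auto
    show "card (insert c (P - {n})) = 5" using card_exchange[OF P(3) n cP] P(2) by simp
    fix i j assume ij: "i \<in> insert c (P - {n})" "j \<in> insert c (P - {n})" "i \<noteq> j"
    then consider "i = c" "j \<in> P - {n}" | "j = c" "i \<in> P - {n}" | "i \<in> P - {n}" "j \<in> P - {n}" by blast
    then show "p (insert i (insert j (insert n T))) \<noteq> 0"
    proof cases
      case 2
      then show ?thesis using cn[of i] by (simp add: insert_commute)
    qed (use cn main ij in auto)
  qed
qed

text \<open>The next three lemmas exclude a pair \<open>(S, P)\<close> to which no swap applies, according to whether
  \<open>S - X\<close> has no, one or more elements. Only in the last case do \<open>p\<close> and \<open>p'\<close> vanish together on all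
  sets that determine the representation, as all of these meet \<open>S - X\<close>.\<close>

lemma empty_obstruction:
  assumes pts: "five_points p S P" and S: "S \<subseteq> X"
    and par: "\<And>x n. x \<in> X - S - P \<Longrightarrow> n \<in> P \<Longrightarrow> p (insert x (insert n S)) = 0 \<Longrightarrow> n \<in> X"
    and nl: "\<And>x. x \<in> X - S - P \<Longrightarrow> \<exists>j\<in>P. p (insert x (insert j S)) \<noteq> 0"
  shows False
proof -
  note P = five_pointsD[OF pts] and sub = five_points_subset[OF pts]
  have "card (X - S) = 2" using S sub by (subst card_Diff_subset) auto
  then obtain u v where uv: "X - S = {u, v}" "u \<noteq> v" by (meson card_2_iff)
  have X: "X = insert u (insert v S)" using uv S by auto
  \<comment> \<open>For \<open>p\<close> the point \<open>u\<close> is parallel to a point of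
    \<open>P\<close> in \<open>X\<close>, which can only be \<open>v\<close>. Relaxing
    \<open>X\<close> separates \<open>u\<close> from \<open>v\<close>, so that \<open>u\<close>
    becomes a sixth point of the line for \<open>p'\<close>.\<close>
  have *: False if X: "X = insert u (insert v S)" and u: "u \<notin> S" "u \<notin> P" for u v
  proof -
    have uD: "u \<in> X - S - P" using X u by auto
    obtain n where n: "n \<in> P" "p (insert u (insert n S)) = 0"
      using six_points[OF pluecker(1) pts u] by blast
    have "n \<in> X" using par[OF uD n] .
    then have nv: "n = v" using X n u P(1) by auto
    obtain j where j: "j \<in> P" "p (insert u (insert j S)) \<noteq> 0" using nl[OF uD] by blast
    have nz: "p' (insert u (insert i S)) \<noteq> 0" if "i \<in> P" for i
    proof (cases "i = n")
      case False
      then have "p (insert u (insert i S)) \<noteq> 0"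
        using parallel_unique[OF pluecker(1) pts u n j that] by blast
      then show ?thesis using zero_iff pX(1) by metis
    qed (use X nv pX in simp)
    show False using six_points[OF pluecker(2) five_points_p'[OF pts] u] nz by blast
  qed
  show False
  proof (cases "u \<in> P \<and> v \<in> P")
    case True
    then show False using P(4)[of u v] uv(2) pX(1) X by simp
  next
    case False
    moreover have "u \<notin> S" "v \<notin> S" using uv by blast+
    moreover have "X = insert v (insert u S)" using X by (simp add: insert_commute)
    ultimately show False using *[of u v] *[of v u] X by blast
  qed
qed

text \<open>Here \<open>X\<close> consists of \<open>T\<close> and three points of \<open>P\<close>:
  over \<open>T\<close> these are collinear for \<open>p\<close> but not for \<open>p'\<close>, and
  all other triples have the same status. \<open>third_collinear_triple\<close> for \<open>p\<close>
  yields a second collinear triple; the same lemma for \<open>p'\<close>, started from that triple,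
  demands one that \<open>p'\<close> does not have.\<close>

lemma triple_obstruction:
  assumes pts: "five_points p (insert c T) P" and c: "c \<notin> T" and T: "T \<subseteq> X" and XP: "X \<subseteq> T \<union> P"
  shows False
proof -
  note P = five_pointsD[OF pts] and sub = five_points_subset[OF pts]
  define s where "s q i j = q (insert i (insert j (insert c T)))" for q :: "'a set \<Rightarrow> 'f" and i j
  define \<tau> where "\<tau> q i j k = q (insert i (insert j (insert k T)))" for q :: "'a set \<Rightarrow> 'f" and i j k
  have "card (X - T) = 3" using T sub c by (subst card_Diff_subset) auto
  then obtain i j k where ijk: "X - T = {i, j, k}" "i \<noteq> j" "i \<noteq> k" "j \<noteq> k"
    unfolding card_3_iff by blast
  then have X: "X = {i, j, k} \<union> T" using T by blast
  have ijkP: "{i, j, k} \<subseteq> P" using ijk(1) XP by blast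
  have "card (P - {i, j, k}) = 2" using P(2) ijk ijkP by (subst card_Diff_subset) auto
  then obtain l m where lm: "P - {i, j, k} = {l, m}" "l \<noteq> m" by (meson card_2_iff)
  have Pe: "P = {i, j, k, l, m}" using lm(1) ijkP by blast
  have "l \<notin> {i, j, k}" "m \<notin> {i, j, k}" using lm(1) by blast+
  then have Pd: "distinct [i, j, k, l, m]" using ijk(2-4) lm(2) by auto
  have nT: "y \<notin> T" "y \<noteq> c" if "y \<in> P" for y using that P(1) by blast+
  have \<tau>_set: "\<tau> q x y z = q ({x, y, z} \<union> T)" for q x y z unfolding \<tau>_def by simp
  have sym: "s q x y = s q y x" "\<tau> q x y z = \<tau> q y x z" "\<tau> q x y z = \<tau> q x z y" for q x y z
    unfolding s_def \<tau>_def by (simp_all add: insert_commute)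
  have s_alt: "s q x y = q (insert x (insert c (insert y T)))" for q x y
    unfolding s_def by (simp add: insert_commute)
  note pts' = five_points_p'[OF pts]
  define Q where "Q = {p, p'}"
  have pQ: "p \<in> Q" "p' \<in> Q" unfolding Q_def by simp_all
  have pl: "pluecker q" if "q \<in> Q" for q using that pluecker unfolding Q_def by auto
  have sn: "s q x y \<noteq> 0" if "q \<in> Q" "x \<in> P" "y \<in> P" "x \<noteq> y" for q x y
    using that(1) P(4)[OF that(2-4)] five_pointsD(4)[OF pts' that(2-4)] unfolding s_def Q_def by auto
  have ss: "s q i j * s q k l = s q i k * s q j l + s q i l * s q j k"
    if "q \<in> Q" "i \<in> P" "j \<in> P" "k \<in> P" "l \<in> P" "distinct [i, j, k, l]" for q i j k l
    unfolding s_def using nT[OF that(2)] nT[OF that(3)] nT[OF that(4)] nT[OF that(5)]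
    by (intro pluecker_three_term[OF pl[OF that(1)] that(6)]) simp_all
  have s\<tau>: "s q i j * \<tau> q i k l = s q i k * \<tau> q i j l + s q i l * \<tau> q i j k"
    if "q \<in> Q" "i \<in> P" "j \<in> P" "k \<in> P" "l \<in> P" "distinct [i, j, k, l]" for q i j k l
  proof -
    have "distinct [i, c, j, k, l]" using that(6) nT(2)[OF that(2)] nT(2)[OF that(3)] nT(2)[OF that(4)] nT(2)[OF that(5)]
      by auto
    from pluecker_three_term_base[OF pl[OF that(1)] this c nT(1)[OF that(3)] nT(1)[OF that(4)] nT(1)[OF that(5)]]
    show ?thesis unfolding s_alt \<tau>_def .
  qed
  have \<tau>\<tau>: "\<tau> q h i j * \<tau> q h k l = \<tau> q h i k * \<tau> q h j l + \<tau> q h i l * \<tau> q h j k"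
    if "q \<in> Q" "h \<in> P" "i \<in> P" "j \<in> P" "k \<in> P" "l \<in> P" "distinct [h, i, j, k, l]" for q h i j k l
    unfolding \<tau>_def
    by (rule pluecker_three_term_base[OF pl[OF that(1)] that(7) nT(1)[OF that(3)] nT(1)[OF that(4)] nT(1)[OF that(5)] nT(1)[OF that(6)]])
  have third: "\<tau> q i l m = 0 \<or> \<tau> q j l m = 0 \<or> \<tau> q k l m = 0"
    if "distinct [i, j, k, l, m]" "P = {i, j, k, l, m}" "q \<in> Q" "\<tau> q i j k = 0"
      "\<tau> q i j l \<noteq> 0" "\<tau> q i j m \<noteq> 0" "\<tau> q i k l \<noteq> 0" "\<tau> q i k m \<noteq> 0" "\<tau> q j k l \<noteq> 0" "\<tau> q j k m \<noteq> 0"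
    for q i j k l m
    by (rule third_collinear_triple[OF that(1,2), of "s q" "\<tau> q", OF sym(1) sn[OF that(3)] sym(2,3)
        ss[OF that(3)] s\<tau>[OF that(3)] \<tau>\<tau>[OF that(3)] that(4-)])
  have lmX: "l \<notin> X" "m \<notin> X" using lm(1) nT(1) X by blast+
  have zero: "\<tau> p' x y z = 0 \<longleftrightarrow> \<tau> p x y z = 0" if "z \<in> {l, m}" for x y z
  proof -
    have "{x, y, z} \<union> T \<noteq> X" using that lmX by blast
    then show ?thesis unfolding \<tau>_set by (rule zero_iff)
  qed
  have ijk0: "\<tau> p i j k = 0" "\<tau> p' i j k \<noteq> 0" using pX unfolding \<tau>_set X[symmetric] by simp_all
  \<comment> \<open>A further point on the line of \<open>i\<close>, \<open>j\<close>,
    \<open>k\<close> would, for \<open>p'\<close>, lie on the lines through \<open>a\<close>,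
    \<open>b\<close> and through \<open>a\<close>, \<open>d\<close>. This would force
    \<open>a\<close>, \<open>b\<close>, \<open>d\<close> to be collinear for \<open>p'\<close>
    too.\<close>
  have two: "\<tau> p a b y \<noteq> 0" if ab: "{a, b, d} = {i, j, k}" "distinct [a, b, d]" and y: "y \<in> {l, m}" for a b d y
  proof
    assume 0: "\<tau> p a b y = 0"
    have in_P: "a \<in> P" "b \<in> P" "d \<in> P" "y \<in> P"
      using ab(1) y ijkP lm(1) by blast+
    have "y \<notin> {a, b, d}" unfolding ab(1) using y lm(1) by blast
    then have D: "distinct [a, b, d, y]" "distinct [a, y, b, d]" using ab(2) by auto
    have abd: "\<tau> q a b d = \<tau> q i j k" for q unfolding \<tau>_set ab(1) ..
    have "s p a b * \<tau> p a d y = 0"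
      using s\<tau>[OF pQ(1) in_P(1,2,3,4) D(1)] 0 ijk0(1) unfolding abd by simp
    then have 1: "\<tau> p a d y = 0" using sn[OF pQ(1) in_P(1,2)] D(1) by simp
    have "\<tau> p' a b y = 0" "\<tau> p' a d y = 0" using 0 1 zero[OF y] by simp_all
    then have "\<tau> p' a y b = 0" "\<tau> p' a y d = 0" unfolding sym(3)[of p' a y] .
    then have "s p' a y * \<tau> p' a b d = 0"
      using s\<tau>[OF pQ(2) in_P(1,4,2,3) D(2)] by simp
    then show False using sn[OF pQ(2) in_P(1,4)] D(2) abd ijk0 by simp
  qed
  \<comment> \<open>For \<open>p'\<close> the collinear triple is now \<open>a\<close>,
    \<open>l\<close>, \<open>m\<close>, with \<open>b\<close> and \<open>d\<close> off its line. The
    third triple would contain \<open>b\<close> and \<open>d\<close>: with \<open>a\<close> it is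
    the relaxed one, and with \<open>l\<close> or \<open>m\<close> it is excluded by
    \<open>two\<close>.\<close>
  have claim: False if ab: "{a, b, d} = {i, j, k}" "distinct [a, b, d]" and 0: "\<tau> p a l m = 0" for a b d
  proof -
    have ab': "{a, d, b} = {i, j, k}" "distinct [a, d, b]" "{b, d, a} = {i, j, k}" "distinct [b, d, a]"
      using ab by auto
    have "l \<notin> {a, b, d}" "m \<notin> {a, b, d}" unfolding ab(1) using lm(1) by blast+
    then have d: "distinct [a, l, m, b, d]" using ab(2) lm(2) by auto
    have "P = {i, j, k} \<union> {l, m}" using Pe by blast
    then have Pa: "P = {a, l, m, b, d}" unfolding ab(1)[symmetric] by blast
    have in_P: "a \<in> P" "l \<in> P" "m \<in> P" "b \<in> P" "d \<in> P" unfolding Pa by simp_all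
    have alm: "\<tau> p' a l m = 0" using 0 zero by simp
    have n1: "\<tau> p' a b y \<noteq> 0" "\<tau> p' a d y \<noteq> 0" "\<tau> p' b d y \<noteq> 0" if "y \<in> {l, m}" for y
      using zero[OF that] two[OF ab that] two[OF ab'(1,2) that] two[OF ab'(3,4) that] by simp_all
    have n2: "\<tau> p' a y b \<noteq> 0" "\<tau> p' a y d \<noteq> 0" "\<tau> p' y b d \<noteq> 0" if "y \<in> {l, m}" for y
      using n1[OF that] sym(3)[of p' a y] sym(2)[of p' y b d] sym(3)[of p' b y d] by simp_all
    have n3: "\<tau> p' l m y \<noteq> 0" if y: "y \<in> {b, d}" for y
    proof
      assume lmy: "\<tau> p' l m y = 0"
      have D: "distinct [l, m, a, y]" and yP: "y \<in> P" using d y in_P by auto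
      have "\<tau> p' l m a = 0" using alm sym(2)[of p' l a m] sym(3)[of p' l m a] by simp
      then have "s p' l m * \<tau> p' l a y = 0"
        using s\<tau>[OF pQ(2) in_P(2,3,1) yP D] lmy by simp
      moreover have "\<tau> p' l a y \<noteq> 0" using n2[of l] y sym(2)[of p' l a y] by auto
      ultimately show False using sn[OF pQ(2) in_P(2,3)] lm(2) by simp
    qed
    have "\<tau> p' a b d = 0 \<or> \<tau> p' l b d = 0 \<or> \<tau> p' m b d = 0"
      by (rule third[OF d Pa pQ(2) alm]) (use n2 n3 in simp_all)
    moreover have "\<tau> p' a b d = \<tau> p' i j k" unfolding \<tau>_set ab(1) ..
    ultimately show False using ijk0(2) n2(3) by simp
  qed
  have "\<tau> p i l m = 0 \<or> \<tau> p j l m = 0 \<or> \<tau> p k l m = 0"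
  proof (rule third[OF Pd Pe pQ(1) ijk0(1)])
    show "\<tau> p i j l \<noteq> 0" "\<tau> p i j m \<noteq> 0" by (rule two[of i j k]; use ijk in auto)+
    show "\<tau> p i k l \<noteq> 0" "\<tau> p i k m \<noteq> 0" by (rule two[of i k j]; use ijk in auto)+
    show "\<tau> p j k l \<noteq> 0" "\<tau> p j k m \<noteq> 0" by (rule two[of j k i]; use ijk in auto)+
  qed
  moreover have "{j, i, k} = {i, j, k}" "{k, i, j} = {i, j, k}" by blast+
  ultimately show False
    using claim[of i j k] claim[of j i k] claim[of k i j] ijk(2-4) by auto
qed

text \<open>A scaled copy \<open>g\<close> of \<open>q\<close> is made to agree with
  \<open>q'\<close> on all neighbours of \<open>insert a (insert b S)\<close> that the Laplace
  expansion of \<open>X\<close> uses. The scalars are forced: \<open>\<mu> x\<close> by the pairs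
  containing \<open>x\<close>, and \<open>\<rho> c\<close> by the triples over
  \<open>S - {c}\<close>.\<close>

lemma rigid_obstruction:
  assumes pts: "five_points p S P" and C2: "card (S - X) \<ge> 2"
    and par: "\<And>x n. x \<in> X - S - P \<Longrightarrow> n \<in> P \<Longrightarrow> p (insert x (insert n S)) = 0 \<Longrightarrow> n \<in> X"
    and nl: "\<And>x. x \<in> X - S - P \<Longrightarrow> \<exists>j\<in>P. p (insert x (insert j S)) \<noteq> 0"
    and ncl: "\<And>c. c \<in> S - X \<Longrightarrow> \<exists>i\<in>P. \<exists>j\<in>P. \<exists>k\<in>P. distinct [i, j, k] \<and>
      p (insert i (insert j (insert k (S - {c})))) \<noteq> 0"
    and ser: "\<And>c n. c \<in> S - X \<Longrightarrow> n \<in> P \<inter> X \<Longrightarrow> \<exists>i\<in>P-{n}. \<exists>j\<in>P-{n}. \<exists>k\<in>P-{n}. distinct [i, j, k] \<and>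
      p (insert i (insert j (insert k (S - {c})))) \<noteq> 0"
  shows False
proof -
  note P = five_pointsD[OF pts] and sub = five_points_subset[OF pts]
  define C where "C = S - X"
  define D where "D = X - S - P"
  have finC: "finite C" using sub unfolding C_def by auto
  have C1: "C \<noteq> {}" by (metis C2 C_def card.empty not_numeral_le_zero)
  \<comment> \<open>Even after the removal of \<open>c\<close>, some element outside
    \<open>X\<close> remains; this makes \<open>qz\<close> applicable to sets built on
    \<open>S - {c}\<close>.\<close>
  have CT: "C - {c} \<noteq> {}" for c
  proof
    assume "C - {c} = {}"
    then have "card C \<le> card {c}" by (intro card_mono) auto
    then show False using C2 unfolding C_def by simp
  qed
  note pts' = five_points_p'[OF pts]
  obtain q q' :: "'a set \<Rightarrow> 'f" where qq: "pluecker q" "\<forall>B. q B = 0 \<longleftrightarrow> p B = 0" "pluecker q'" "\<forall>B. q' B = 0 \<longleftrightarrow> p' B = 0"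
    "\<forall>i\<in>P. \<forall>j\<in>P. i \<noteq> j \<longrightarrow> q (insert i (insert j S)) = q' (insert i (insert j S))"
    using common_normal_form[OF pluecker(1) finite_support(1) pts pluecker(2) finite_support(2) pts'] by blast
  have q: "pluecker q" "q B = 0 \<longleftrightarrow> p B = 0" and q': "pluecker q'" "q' B = 0 \<longleftrightarrow> p' B = 0" for B
    using qq(1-4) by blast+
  have qS: "q (insert i (insert j S)) = q' (insert i (insert j S))" if "i \<in> P" "j \<in> P" "i \<noteq> j" for i j
    using qq(5) that by blast
  have sn: "q (insert i (insert j S)) \<noteq> 0" if "i \<in> P" "j \<in> P" "i \<noteq> j" for i j
    using P(4)[OF that] q(2) by auto
  \<comment> \<open>A set containing an element of \<open>C\<close> is not \<open>X\<close>, the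
    only set where the zeros differ.\<close>
  have qz: "q' B = 0 \<longleftrightarrow> q B = 0" if "c \<in> C" "c \<in> B" for B c
    using q(2) q'(2) zero_iff[of B] that unfolding C_def by auto
  have "\<exists>\<mu>. \<mu> \<noteq> 0 \<and> (\<forall>j\<in>P. q' (insert x (insert j S)) = \<mu> * q (insert x (insert j S)))" if x: "x \<in> D" for x
  proof -
    have xS: "x \<notin> S" "x \<notin> P" using x unfolding D_def by auto
    obtain n where n: "n \<in> P" "p (insert x (insert n S)) = 0"
      using six_points[OF pluecker(1) pts xS] by blast
    obtain j where j: "j \<in> P" "p (insert x (insert j S)) \<noteq> 0" using nl x unfolding D_def by blast
    have jn: "j \<noteq> n" using n j by auto
    obtain c where c: "c \<in> C" using C1 by blast
    then have cS: "c \<in> S" unfolding C_def by auto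
    define \<mu> where "\<mu> = q' (insert x (insert j S)) / q (insert x (insert j S))"
    have nz: "q (insert x (insert j S)) \<noteq> 0" "q' (insert x (insert j S)) \<noteq> 0"
      using j q(2) qz[OF c, of "insert x (insert j S)"] cS by auto
    have nz': "q (insert x (insert n S)) = 0" "q' (insert x (insert n S)) = 0"
      using n q(2) qz[OF c, of "insert x (insert n S)"] cS by auto
    have "q' (insert x (insert i S)) = \<mu> * q (insert x (insert i S))" if i: "i \<in> P" for i
    proof (cases "i = n \<or> i = j")
      case False
      then have d: "distinct [x, i, n, j]" using xS n j i jn by auto
      have notin: "x \<notin> S" "i \<notin> S" "n \<notin> S" "j \<notin> S" using xS n j i P(1) by auto
      have "q (insert x (insert i S)) * q (insert n (insert j S)) = q (insert x (insert j S)) * q (insert i (insert n S))"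
        "q' (insert x (insert i S)) * q' (insert n (insert j S)) = q' (insert x (insert j S)) * q' (insert i (insert n S))"
        using pluecker_three_term[OF q(1) d notin] pluecker_three_term[OF q'(1) d notin] nz' by auto
      then show ?thesis
        using qS[OF n(1) j(1)] qS[OF i n(1)] sn[OF n(1) j(1)] jn False nz(1) unfolding \<mu>_def
        by (intro proportional[of _ "q (insert n (insert j S))" _ "q (insert i (insert n S))"]) simp_all
    qed (use nz nz' \<mu>_def in auto)
    moreover have "\<mu> \<noteq> 0" using nz unfolding \<mu>_def by simp
    ultimately show ?thesis by blast
  qed
  then obtain \<mu> where \<mu>: "\<And>x. x \<in> D \<Longrightarrow> \<mu> x \<noteq> 0"
      "\<And>x j. x \<in> D \<Longrightarrow> j \<in> P \<Longrightarrow> q' (insert x (insert j S)) = \<mu> x * q (insert x (insert j S))"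
    by metis
  have sym: "insert i (insert j T) = insert j (insert i T)" for i j :: 'a and T by (rule insert_commute)
  have "\<exists>\<rho>. \<rho> \<noteq> 0 \<and> (\<forall>i\<in>P. \<forall>j\<in>P. \<forall>k\<in>P. distinct [i, j, k] \<longrightarrow>
      q' (insert i (insert j (insert k (S - {c})))) = \<rho> * q (insert i (insert j (insert k (S - {c})))))"
    if c: "c \<in> C" for c
  proof -
    define T where "T = S - {c}"
    have T: "S = insert c T" "c \<notin> T" using c unfolding T_def C_def by auto
    obtain c' where c': "c' \<in> C" "c' \<in> T" using CT[of c] unfolding T_def C_def by auto
    obtain a b d where abd: "a \<in> P" "b \<in> P" "d \<in> P" "distinct [a, b, d]" "p (insert a (insert b (insert d T))) \<noteq> 0"
      using ncl c unfolding C_def T_def by blast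
    have rel: "g (insert i (insert j S)) * g (insert i (insert k (insert l T))) =
      g (insert i (insert k S)) * g (insert i (insert j (insert l T))) +
      g (insert i (insert l S)) * g (insert i (insert j (insert k T)))"
      if "i \<in> P" "j \<in> P" "k \<in> P" "l \<in> P" "distinct [i, j, k, l]" "pluecker g" for i j k l and g :: "'a set \<Rightarrow> 'f"
    proof -
      have "i \<noteq> c" "j \<noteq> c" "k \<noteq> c" "l \<noteq> c" and nT: "j \<notin> T" "k \<notin> T" "l \<notin> T"
        using that(1-4) P(1) T by blast+
      then have "distinct [i, c, j, k, l]" using that(5) by simp
      from pluecker_three_term_base[OF that(6) this T(2) nT] show ?thesis
        unfolding T(1) insert_commute[of c] .
    qed
    obtain \<rho> where "\<rho> \<noteq> 0" "\<And>i j k. i \<in> P \<Longrightarrow> j \<in> P \<Longrightarrow> k \<in> P \<Longrightarrow> distinct [i, j, k] \<Longrightarrow>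
      q' (insert i (insert j (insert k T))) = \<rho> * q (insert i (insert j (insert k T)))"
    proof (rule triples_proportional[of P "\<lambda>i j. q (insert i (insert j S))"
        "\<lambda>i j k. q (insert i (insert j (insert k T)))" "\<lambda>i j k. q' (insert i (insert j (insert k T)))" a b d])
      fix i j k l assume ijkl: "i \<in> P" "j \<in> P" "k \<in> P" "l \<in> P" "distinct [i, j, k, l]"
      show "q (insert i (insert j S)) * q (insert i (insert k (insert l T))) =
        q (insert i (insert k S)) * q (insert i (insert j (insert l T))) +
        q (insert i (insert l S)) * q (insert i (insert j (insert k T)))"
        using rel[OF ijkl q(1)] .
      show "q (insert i (insert j S)) * q' (insert i (insert k (insert l T))) =
        q (insert i (insert k S)) * q' (insert i (insert j (insert l T))) +
        q (insert i (insert l S)) * q' (insert i (insert j (insert k T)))"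
        using rel[OF ijkl q'(1)] qS ijkl by auto
    next
      fix i j k
      show "q (insert i (insert j (insert k T))) = 0 \<longleftrightarrow> q' (insert i (insert j (insert k T))) = 0"
        using qz[OF c'(1)] c'(2) by auto
    next
      show "q (insert a (insert b (insert d T))) \<noteq> 0" using abd q(2) by auto
    qed (use P abd sn in \<open>auto simp: insert_commute\<close>)
    then show ?thesis unfolding T_def by (intro exI[of _ \<rho>]) auto
  qed
  then obtain \<rho> where \<rho>: "\<And>c. c \<in> C \<Longrightarrow> \<rho> c \<noteq> 0"
      "\<And>c i j k. c \<in> C \<Longrightarrow> i \<in> P \<Longrightarrow> j \<in> P \<Longrightarrow> k \<in> P \<Longrightarrow> distinct [i, j, k] \<Longrightarrow>
      q' (insert i (insert j (insert k (S - {c})))) = \<rho> c * q (insert i (insert j (insert k (S - {c}))))"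
    by metis
  \<comment> \<open>Removing \<open>c\<close> from \<open>S\<close> divides out
    \<open>1 / \<rho> c\<close>, so it multiplies by \<open>\<rho> c\<close> as required. The global
    factor \<open>prod \<rho> C\<close> in \<open>g\<close> leaves the pair values over
    \<open>S\<close> unchanged.\<close>
  define \<nu> where "\<nu> u = (if u \<in> D then \<mu> u else if u \<in> C then 1 / \<rho> u else 1)" for u
  have \<nu>0: "\<nu> u \<noteq> 0" for u unfolding \<nu>_def using \<mu>(1) \<rho>(1) by auto
  define g where "g B = prod \<rho> C * prod \<nu> B * q B" for B
  have finq: "finite B" if "q B \<noteq> 0" for B using that q(2) finite_support(1) by metis
  have g: "pluecker g" unfolding g_def by (rule pluecker_gauge[OF q(1) finq])
  have \<rho>C: "prod \<rho> C \<noteq> 0" using \<rho>(1) finC by auto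
  have gz: "g B = 0 \<longleftrightarrow> q B = 0" for B
    unfolding g_def using \<rho>C \<nu>0 by (cases "finite B") auto
  have \<nu>S: "prod \<rho> C * prod \<nu> S = 1"
  proof -
    have "prod \<nu> S = prod \<nu> C"
      using sub(3) by (intro prod.mono_neutral_right) (auto simp: C_def D_def \<nu>_def)
    also have "\<dots> = prod (\<lambda>c. 1 / \<rho> c) C"
      by (intro prod.cong) (auto simp: C_def D_def \<nu>_def)
    finally have "prod \<rho> C * prod \<nu> S = prod (\<lambda>c. \<rho> c * (1 / \<rho> c)) C" by (simp only: prod.distrib)
    also have "\<dots> = 1" using \<rho>(1) by (intro prod.neutral) auto
    finally show ?thesis .
  qed
  have \<nu>P: "\<nu> i = 1" "i \<notin> S" if "i \<in> P" for i
    using that P(1) unfolding \<nu>_def C_def D_def by auto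
  have \<nu>T: "prod \<rho> C * prod \<nu> (S - {c}) = \<rho> c" if c: "c \<in> C" for c
  proof -
    have "prod \<nu> S = \<nu> c * prod \<nu> (S - {c})"
      using c sub(3) unfolding C_def by (intro prod.remove) auto
    moreover have "\<nu> c = 1 / \<rho> c" using c unfolding \<nu>_def C_def D_def by auto
    ultimately have "prod \<nu> (S - {c}) = \<rho> c * prod \<nu> S" using \<rho>(1)[OF c] by simp
    then have "prod \<rho> C * prod \<nu> (S - {c}) = \<rho> c * (prod \<rho> C * prod \<nu> S)" by (simp only: mult.left_commute)
    then show ?thesis unfolding \<nu>S by simp
  qed
  have g_eq: "g B = (prod \<rho> C * prod \<nu> S) * (z * q B)" if "prod \<nu> B = z * prod \<nu> S" for B z
    unfolding g_def that by (simp only: mult_ac)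
  have gS: "g (insert i (insert j S)) = q' (insert i (insert j S))" if ij: "i \<in> P" "j \<in> P" "i \<noteq> j" for i j
  proof -
    have "prod \<nu> (insert i (insert j S)) = 1 * prod \<nu> S"
      using \<nu>P[OF ij(1)] \<nu>P[OF ij(2)] ij(3) sub(3) by simp
    from g_eq[OF this] show ?thesis unfolding \<nu>S qS[OF ij] by simp
  qed
  have gx: "g (insert x (insert j S)) = q' (insert x (insert j S))" if xj: "x \<in> D" "j \<in> P" for x j
  proof -
    have "x \<notin> insert j S" "\<nu> x = \<mu> x" using xj unfolding D_def \<nu>_def by auto
    then have "prod \<nu> (insert x (insert j S)) = \<mu> x * prod \<nu> S"
      using \<nu>P[OF xj(2)] sub(3) by simp
    from g_eq[OF this] show ?thesis unfolding \<nu>S \<mu>(2)[OF xj] by simp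
  qed
  have gT: "g (insert i (insert j (insert k (S - {c})))) = q' (insert i (insert j (insert k (S - {c}))))"
    if c: "c \<in> C" and ijk: "i \<in> P" "j \<in> P" "k \<in> P" "distinct [i, j, k]" for c i j k
  proof -
    have "prod \<nu> (insert i (insert j (insert k (S - {c})))) = prod \<nu> (S - {c})"
      using \<nu>P[OF ijk(1)] \<nu>P[OF ijk(2)] \<nu>P[OF ijk(3)] ijk(4) sub(3) by simp
    then show ?thesis unfolding g_def \<rho>(2)[OF c ijk] using \<nu>T[OF c] by simp
  qed
  have gTx: "g (insert i (insert j (insert x (S - {c})))) = q' (insert i (insert j (insert x (S - {c}))))"
    if c: "c \<in> C" and x: "x \<in> D" and ij: "i \<in> P" "j \<in> P" "i \<noteq> j" for c x i j
  proof -
    define T where "T = S - {c}"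
    have T: "S = insert c T" "c \<notin> T" using c unfolding T_def C_def by auto
    obtain c' where c': "c' \<in> C" "c' \<in> T" using CT[of c] unfolding T_def C_def by auto
    have xS: "x \<notin> S" "x \<notin> P" using x unfolding D_def by auto
    obtain n where n: "n \<in> P" "p (insert x (insert n S)) = 0"
      using six_points[OF pluecker(1) pts xS] by blast
    obtain m where m: "m \<in> P" "p (insert x (insert m S)) \<noteq> 0" using nl x unfolding D_def by blast
    \<comment> \<open>As \<open>x\<close> is parallel to \<open>n\<close>, the triangle used in
      \<open>triples_extend\<close> must avoid \<open>n\<close>. Such a triangle is what
      \<open>ser\<close> provides, and only for \<open>n\<close> in \<open>X\<close>.\<close>
    have "n \<in> X" using par n x unfolding D_def by auto
    then obtain a b d where abd: "a \<in> P - {n}" "b \<in> P - {n}" "d \<in> P - {n}" "distinct [a, b, d]"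
        "p (insert a (insert b (insert d T))) \<noteq> 0"
      using ser[of c n] c n unfolding C_def T_def by blast
    have sx: "g (insert i (insert x S)) \<noteq> 0" if "i \<in> P - {n}" for i
      using parallel_unique[OF pluecker(1) pts xS n m, of i] that gz q(2) by (auto simp: insert_commute)
    have rel: "h (insert i (insert j S)) * h (insert i (insert k (insert x T))) =
      h (insert i (insert k S)) * h (insert i (insert j (insert x T))) +
      h (insert i (insert x S)) * h (insert i (insert j (insert k T)))"
      if "i \<in> P" "j \<in> P" "k \<in> P" "distinct [i, j, k]" "pluecker h" for i j k and h :: "'a set \<Rightarrow> 'f"
    proof -
      have "i \<noteq> c" "j \<noteq> c" "k \<noteq> c" "x \<noteq> c" "i \<noteq> x" "j \<noteq> x" "k \<noteq> x" and nT: "j \<notin> T" "k \<notin> T" "x \<notin> T"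
        using that(1-3) P(1) T xS by blast+
      then have "distinct [i, c, j, k, x]" using that(4) by simp
      from pluecker_three_term_base[OF that(5) this T(2) nT] show ?thesis
        unfolding T(1) insert_commute[of c] .
    qed
    show ?thesis unfolding T_def[symmetric]
    proof (rule triples_extend[of x P "\<lambda>i j. g (insert i (insert j S))"
        "\<lambda>i j k. g (insert i (insert j (insert k T)))" "\<lambda>i j k. q' (insert i (insert j (insert k T)))" a b d])
      fix i j k assume ijk: "i \<in> P" "j \<in> P" "k \<in> P" "distinct [i, j, k]"
      show "g (insert i (insert j S)) * g (insert i (insert k (insert x T))) =
        g (insert i (insert k S)) * g (insert i (insert j (insert x T))) +
        g (insert i (insert x S)) * g (insert i (insert j (insert k T)))"
        using rel[OF ijk g] .
      have "g (insert i (insert x S)) = q' (insert i (insert x S))"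
        using gx[OF x ijk(1)] by (simp add: insert_commute)
      then show "g (insert i (insert j S)) * q' (insert i (insert k (insert x T))) =
        g (insert i (insert k S)) * q' (insert i (insert j (insert x T))) +
        g (insert i (insert x S)) * q' (insert i (insert j (insert k T)))"
        using rel[OF ijk q'(1)] gS ijk by auto
      show "g (insert i (insert j (insert k T))) = q' (insert i (insert j (insert k T)))"
        using gT[OF c ijk] unfolding T_def .
    next
      fix i j
      show "g (insert i (insert j (insert x T))) = 0 \<longleftrightarrow> q' (insert i (insert j (insert x T))) = 0"
        using qz[OF c'(1)] c'(2) gz by auto
    next
      show "g (insert a (insert b (insert d T))) \<noteq> 0" using abd q(2) gz by auto
      show "g (insert a (insert x S)) \<noteq> 0" "g (insert b (insert x S)) \<noteq> 0" "g (insert d (insert x S)) \<noteq> 0"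
        using sx abd by auto
    qed (use xS abd ij sn gz in \<open>auto simp: insert_commute\<close>)
  qed
  obtain a b where ab: "a \<in> P" "b \<in> P" "a \<noteq> b"
    using card_5_two[OF P(2)] .
  let ?B = "insert a (insert b S)"
  have nab: "a \<notin> S" "b \<notin> S" using ab P(1) by auto
  have "g X = q' X"
  proof (rule pluecker_laplace[OF g q'(1), of ?B "C \<union> {a, b}" "D \<union> (P - {a, b})"])
    show "g ?B = q' ?B" using gS ab by auto
    show "g ?B \<noteq> 0" using gz sn ab by auto
    fix y x assume y: "y \<in> C \<union> {a, b}" and x: "x \<in> D \<union> (P - {a, b})"
    show "g (insert x (?B - {y})) = q' (insert x (?B - {y}))"
    proof (cases "y \<in> C")
      case False
      then have "?B - {y} = insert b S \<or> ?B - {y} = insert a S" using y nab ab by auto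
      then show ?thesis using x gx gS ab by auto
    next
      case True
      then have "?B - {y} = insert a (insert b (S - {y}))" using nab unfolding C_def by auto
      then show ?thesis using x gT[OF True, of x a b] gTx[OF True, of x a b] ab
        by (auto simp: insert_commute)
    qed
  qed (use sub finite_X ab nab in \<open>auto simp: C_def D_def\<close>)
  then show False using pX q(2) q'(2) gz by metis
qed

text \<open>For a pair of minimal measure, the swap lemmas turn into the local conditions
  \<open>nl\<close>, \<open>par\<close>, \<open>ncl\<close> and \<open>ser\<close>, which are the
  hypotheses of the obstruction lemmas.\<close>

lemma no_five_points: "\<not> five_points p S P"
proof (induction "card (S - X) + card (X - S - P)" arbitrary: S P rule: less_induct)
  case less
  show ?case
  proof
    assume pts: "five_points p S P"
    note P = five_pointsD[OF pts] and sub = five_points_subset[OF pts]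
    have fin: "finite (S - X)" "finite (X - S - P)" using sub(3) finite_X by auto
    have nl: "\<exists>j\<in>P. p (insert x (insert j S)) \<noteq> 0" if x: "x \<in> X - S - P" for x
    proof (rule ccontr)
      assume "\<not> ?thesis"
      then obtain c where c: "c \<in> S - X" "five_points p (insert x (S - {c})) P"
        using swap_loop[OF pts, of x] x by blast
      have "insert x (S - {c}) - X \<subset> S - X" "X - insert x (S - {c}) - P \<subset> X - S - P"
        using c x by auto
      then have "card (insert x (S - {c}) - X) < card (S - X)"
          "card (X - insert x (S - {c}) - P) < card (X - S - P)"
        using fin by (auto intro: psubset_card_mono)
      then show False using less[of "insert x (S - {c})" P] c(2) by auto
    qed
    have par: "n \<in> X" if x: "x \<in> X - S - P" and n: "n \<in> P" "p (insert x (insert n S)) = 0" for x n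
    proof (rule ccontr)
      assume nX: "n \<notin> X"
      obtain j where j: "j \<in> P" "p (insert x (insert j S)) \<noteq> 0" using nl[OF x] by blast
      have "five_points p S (insert x (P - {n}))"
        using swap_parallel[OF pts, of x n] parallel_unique[OF pluecker(1) pts _ _ n j] x n by auto
      moreover have "X - S - insert x (P - {n}) \<subset> X - S - P" using nX x by auto
      then have "card (X - S - insert x (P - {n})) < card (X - S - P)"
        using fin by (auto intro: psubset_card_mono)
      ultimately show False using less[of S "insert x (P - {n})"] by auto
    qed
    have ncl: "\<exists>i\<in>P. \<exists>j\<in>P. \<exists>k\<in>P. distinct [i, j, k] \<and>
      p (insert i (insert j (insert k (S - {c})))) \<noteq> 0" if c: "c \<in> S - X" for c
    proof (rule ccontr)
      assume n: "\<not> ?thesis"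
      have T: "S = insert c (S - {c})" using c by auto
      have "\<exists>e\<in>X - insert c (S - {c}) - P. five_points p (insert e (S - {c})) P"
      proof (rule swap_coloop)
        show "five_points p (insert c (S - {c})) P" using pts T by simp
        show "p (insert i (insert j (insert k (S - {c})))) = 0"
          if "i \<in> P" "j \<in> P" "k \<in> P" "distinct [i, j, k]" for i j k
          using n that by blast
      qed (use c in auto)
      then obtain e where e: "e \<in> X - S - P" "five_points p (insert e (S - {c})) P"
        using c by auto
      have "insert e (S - {c}) - X \<subset> S - X" "X - insert e (S - {c}) - P \<subset> X - S - P"
        using c e by auto
      then have "card (insert e (S - {c}) - X) < card (S - X)"
          "card (X - insert e (S - {c}) - P) < card (X - S - P)"
        using fin by (auto intro: psubset_card_mono)
      then show False using less[of "insert e (S - {c})" P] e(2) by auto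
    qed
    have ser: "\<exists>i\<in>P-{n}. \<exists>j\<in>P-{n}. \<exists>k\<in>P-{n}. distinct [i, j, k] \<and>
      p (insert i (insert j (insert k (S - {c})))) \<noteq> 0" if c: "c \<in> S - X" and n: "n \<in> P \<inter> X" for c n
    proof (rule ccontr)
      assume neg: "\<not> ?thesis"
      have T: "S = insert c (S - {c})" using c by auto
      obtain a b d where abd: "a \<in> P" "b \<in> P" "d \<in> P" "distinct [a, b, d]"
        "p (insert a (insert b (insert d (S - {c})))) \<noteq> 0"
        using ncl[OF c] by blast
      have "five_points p (insert n (S - {c})) (insert c (P - {n}))"
      proof (rule swap_series[OF _ _ _ _ abd])
        show "five_points p (insert c (S - {c})) P" using pts T by simp
        show "p (insert i (insert j (insert k (S - {c})))) = 0"
          if "i \<in> P - {n}" "j \<in> P - {n}" "k \<in> P - {n}" "distinct [i, j, k]" for i j k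
          using neg that by blast
      qed (use c n in auto)
      moreover have "insert n (S - {c}) - X \<subset> S - X" using c n by auto
      then have "card (insert n (S - {c}) - X) < card (S - X)"
        using fin by (auto intro: psubset_card_mono)
      moreover have "X - insert n (S - {c}) - insert c (P - {n}) = X - S - P"
        using c n P(1) by auto
      ultimately show False using less[of "insert n (S - {c})" "insert c (P - {n})"] by auto
    qed
    consider "S - X = {}" | c where "S - X = {c}" | "card (S - X) \<ge> 2"
      by (metis One_nat_def Suc_1 card_0_eq card_1_singletonE fin(1) le_less_linear less_2_cases_iff)
    then show False
    proof cases
      case 1
      then have "S \<subseteq> X" by blast
      then show False by (rule empty_obstruction[OF pts _ par nl])
    next
      case 3
      then show False by (rule rigid_obstruction[OF pts _ par nl ncl ser])
    next
      case (2 c)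
      define T where "T = S - {c}"
      have T: "S = insert c T" "c \<notin> T" "T \<subseteq> X" "c \<notin> X" using 2 unfolding T_def by auto
      show False
      proof (cases "X \<subseteq> T \<union> P")
        case True
        then show False using triple_obstruction[of c T P] pts T by auto
      next
        case False
        then obtain x where x: "x \<in> X - S - P" using T by auto
        then obtain n where n: "n \<in> P" "p (insert x (insert n S)) = 0"
          using six_points[OF pluecker(1) pts] by blast
        have nX: "n \<in> X" using par[OF x n] .
        \<comment> \<open>Both \<open>x\<close> and \<open>n\<close> lie in \<open>X - T\<close>, so
          adding them to \<open>S\<close> gives \<open>X\<close> with its remaining element
          \<open>u\<close> replaced by \<open>c\<close>. This is a basis by
          \<open>exchange_X\<close>, although \<open>x\<close> and \<open>n\<close> are parallel
          over \<open>S\<close>.\<close>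
        have "card (X - T) = 3" using sub T by (subst card_Diff_subset) auto
        moreover have xn: "{x, n} \<subseteq> X - T" "x \<noteq> n" using x n nX T P(1) by auto
        ultimately have "card (X - T - {x, n}) = 1" by (subst card_Diff_subset) auto
        then obtain u where u: "X - T - {x, n} = {u}" by (auto simp: card_1_singleton_iff)
        then have "insert c (X - {u}) = insert x (insert n S)" using xn T by auto
        moreover have "p (insert c (X - {u})) \<noteq> 0"
          using u T sub by (intro exchange_X) auto
        ultimately show False using n by simp
      qed
    qed
  qed
qed

end

section \<open>Duality and binary matroids\<close>

text \<open>Contracting \<open>S\<close> and restricting to \<open>P\<close> gives a uniform matroid of rank \<open>k\<close>.\<close>

definition uniform_points :: "('a set \<Rightarrow> 'f::zero) \<Rightarrow> nat \<Rightarrow> 'a set \<Rightarrow> 'a set \<Rightarrow> bool" where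
  "uniform_points p k S P \<longleftrightarrow> S \<inter> P = {} \<and> (\<forall>Q. Q \<subseteq> P \<longrightarrow> card Q = k \<longrightarrow> p (S \<union> Q) \<noteq> 0)"

text \<open>Pluecker coordinates of the orthogonal space; the usual signs disappear together with
  those of \<open>pluecker\<close>.\<close>

definition dual_coords :: "'a set \<Rightarrow> ('a set \<Rightarrow> 'f) \<Rightarrow> 'a set \<Rightarrow> 'f::zero" where
  "dual_coords E p B = (if B \<subseteq> E then p (E - B) else 0)"

lemma five_points_if_uniform:
  assumes "uniform_points p 2 S P" "card P = 5"
  shows "five_points p S P"
  unfolding five_points_def
proof (intro conjI ballI impI)
  fix i j assume "i \<in> P" "j \<in> P" "i \<noteq> j"
  then have "{i, j} \<subseteq> P" "card {i, j} = 2" by simp_all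
  then have "p (S \<union> {i, j}) \<noteq> 0" using assms(1) unfolding uniform_points_def by blast
  then show "p (insert i (insert j S)) \<noteq> 0" by simp
qed (use assms in \<open>auto simp: uniform_points_def\<close>)

text \<open>Under complementation the exchange relation turns into itself with the roles of
  \<open>B\<close> and \<open>B'\<close> interchanged.\<close>

lemma pluecker_dual:
  fixes p :: "'a set \<Rightarrow> 'f::field"
  assumes "pluecker p"
  shows "pluecker (dual_coords E p)"
  unfolding pluecker_def
proof (intro allI impI)
  fix B B' :: "'a set" and x assume x: "x \<in> B' - B"
  let ?d = "dual_coords E p"
  show "?d B * ?d B' = (\<Sum>b\<in>B-B'. ?d (insert x (B - {b})) * ?d (insert b (B' - {x})))"
  proof (cases "B \<subseteq> E \<and> B' \<subseteq> E")
    case True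
    then have xA: "x \<in> (E - B) - (E - B')" and AA: "(E - B') - (E - B) = B - B'" using x by blast+
    have "?d (insert x (B - {b})) * ?d (insert b (B' - {x})) =
        p (insert x (E - B' - {b})) * p (insert b (E - B - {x}))" if b: "b \<in> B - B'" for b
    proof -
      have "insert x (B - {b}) \<subseteq> E" "insert b (B' - {x}) \<subseteq> E" using True x b by blast+
      moreover have "E - insert x (B - {b}) = insert b (E - B - {x})"
          "E - insert b (B' - {x}) = insert x (E - B' - {b})" using True x b by blast+
      ultimately show ?thesis unfolding dual_coords_def by simp
    qed
    then have "(\<Sum>b\<in>B-B'. ?d (insert x (B - {b})) * ?d (insert b (B' - {x}))) = p (E - B') * p (E - B)"
      unfolding plueckerD[OF assms xA] AA by (rule sum.cong[OF refl])
    then show ?thesis using True unfolding dual_coords_def by simp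
  next
    case False
    have "?d (insert x (B - {b})) * ?d (insert b (B' - {x})) = 0" if b: "b \<in> B - B'" for b
    proof -
      have "\<not> (insert x (B - {b}) \<subseteq> E \<and> insert b (B' - {x}) \<subseteq> E)" using False b x by blast
      then show ?thesis unfolding dual_coords_def by auto
    qed
    then have "(\<Sum>b\<in>B-B'. ?d (insert x (B - {b})) * ?d (insert b (B' - {x}))) = 0"
      by (rule sum.neutral[OF ballI])
    then show ?thesis using False unfolding dual_coords_def by auto
  qed
qed

text \<open>Duality interchanges the contracted set with the deleted one, and rank \<open>k\<close>
  with \<open>card P - k\<close>.\<close>

lemma uniform_points_dual:
  assumes u: "uniform_points p k S P" and E: "S \<union> P \<subseteq> E" "finite E" and k: "k \<le> card P"
  shows "uniform_points (dual_coords E p) (card P - k) (E - S - P) P"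
  unfolding uniform_points_def
proof (intro conjI allI impI)
  fix Q assume Q: "Q \<subseteq> P" "card Q = card P - k"
  have "finite P" using E by (meson finite_subset le_sup_iff)
  then have "card (P - Q) = k" using Q k by (simp add: card_Diff_subset finite_subset)
  then have "p (S \<union> (P - Q)) \<noteq> 0" using u unfolding uniform_points_def by blast
  moreover have "E - (E - S - P \<union> Q) = S \<union> (P - Q)" "E - S - P \<union> Q \<subseteq> E"
    using E(1) Q(1) u unfolding uniform_points_def by blast+
  ultimately show "dual_coords E p (E - S - P \<union> Q) \<noteq> 0" unfolding dual_coords_def by simp
qed blast

text \<open>\<open>{0, 1}\<close> is a subfield, so the recursion of \<open>pluecker_laplace\<close>
  never leaves it.\<close>

lemma (in gf4) pluecker_zero_one:
  fixes p :: "'a set \<Rightarrow> 'f"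
  assumes "pluecker p" and B0: "p B\<^sub>0 = 1" "finite B\<^sub>0" "B\<^sub>0 \<subseteq> E"
    and neighbours: "\<And>b x. b \<in> B\<^sub>0 \<Longrightarrow> x \<in> E - B\<^sub>0 \<Longrightarrow> p (insert x (B\<^sub>0 - {b})) \<in> {0, 1}"
    and "finite B" "card B = card B\<^sub>0" "B \<subseteq> E"
  shows "p B \<in> {0, 1}"
  using assms(6-)
proof (induction "card (B - B\<^sub>0)" arbitrary: B)
  case 0
  then have "B \<subseteq> B\<^sub>0" by auto
  then have "B = B\<^sub>0" using 0 B0(2) by (metis card_subset_eq)
  then show ?case using B0 by simp
next
  case (Suc n)
  then have "B - B\<^sub>0 \<noteq> {}" by (metis card.empty nat.distinct(1))
  then obtain x where x: "x \<in> B - B\<^sub>0" by blast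
  have sum01: "sum f A \<in> {0, 1}" if "\<And>a. a \<in> A \<Longrightarrow> f a \<in> {0, 1}" for f :: "'a \<Rightarrow> 'f" and A
    using that
  proof (induction A rule: infinite_finite_induct)
    case (insert x A)
    then have "f x \<in> {0, 1}" "sum f A \<in> {0, 1}" by simp_all
    then show ?case using insert.hyps by auto
  qed simp_all
  have "p (insert x (B\<^sub>0 - {b})) * p (insert b (B - {x})) \<in> {0, 1}" if b: "b \<in> B\<^sub>0 - B" for b
  proof -
    have "insert b (B - {x}) - B\<^sub>0 = B - B\<^sub>0 - {x}" using b by auto
    then have "card (insert b (B - {x}) - B\<^sub>0) = n" using Suc.hyps(2) x by simp
    moreover have "card (insert b (B - {x})) = card B\<^sub>0"
      using card_exchange[of B x b] Suc.prems(1,2) x b by (metis Diff_iff)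
    ultimately have "p (insert b (B - {x})) \<in> {0, 1}"
      using Suc.prems B0(3) b by (intro Suc.hyps(1)) auto
    then show ?thesis using neighbours[of b x] Suc.prems x b by auto
  qed
  then have "(\<Sum>b\<in>B\<^sub>0-B. p (insert x (B\<^sub>0 - {b})) * p (insert b (B - {x}))) \<in> {0, 1}"
    by (rule sum01)
  then show ?case using plueckerD[OF assms(1) x] B0(1) by simp
qed

section \<open>Duals of relaxations, and the binary case\<close>

context relaxed_pair
begin

lemma relaxed_pair_dual: "relaxed_pair E (E - X) (dual_coords E p) (dual_coords E p')"
proof
  have EX: "E - (E - X) = X" using X_subset by blast
  show "finite E" "E - X \<subseteq> E" using finite_E by auto
  show "pluecker (dual_coords E p)" "pluecker (dual_coords E p')"
    using pluecker pluecker_dual by auto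
  show "dual_coords E p (E - X) = 0" "dual_coords E p' (E - X) \<noteq> 0"
    using pX unfolding dual_coords_def EX by simp_all
  show "B \<subseteq> E \<and> card B = card (E - X)" if "dual_coords E p B \<noteq> 0" for B
  proof -
    have B: "B \<subseteq> E" "p (E - B) \<noteq> 0" using that unfolding dual_coords_def by (auto split: if_splits)
    then have "card E - card B = card X"
      using support[OF B(2)] finite_E by (simp add: card_Diff_subset finite_subset)
    moreover have "card B \<le> card E" using B finite_E by (simp add: card_mono)
    ultimately have "card B = card E - card X" by linarith
    then show ?thesis using B X_subset finite_X by (simp add: card_Diff_subset)
  qed
  show "dual_coords E p' B = 0 \<longleftrightarrow> dual_coords E p B = 0" if "B \<noteq> E - X" for B
  proof (cases "B \<subseteq> E")
    case True
    then have "E - B \<noteq> X" using that by blast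
    then show ?thesis using zero_iff True unfolding dual_coords_def by simp
  qed (simp add: dual_coords_def)
  show "dual_coords E p (insert y (E - X - {x})) \<noteq> 0" if "x \<in> E - X" "y \<in> E - (E - X)" for x y
  proof -
    have "E - insert y (E - X - {x}) = insert x (X - {y})" "insert y (E - X - {x}) \<subseteq> E" "y \<in> X"
      using that X_subset by blast+
    then show ?thesis using exchange_X[of y x] that(1) unfolding dual_coords_def by simp
  qed
qed

lemma no_uniform_five:
  assumes "uniform_points p k S P" "card P = 5" "k = 2 \<or> k = 3"
  shows False
  using assms(3)
proof
  assume "k = 2"
  then show False using no_five_points five_points_if_uniform assms by blast
next
  assume k: "k = 3"
  have "P \<subseteq> E \<and> S \<subseteq> E"
  proof -
    have "i \<in> E \<and> S \<subseteq> E" if i: "i \<in> P" for i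
    proof -
      have fin: "finite P" using assms(2) card.infinite by force
      have "2 \<le> card (P - {i})" using assms(2) i fin by simp
      then obtain Q where Q: "Q \<subseteq> P - {i}" "card Q = 2" by (meson obtain_subset_with_card_n)
      moreover have "finite Q" "i \<notin> Q" using Q by (auto intro: card_ge_0_finite)
      ultimately have "insert i Q \<subseteq> P" "card (insert i Q) = k" using i k by auto
      then show ?thesis using assms(1) support unfolding uniform_points_def by blast
    qed
    moreover have "P \<noteq> {}" using assms(2) by auto
    ultimately show ?thesis by blast
  qed
  then have "uniform_points (dual_coords E p) 2 (E - S - P) P"
    using uniform_points_dual[OF assms(1), of E] finite_E assms(2) k by simp
  then show False
    using relaxed_pair.no_five_points[OF relaxed_pair_dual] five_points_if_uniform assms(2) by blast
qed

lemma card_outside_le_1: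
  assumes nonzero: "p' B \<noteq> 0" and no4: "\<And>S P. card P = 4 \<Longrightarrow> \<not> uniform_points p' 2 S P"
  shows "card (B - X) \<le> 1"
proof (rule ccontr)
  have two: "p' (insert y (insert y' (X - {x, x'}))) = 0"
    if "x \<in> X" "x' \<in> X" "x \<noteq> x'" "y \<in> E - X" "y' \<in> E - X" "y \<noteq> y'" for x x' y y'
  proof (rule ccontr)
    assume nz: "p' (insert y (insert y' (X - {x, x'}))) \<noteq> 0"
    have nX: "p' (insert w (X - {v})) \<noteq> 0" if "v \<in> X" "w \<in> E - X" for v w
      using exchange_X[OF that] zero_iff[of "insert w (X - {v})"] that by auto
    let ?S = "X - {x, x'}" and ?P = "{x, x', y, y'}"
    have "x \<noteq> y" "x \<noteq> y'" "x' \<noteq> y" "x' \<noteq> y'" using that by blast+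
    then have "card ?P = 4" using that(3,6) by simp
    moreover have "uniform_points p' 2 ?S ?P"
      unfolding uniform_points_def
    proof (intro conjI allI impI)
      show "?S \<inter> ?P = {}" using that by auto
      fix Q assume Q: "Q \<subseteq> ?P" "card Q = 2"
      then obtain a b where ab: "Q = {a, b}" "a \<noteq> b" by (meson card_2_iff)
      have sets: "?S \<union> {x, x'} = X" "?S \<union> {x, w} = insert w (X - {x'})" "?S \<union> {x', w} = insert w (X - {x})"
          "?S \<union> {y, y'} = insert y (insert y' ?S)" for w
        using that by blast+
      consider "Q = {x, x'}" | "Q = {x, y}" | "Q = {x, y'}" | "Q = {x', y}" | "Q = {x', y'}" | "Q = {y, y'}"
        using Q(1) ab unfolding ab(1) by (auto simp: insert_commute)
      then show "p' (?S \<union> Q) \<noteq> 0"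
        by cases (use sets nX pX nz that in auto)
    qed
    ultimately show False using no4 by blast
  qed
  assume "\<not> card (B - X) \<le> 1"
  then have "2 \<le> card (B - X)" by simp
  then show False using nonzero
  proof (induction "card (B - X)" arbitrary: B rule: less_induct)
    case less
    have B: "B \<subseteq> E" "card B = card X" "finite B"
      using support'[OF less.prems(2)] finite_support(2)[OF less.prems(2)] by auto
    show False
    proof (cases "card (B - X) = 2")
      case True
      then obtain y y' where y: "B - X = {y, y'}" "y \<noteq> y'" by (meson card_2_iff)
      have "card (X - B) = card (B - X)"
        using B finite_X by (metis card_le_sym_Diff card_le_sym_Diff le_antisym order_refl)
      then obtain x x' where x: "X - B = {x, x'}" "x \<noteq> x'" using True by (metis card_2_iff)
      have "B = insert y (insert y' (X - {x, x'}))" using x y by blast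
      then show False using two[of x x' y y'] x y B less.prems(2) by blast
    next
      case False
      then have "2 < card (B - X)" using less.prems(1) by simp
      then have "B - X \<noteq> {}" by (metis card.empty not_less_zero)
      then obtain v where v: "v \<in> B - X" by blast
      obtain b where b: "b \<in> X - B" "p' (insert b (B - {v})) \<noteq> 0"
        using pluecker_exchange[OF pluecker(2) pX(2) less.prems(2) v] by blast
      have "insert b (B - {v}) - X = B - X - {v}" using b by blast
      then have c: "card (insert b (B - {v}) - X) = card (B - X) - 1" using v by simp
      have "2 \<le> card (insert b (B - {v}) - X)" "card (insert b (B - {v}) - X) < card (B - X)"
        unfolding c using \<open>2 < card (B - X)\<close> by linarith+
      then show False using less.hyps b(2) by blast
    qed
  qed
qed

text \<open>The values at \<open>X - {x}\<close> with \<open>y\<close> added form a matrix without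
  zeros. As \<open>p X = 0\<close>, the three-term relations make its two-by-two minors vanish, so
  it has rank one and can be scaled to all ones.\<close>

lemma exists_unit_gauge:
  assumes f: "f \<in> X" and e: "e \<in> E - X"
  shows "\<exists>g :: 'a set \<Rightarrow> 'f. pluecker g \<and> (\<forall>B. g B = 0 \<longleftrightarrow> p B = 0) \<and> (\<forall>x\<in>X. \<forall>y\<in>E-X. g (insert y (X - {x})) = 1)"
proof -
  define \<alpha> where "\<alpha> x y = p (insert y (X - {x}))" for x y
  have \<alpha>0: "\<alpha> x y \<noteq> 0" if "x \<in> X" "y \<in> E - X" for x y
    using exchange_X[OF that] unfolding \<alpha>_def .
  have rank1: "\<alpha> f e * \<alpha> x y = \<alpha> f y * \<alpha> x e" if x: "x \<in> X" and y: "y \<in> E - X" for x y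
  proof (cases "x = f \<or> y = e")
    case False
    let ?T = "X - {x, f}"
    have "distinct [x, f, y, e]" "x \<notin> ?T" "f \<notin> ?T" "y \<notin> ?T" "e \<notin> ?T" using False x y e f by auto
    from pluecker_three_term[OF pluecker(1) this]
    have "p (insert x (insert f ?T)) * p (insert y (insert e ?T)) =
      p (insert x (insert y ?T)) * p (insert f (insert e ?T)) +
      p (insert x (insert e ?T)) * p (insert f (insert y ?T))" .
    moreover have "insert x (insert f ?T) = X" "insert x (insert y ?T) = insert y (X - {f})"
      "insert f (insert e ?T) = insert e (X - {x})" "insert x (insert e ?T) = insert e (X - {f})"
      "insert f (insert y ?T) = insert y (X - {x})" using False x f by blast+
    ultimately have "0 = \<alpha> f y * \<alpha> x e + \<alpha> f e * \<alpha> x y" using pX(1) unfolding \<alpha>_def by simp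
    then show ?thesis using char_2_eqI by metis
  qed (auto simp: mult.commute)
  define \<nu> where "\<nu> u = (if u \<in> X then \<alpha> u e / \<alpha> f e else if u \<in> E then 1 / \<alpha> f u else 1)" for u
  define g where "g B = inverse (prod \<nu> X) * prod \<nu> B * p B" for B
  have \<nu>0: "\<nu> u \<noteq> 0" for u unfolding \<nu>_def using \<alpha>0 e f by auto
  have \<nu>X: "prod \<nu> X \<noteq> 0" using \<nu>0 finite_X by simp
  have "pluecker g" unfolding g_def by (rule pluecker_gauge[OF pluecker(1) finite_support(1)])
  moreover have "g B = 0 \<longleftrightarrow> p B = 0" for B
    unfolding g_def using \<nu>X \<nu>0 by (cases "finite B") auto
  moreover have "g (insert y (X - {x})) = 1" if x: "x \<in> X" and y: "y \<in> E - X" for x y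
  proof -
    have "prod \<nu> X = \<nu> x * prod \<nu> (X - {x})" using x finite_X by (rule prod.remove[rotated])
    moreover have "prod \<nu> (insert y (X - {x})) = \<nu> y * prod \<nu> (X - {x})" using y finite_X by simp
    moreover have "\<nu> x = \<alpha> x e / \<alpha> f e" "\<nu> y = 1 / \<alpha> f y" using x y unfolding \<nu>_def by auto
    moreover have "prod \<nu> (X - {x}) \<noteq> 0" using \<nu>0 finite_X by simp
    ultimately have "g (insert y (X - {x})) = (1 / \<alpha> f y) / (\<alpha> x e / \<alpha> f e) * \<alpha> x y"
      unfolding g_def \<alpha>_def[symmetric] by simp
    then show ?thesis using rank1[OF x y] \<alpha>0[OF x e] \<alpha>0[OF f y] by simp
  qed
  ultimately show ?thesis by blast
qed

text \<open>Starting from the unit gauge, the only neighbours of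
  \<open>insert \<epsilon> (X - {f})\<close> still to be normalised are the entries
  \<open>\<delta> f x \<epsilon> y\<close>. If all nonzero ones are equal, one more scaling puts
  \<open>p\<close> into \<open>{0, 1}\<close>, and four points on a line have no such
  representation.\<close>

lemma no_uniform_four:
  assumes no5: "\<And>k S P. k = 2 \<or> k = 3 \<Longrightarrow> card P = 5 \<Longrightarrow> \<not> uniform_points p' k S P"
    and u: "uniform_points p 2 S P" "card P = 4"
  shows False
proof -
  have finP: "finite P" using u(2) card.infinite by force
  obtain a b d e where P: "P = {a, b, d, e}" "distinct [a, b, d, e]"
  proof -
    obtain xs where xs: "set xs = P" "distinct xs" using finite_distinct_list[OF finP] by blast
    then have "length xs = 4" using u(2) by (metis distinct_card)
    then obtain a b d e where "xs = [a, b, d, e]" by (auto simp: numeral_eq_Suc length_Suc_conv)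
    then show thesis using that xs by auto
  qed
  have pS: "p (insert i (insert j S)) \<noteq> 0" if "i \<in> P" "j \<in> P" "i \<noteq> j" for i j
  proof -
    have "{i, j} \<subseteq> P" "card {i, j} = 2" using that by simp_all
    then have "p (S \<union> {i, j}) \<noteq> 0" using u(1) unfolding uniform_points_def by blast
    then show ?thesis by simp
  qed
  have pab: "p (insert a (insert b S)) \<noteq> 0" using pS P by auto
  have B: "insert a (insert b S) \<subseteq> E" "card (insert a (insert b S)) = card X" "insert a (insert b S) \<noteq> X"
    using support[OF pab] pab pX(1) by auto
  have finB: "finite (insert a (insert b S))" using finite_support(1)[OF pab] .
  have "\<not> insert a (insert b S) \<subseteq> X" "\<not> X \<subseteq> insert a (insert b S)"
    using B finB finite_X by (metis card_subset_eq)+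
  then obtain f \<epsilon> where f: "f \<in> X" and \<epsilon>: "\<epsilon> \<in> E - X" using B(1) by blast
  obtain g :: "'a set \<Rightarrow> 'f" where gg: "pluecker g" "\<forall>B. g B = 0 \<longleftrightarrow> p B = 0" "\<forall>x\<in>X. \<forall>y\<in>E-X. g (insert y (X - {x})) = 1"
    using exists_unit_gauge[OF f \<epsilon>] by blast
  have g: "pluecker g" "g B = 0 \<longleftrightarrow> p B = 0" for B using gg(1,2) by blast+
  have g1: "g (insert y (X - {x})) = 1" if "x \<in> X" "y \<in> E - X" for x y using gg(3) that by blast
  have nX: "p' (insert y (X - {x})) \<noteq> 0" if "x \<in> X" "y \<in> E - X" for x y
    using exchange_X[OF that] zero_iff[of "insert y (X - {x})"] that by auto
  \<comment> \<open>Three non-zero values of \<open>\<delta>\<close> in a row or column would give a minor \<open>U\<^bsub>2,5\<^esub>\<close> or \<open>U\<^bsub>3,5\<^esub>\<close> of \<open>p'\<close>.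
     As they add up to \<open>0\<close>, all non-zero entries \<open>\<delta> f x \<epsilon> y\<close> turn out to be equal.\<close>
  define \<delta> where "\<delta> x x' y y' = g (insert y (insert y' (X - {x, x'})))" for x x' y y'
  have \<delta>_p': "p' (insert y (insert y' (X - {x, x'}))) \<noteq> 0" if "\<delta> x x' y y' \<noteq> 0" "y \<in> E - X" for x x' y y'
    using that g(2) zero_iff[of "insert y (insert y' (X - {x, x'}))"] unfolding \<delta>_def by auto
  have cols: "\<delta> x x' y2 y3 = \<delta> x x' y1 y3 + \<delta> x x' y1 y2"
      "\<delta> x x' y2 y3 = 0 \<or> \<delta> x x' y1 y3 = 0 \<or> \<delta> x x' y1 y2 = 0"
    if x: "x \<in> X" "x' \<in> X" "x \<noteq> x'" and y: "y1 \<in> E - X" "y2 \<in> E - X" "y3 \<in> E - X" "distinct [y1, y2, y3]"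
    for x x' y1 y2 y3
  proof -
    let ?T = "X - {x, x'}"
    have ne: "x \<noteq> y1" "x \<noteq> y2" "x \<noteq> y3" "x' \<noteq> y1" "x' \<noteq> y2" "x' \<noteq> y3" using x y by blast+
    have nT: "x \<notin> ?T" "y1 \<notin> ?T" "y2 \<notin> ?T" "y3 \<notin> ?T" using y by blast+
    have sx: "insert x (insert y ?T) = insert y (X - {x'})" "insert x' (insert y ?T) = insert y (X - {x})"
      "insert x (insert x' ?T) = X" for y
      using x by blast+
    have "distinct [x, y1, y2, y3]" using ne y(4) by simp
    from pluecker_three_term[OF g(1) this nT]
    show "\<delta> x x' y2 y3 = \<delta> x x' y1 y3 + \<delta> x x' y1 y2"
      unfolding sx(1) \<delta>_def using g1[OF x(2) y(1)] g1[OF x(2) y(2)] g1[OF x(2) y(3)] by simp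
    show "\<delta> x x' y2 y3 = 0 \<or> \<delta> x x' y1 y3 = 0 \<or> \<delta> x x' y1 y2 = 0"
    proof (rule ccontr)
      assume n: "\<not> ?thesis"
      let ?P = "{x, x', y1, y2, y3}"
      have "card ?P = 5" using ne x(3) y(4) by simp
      moreover have "uniform_points p' 2 ?T ?P"
        unfolding uniform_points_def
      proof (intro conjI allI impI)
        show "?T \<inter> ?P = {}" using y by blast
        fix Q assume Q: "Q \<subseteq> ?P" "card Q = 2"
        then obtain u v where uv: "Q = {u, v}" "u \<noteq> v" by (meson card_2_iff)
        have sQ: "?T \<union> {u, v} = insert u (insert v ?T)" by simp
        have "u \<in> ?P" "v \<in> ?P" using Q(1) unfolding uv(1) by blast+
        then have "Q \<in> {{x, x'}, {x, y1}, {x, y2}, {x, y3}, {x', y1}, {x', y2}, {x', y3}, {y1, y2}, {y1, y3}, {y2, y3}}"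
          unfolding uv(1) using uv(2) by (elim insertE emptyE) (simp_all only: doubleton_eq_iff insert_iff simp_thms)
        moreover have "p' (insert x (insert x' ?T)) \<noteq> 0" unfolding sx(3) by (rule pX(2))
        moreover have "p' (insert x (insert w ?T)) \<noteq> 0" "p' (insert x' (insert w ?T)) \<noteq> 0" if "w \<in> E - X" for w
          unfolding sx(1,2) using nX[OF x(2) that] nX[OF x(1) that] .
        moreover have "p' (insert y1 (insert y2 ?T)) \<noteq> 0" "p' (insert y1 (insert y3 ?T)) \<noteq> 0"
            "p' (insert y2 (insert y3 ?T)) \<noteq> 0"
          by (rule \<delta>_p'; use n y(1-3) in blast)+
        moreover have "?T \<union> {v, w} = insert v (insert w ?T)" for v w by blast
        ultimately show "p' (?T \<union> Q) \<noteq> 0" using y(1-3) by (elim insertE emptyE) (simp_all only: not_False_eq_True)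
      qed
      ultimately show False using no5 by blast
    qed
  qed
  have rows: "\<delta> x2 x3 y y' = \<delta> x1 x3 y y' + \<delta> x1 x2 y y'"
      "\<delta> x2 x3 y y' = 0 \<or> \<delta> x1 x3 y y' = 0 \<or> \<delta> x1 x2 y y' = 0"
    if x: "x1 \<in> X" "x2 \<in> X" "x3 \<in> X" "distinct [x1, x2, x3]" and y: "y \<in> E - X" "y' \<in> E - X" "y \<noteq> y'"
    for x1 x2 x3 y y'
  proof -
    let ?T = "X - {x1, x2, x3}"
    have ne: "x1 \<noteq> y" "x2 \<noteq> y" "x3 \<noteq> y" "x1 \<noteq> y'" "x2 \<noteq> y'" "x3 \<noteq> y'" using x y by blast+
    have xd: "x1 \<noteq> x2" "x1 \<noteq> x3" "x2 \<noteq> x3" using x(4) by auto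
    have nT: "x1 \<notin> ?T" "x2 \<notin> ?T" "x3 \<notin> ?T" "y' \<notin> ?T" using y by blast+
    have sx: "insert y (insert x1 (insert x2 ?T)) = insert y (X - {x3})" "insert y (insert x1 (insert x3 ?T)) = insert y (X - {x2})"
      "insert y (insert x2 (insert x3 ?T)) = insert y (X - {x1})"
      "insert x1 (insert x2 (insert x3 ?T)) = X"
      "insert y (insert y' (insert x1 ?T)) = insert y (insert y' (X - {x2, x3}))"
      "insert y (insert y' (insert x2 ?T)) = insert y (insert y' (X - {x1, x3}))"
      "insert y (insert y' (insert x3 ?T)) = insert y (insert y' (X - {x1, x2}))" for y y'
      using x(1-3) xd by blast+
    have "distinct [y, y', x1, x2, x3]" using ne xd y(3) by auto
    from pluecker_three_term_base[OF g(1) this nT(4,1,2,3)]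
    show "\<delta> x2 x3 y y' = \<delta> x1 x3 y y' + \<delta> x1 x2 y y'"
      unfolding sx(1-3) unfolding sx(5-7) \<delta>_def using g1[OF x(1) y(1)] g1[OF x(2) y(1)] g1[OF x(3) y(1)] by simp
    show "\<delta> x2 x3 y y' = 0 \<or> \<delta> x1 x3 y y' = 0 \<or> \<delta> x1 x2 y y' = 0"
    proof (rule ccontr)
      assume n: "\<not> ?thesis"
      let ?P = "{x1, x2, x3, y, y'}"
      have card: "card ?P = 5" using ne xd y(3) by simp
      have "uniform_points p' 3 ?T ?P"
        unfolding uniform_points_def
      proof (intro conjI allI impI)
        show "?T \<inter> ?P = {}" using y by blast
        fix Q assume Q: "Q \<subseteq> ?P" "card Q = 3"
        then have "card (?P - Q) = 2" using card by (simp add: card_Diff_subset finite_subset)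
        then obtain u v where uv: "?P - Q = {u, v}" "u \<noteq> v" by (meson card_2_iff)
        then have "u \<in> ?P" "v \<in> ?P" by blast+
        then have "{u, v} \<in> {{x1, x2}, {x1, x3}, {x2, x3}, {x1, y}, {x2, y}, {x3, y}, {x1, y'}, {x2, y'}, {x3, y'}, {y, y'}}"
          using uv(2) by (elim insertE emptyE) (simp_all only: doubleton_eq_iff insert_iff simp_thms)
        moreover have "Q = ?P - {u, v}" using uv(1) Q(1) by blast
        moreover have "?P - {x1, x2} = {y, y', x3}" "?P - {x1, x3} = {y, y', x2}" "?P - {x2, x3} = {y, y', x1}"
          "?P - {x1, y} = {y', x2, x3}" "?P - {x2, y} = {y', x1, x3}" "?P - {x3, y} = {y', x1, x2}"
          "?P - {x1, y'} = {y, x2, x3}" "?P - {x2, y'} = {y, x1, x3}" "?P - {x3, y'} = {y, x1, x2}"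
          "?P - {y, y'} = {x1, x2, x3}"
          using ne xd y(3) by auto
        ultimately have "Q \<in> {{y, y', x3}, {y, y', x2}, {y, y', x1}, {y', x2, x3}, {y', x1, x3}, {y', x1, x2},
          {y, x2, x3}, {y, x1, x3}, {y, x1, x2}, {x1, x2, x3}}"
          by (elim insertE emptyE) (simp_all only: insert_iff simp_thms)
        moreover have "p' (insert y (insert y' (insert x3 ?T))) \<noteq> 0" "p' (insert y (insert y' (insert x2 ?T))) \<noteq> 0"
            "p' (insert y (insert y' (insert x1 ?T))) \<noteq> 0"
          unfolding sx(5-7) by (rule \<delta>_p'; use n y(1) in blast)+
        moreover have "p' (insert w (insert x2 (insert x3 ?T))) \<noteq> 0" "p' (insert w (insert x1 (insert x3 ?T))) \<noteq> 0"
            "p' (insert w (insert x1 (insert x2 ?T))) \<noteq> 0" if "w \<in> E - X" for w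
          unfolding sx(1-3) using nX[OF x(1) that] nX[OF x(2) that] nX[OF x(3) that] .
        moreover have "p' (insert x1 (insert x2 (insert x3 ?T))) \<noteq> 0" unfolding sx(4) by (rule pX(2))
        moreover have "?T \<union> {u, v, w} = insert u (insert v (insert w ?T))" for u v w by blast
        ultimately show "p' (?T \<union> Q) \<noteq> 0" using y(1,2) by (elim insertE emptyE) (simp_all only: not_False_eq_True)
      qed
      then show False using no5 card by blast
    qed
  qed
  have common: "\<delta> f x \<epsilon> y = \<delta> f x' \<epsilon> y'"
    if x: "x \<in> X - {f}" "x' \<in> X - {f}" and y: "y \<in> E - X - {\<epsilon>}" "y' \<in> E - X - {\<epsilon>}"
      and nz: "\<delta> f x \<epsilon> y \<noteq> 0" "\<delta> f x' \<epsilon> y' \<noteq> 0" for x x' y y'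
  proof -
    have row: "\<delta> f x \<epsilon> y = \<delta> f x \<epsilon> y'" if x: "x \<in> X - {f}" and y: "y \<in> E - X - {\<epsilon>}" "y' \<in> E - X - {\<epsilon>}"
      and nz: "\<delta> f x \<epsilon> y \<noteq> 0" "\<delta> f x \<epsilon> y' \<noteq> 0" for x y y'
    proof (cases "y = y'")
      case False
      have "f \<noteq> x" "x \<in> X" "y \<in> E - X" "y' \<in> E - X" "distinct [\<epsilon>, y, y']" using x y False by auto
      from cols[OF f this(2,1) \<epsilon> this(3-5)] nz have "0 = \<delta> f x \<epsilon> y' + \<delta> f x \<epsilon> y" by auto
      then show ?thesis using char_2_eqI by metis
    qed simp
    have col: "\<delta> f x \<epsilon> y = \<delta> f x' \<epsilon> y" if x: "x \<in> X - {f}" "x' \<in> X - {f}" and y: "y \<in> E - X - {\<epsilon>}"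
      and nz: "\<delta> f x \<epsilon> y \<noteq> 0" "\<delta> f x' \<epsilon> y \<noteq> 0" for x x' y
    proof (cases "x = x'")
      case False
      have "x \<in> X" "x' \<in> X" "y \<in> E - X" "\<epsilon> \<noteq> y" "distinct [f, x, x']" using x y False by auto
      from rows[OF f this(1,2,5) \<epsilon> this(3,4)] nz have "0 = \<delta> f x' \<epsilon> y + \<delta> f x \<epsilon> y" by auto
      then show ?thesis using char_2_eqI by metis
    qed simp
    show ?thesis
    proof (rule ccontr)
      assume ne: "\<not> ?thesis"
      have x0: "\<delta> f x \<epsilon> y' = 0" using row[OF x(1) y nz(1)] col[OF x y(2) _ nz(2)] ne by metis
      have y0: "\<delta> f x' \<epsilon> y = 0" using row[OF x(2) y(1,2) _ nz(2)] col[OF x y(1) nz(1)] ne by metis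
      have "x \<noteq> x'" "y \<noteq> y'" using x0 nz by auto
      have in_X: "x \<in> X" "x' \<in> X" "y \<in> E - X" "y' \<in> E - X" "\<epsilon> \<noteq> y" "\<epsilon> \<noteq> y'" "distinct [f, x, x']" "distinct [\<epsilon>, y, y']"
        using x y \<open>x \<noteq> x'\<close> \<open>y \<noteq> y'\<close> by auto
      \<comment> \<open>With zeros in the two opposite corners, both nonzero entries reappear for
        the same pair \<open>x\<close>, \<open>x'\<close>, where the column argument compares
        them.\<close>
      have "\<delta> x x' \<epsilon> y = \<delta> f x \<epsilon> y" "\<delta> x x' \<epsilon> y' = \<delta> f x' \<epsilon> y'"
        using rows(1)[OF f in_X(1,2,7) \<epsilon> in_X(3,5)] rows(1)[OF f in_X(1,2,7) \<epsilon> in_X(4,6)] x0 y0 by simp_all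
      moreover have "\<delta> x x' y y' = \<delta> x x' \<epsilon> y' + \<delta> x x' \<epsilon> y"
          "\<delta> x x' y y' = 0 \<or> \<delta> x x' \<epsilon> y' = 0 \<or> \<delta> x x' \<epsilon> y = 0"
        using cols[OF in_X(1,2) \<open>x \<noteq> x'\<close> \<epsilon> in_X(3,4,8)] by blast+
      ultimately have "\<delta> f x' \<epsilon> y' + \<delta> f x \<epsilon> y = 0" using nz by auto
      then show False using ne char_2_eqI by metis
    qed
  qed
  obtain c where c: "c \<noteq> 0" "\<And>x y. x \<in> X - {f} \<Longrightarrow> y \<in> E - X - {\<epsilon>} \<Longrightarrow> \<delta> f x \<epsilon> y \<in> {0, c}"
  proof (cases "\<exists>x\<in>X-{f}. \<exists>y\<in>E-X-{\<epsilon>}. \<delta> f x \<epsilon> y \<noteq> 0")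
    case True
    then obtain x y where xy: "x \<in> X - {f}" "y \<in> E - X - {\<epsilon>}" "\<delta> f x \<epsilon> y \<noteq> 0" by blast
    show thesis
    proof (rule that[OF xy(3)])
      show "\<delta> f x' \<epsilon> y' \<in> {0, \<delta> f x \<epsilon> y}" if "x' \<in> X - {f}" "y' \<in> E - X - {\<epsilon>}" for x' y'
        using common[OF xy(1) that(1) xy(2) that(2) xy(3)] by fastforce
    qed
  next
    case False
    show thesis by (rule that[of 1]) (use False in auto)
  qed
  \<comment> \<open>Neighbours with as many elements of \<open>X\<close> as \<open>X - {f}\<close>
    keep the value 1; those with one element fewer are divided by \<open>c\<close>.\<close>
  define \<nu> where "\<nu> u = (if u \<in> X then c else 1)" for u
  let ?X = "X - {f}"
  define h where "h B = inverse (prod \<nu> ?X) * prod \<nu> B * g B" for B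
  let ?B0 = "insert \<epsilon> ?X"
  have \<nu>0: "\<nu> u \<noteq> 0" for u using c(1) unfolding \<nu>_def by simp
  have \<nu>X: "prod \<nu> ?X \<noteq> 0" using \<nu>0 finite_X by simp
  have gfin: "finite B" if "g B \<noteq> 0" for B using that g(2) finite_support(1) by metis
  have h: "pluecker h" unfolding h_def by (rule pluecker_gauge[OF g(1) gfin])
  have h0: "h B = 0 \<longleftrightarrow> p B = 0" for B
    unfolding h_def using \<nu>X \<nu>0 g(2) by (cases "finite B") auto
  have h_out: "h (insert y ?X) = 1" if y: "y \<in> E - X" for y
    unfolding h_def using y finite_X \<nu>X g1[OF f y] by (simp add: \<nu>_def)
  have h01: "h B \<in> {0, 1}" if B: "finite B" "card B = card X" "B \<subseteq> E" for B
  proof (rule pluecker_zero_one[OF h h_out[OF \<epsilon>] _ _ _ B(1) _ B(3)])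
    show "finite ?B0" "?B0 \<subseteq> E" using finite_X X_subset \<epsilon> by auto
    show "card B = card ?B0" using B(2) card_exchange[OF finite_X f, of \<epsilon>] \<epsilon> by simp
    fix b x assume b: "b \<in> ?B0" and x: "x \<in> E - ?B0"
    show "h (insert x (?B0 - {b})) \<in> {0, 1}"
    proof (cases "b = \<epsilon>")
      case True
      then have B: "?B0 - {b} = ?X" using \<epsilon> by blast
      show ?thesis
      proof (cases "x = f")
        case True
        then have "insert x (?B0 - {b}) = X" unfolding B using f by blast
        then show ?thesis using h0 pX(1) by simp
      next
        case False
        then show ?thesis unfolding B using h_out[of x] x by simp
      qed
    next
      case False
      then have bX: "b \<in> ?X" using b by blast
      have \<nu>b: "prod \<nu> ?X = c * prod \<nu> (?X - {b})"
        using prod.remove[OF _ bX, of \<nu>] finite_X bX unfolding \<nu>_def by simp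
      show ?thesis
      proof (cases "x = f")
        case True
        then have B: "insert x (?B0 - {b}) = insert \<epsilon> (X - {b})" "X - {b} = insert f (?X - {b})"
          using f bX \<epsilon> by blast+
        have "prod \<nu> (insert \<epsilon> (X - {b})) = prod \<nu> ?X"
        proof -
          have n: "\<epsilon> \<notin> insert f (?X - {b})" "f \<notin> ?X - {b}" using \<epsilon> f by blast+
          have \<nu>: "\<nu> \<epsilon> = 1" "\<nu> f = c" using \<epsilon> f unfolding \<nu>_def by simp_all
          have fin: "finite (?X - {b})" "finite (insert f (?X - {b}))" using finite_X by simp_all
          show ?thesis unfolding \<nu>b B(2) prod.insert[OF fin(2) n(1)] prod.insert[OF fin(1) n(2)] \<nu> by simp
        qed
        then have "h (insert x (?B0 - {b})) = 1"
          unfolding h_def B(1) using \<nu>X g1[of b \<epsilon>] bX \<epsilon> by simp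
        then show ?thesis by simp
      next
        case False
        then have xE: "x \<in> E - X - {\<epsilon>}" using x by blast
        have B: "insert x (?B0 - {b}) = insert x (insert \<epsilon> (?X - {b}))" "X - {f, b} = ?X - {b}" using bX \<epsilon> by blast+
        have "prod \<nu> (insert x (insert \<epsilon> (?X - {b}))) = prod \<nu> (?X - {b})"
        proof -
          have n: "x \<notin> insert \<epsilon> (?X - {b})" "\<epsilon> \<notin> ?X - {b}" using \<epsilon> xE by blast+
          have \<nu>: "\<nu> \<epsilon> = 1" "\<nu> x = 1" using \<epsilon> xE unfolding \<nu>_def by simp_all
          have fin: "finite (?X - {b})" "finite (insert \<epsilon> (?X - {b}))" using finite_X by simp_all
          show ?thesis unfolding prod.insert[OF fin(2) n(1)] prod.insert[OF fin(1) n(2)] \<nu> by simp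
        qed
        then have "h (insert x (?B0 - {b})) = inverse c * \<delta> f b \<epsilon> x"
          unfolding h_def B(1) \<nu>b \<delta>_def B(2) using \<nu>0 finite_X by (simp add: insert_commute)
        then show ?thesis using c(2)[OF bX xE] c(1) by auto
      qed
    qed
  qed
  have hS: "h (insert i (insert j S)) = 1" if "i \<in> P" "j \<in> P" "i \<noteq> j" for i j
  proof -
    note nz = pS[OF that]
    have "h (insert i (insert j S)) \<in> {0, 1}"
      using h01[OF finite_support(1)[OF nz]] support[OF nz] by blast
    then show ?thesis using h0 nz by auto
  qed
  have "a \<notin> S" "b \<notin> S" "d \<notin> S" "e \<notin> S" using u(1) P unfolding uniform_points_def by blast+
  moreover have "a \<noteq> b" "a \<noteq> d" "a \<noteq> e" "b \<noteq> d" "b \<noteq> e" "d \<noteq> e" using P(2) by auto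
  \<comment> \<open>All six pair values are 1, so the three-term relation reads
    \<open>1 = 1 + 1\<close>, which is 0 in characteristic 2.\<close>
  ultimately show False
    using pluecker_three_term[OF h P(2), of S] hS[of a b] hS[of d e] hS[of a d] hS[of b e] hS[of a e] hS[of b d]
    unfolding P(1) by simp
qed

end

section \<open>Pluecker functions of representable matroids\<close>

context matroid
begin

lemma finite_indep: "I \<in> indeps M \<Longrightarrow> finite I"
  using finite_ground indep_ground finite_subset by blast

lemma basesD: "B \<in> bases M \<Longrightarrow> B \<in> indeps M" "B \<in> bases M \<Longrightarrow> finite B" "B \<in> bases M \<Longrightarrow> B \<subseteq> ground M"
  using finite_indep indep_ground unfolding bases_def by auto

lemma card_indep_le: 
  assumes "I \<in> indeps M" "B \<in> bases M"
  shows "card I \<le> card B"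
proof (rule ccontr)
  assume "\<not> ?thesis"
  then obtain e where "e \<in> I - B" "insert e B \<in> indeps M"
    using indep_augment[OF basesD(1)[OF assms(2)] assms(1)] by auto
  then show False using assms(2) unfolding bases_def by blast
qed

lemma basis_iff_card:
  assumes "B \<in> bases M"
  shows "I \<in> bases M \<longleftrightarrow> I \<in> indeps M \<and> card I = card B"
proof
  assume "I \<in> bases M"
  then show "I \<in> indeps M \<and> card I = card B"
    using card_indep_le assms basesD(1) by (meson le_antisym)
next
  assume I: "I \<in> indeps M \<and> card I = card B"
  have "J = I" if "J \<in> indeps M" "I \<subseteq> J" for J
    using that I card_indep_le[OF that(1) assms] finite_indep[OF that(1)] by (metis card_seteq)
  then show "I \<in> bases M" using I unfolding bases_def by blast
qed

lemma augment_to_basis: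
  assumes I: "I \<in> indeps M" and B: "B \<in> bases M"
  obtains B' where "B' \<in> bases M" "I \<subseteq> B'" "B' \<subseteq> I \<union> B"
proof -
  have "\<exists>B'\<in>bases M. I \<subseteq> B' \<and> B' \<subseteq> I \<union> B"
    using I
  proof (induction "card B - card I" arbitrary: I)
    case 0
    then have "card I = card B" using card_indep_le[OF _ B] by fastforce
    then show ?case using basis_iff_card[OF B] 0 by blast
  next
    case (Suc n)
    then have "card I < card B" by linarith
    then obtain e where e: "e \<in> B - I" "insert e I \<in> indeps M"
      using indep_augment[OF Suc.prems basesD(1)[OF B]] by blast
    have "n = card B - card (insert e I)" using Suc.hyps(2) e(1) finite_indep[OF Suc.prems] by simp
    then obtain B' where "B' \<in> bases M" "insert e I \<subseteq> B'" "B' \<subseteq> insert e I \<union> B"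
      using Suc.hyps(1) e(2) by blast
    then show ?case using e by blast
  qed
  then show thesis using that by blast
qed

lemma bases_nonempty: "\<exists>B. B \<in> bases M"
proof -
  have fin: "finite (indeps M)"
    using finite_ground indep_ground by (meson Pow_iff finite_Pow_iff finite_subset subsetI)
  then obtain B where "B \<in> indeps M" "\<forall>J\<in>indeps M. B \<subseteq> J \<longrightarrow> B = J"
    using finite_has_maximal[of "indeps M"] indep_empty by blast
  then show ?thesis unfolding bases_def by blast
qed

lemma exists_basis_containing:
  assumes "I \<in> indeps M"
  obtains B where "B \<in> bases M" "I \<subseteq> B"
  using bases_nonempty augment_to_basis[OF assms] by metis

lemma basis_exchange:
  assumes "B \<in> bases M" "B' \<in> bases M" "x \<in> B"
  obtains b where "b \<in> B' - (B - {x})" "insert b (B - {x}) \<in> bases M"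
proof -
  have I: "B - {x} \<in> indeps M" using indep_subset basesD(1)[OF assms(1)] by blast
  have fin: "finite B" and eq: "card B' = card B"
    using basesD(2)[OF assms(1)] basis_iff_card[OF assms(1)] assms(2) by blast+
  have c: "Suc (card (B - {x})) = card B" using fin assms(3) by (rule card_Suc_Diff1)
  then have "card (B - {x}) < card B'" using eq by linarith
  then obtain b where b: "b \<in> B' - (B - {x})" "insert b (B - {x}) \<in> indeps M"
    using indep_augment[OF I basesD(1)[OF assms(2)]] by blast
  have "card (insert b (B - {x})) = Suc (card (B - {x}))" using b(1) fin by simp
  then have "card (insert b (B - {x})) = card B" using c by linarith
  then show thesis using that b basis_iff_card[OF assms(1)] by blast
qed

end

context gf4
begin

lemma maximal_minor_dependent:
  fixes v :: "'a \<Rightarrow> 'a \<Rightarrow> 'f"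
  assumes E: "finite E" "finite R" and B: "B \<subseteq> E" "card B = card R"
    and dep: "e \<in> B" "\<And>r. r \<in> R \<Longrightarrow> v e r = (\<Sum>b\<in>B-{e}. c b * v b r)"
  shows "maximal_minor E R v B = 0"
proof -
  have "finite B" using B E finite_subset by blast
  then obtain \<beta> where \<beta>: "bij_betw \<beta> R B" using B E by (metis finite_same_card_bij)
  let ?W = "\<lambda>i. v (\<beta> i)"
  obtain j where j: "j \<in> R" "\<beta> j = e" using \<beta> dep(1) unfolding bij_betw_def by force
  have "maximal_minor E R v B = pdet R (?W(j := \<lambda>r. \<Sum>b\<in>B-{e}. c b * v b r))"
    unfolding maximal_minor_eq[OF E(1) B(1) \<beta>] using dep(2) j by (intro pdet_cong) auto
  also have "\<dots> = (\<Sum>b\<in>B-{e}. c b * pdet R (?W(j := v b)))"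
    by (rule pdet_linear[OF E(2) j(1)])
  also have "\<dots> = 0"
  proof (rule sum.neutral, rule ballI)
    fix b assume b: "b \<in> B - {e}"
    then obtain k where k: "k \<in> R" "\<beta> k = b" using \<beta> unfolding bij_betw_def by force
    then have "k \<noteq> j" using j b by blast
    then have "pdet R (?W(j := v b)) = 0" using k j E(2) by (intro pdet_alternating[of R k j]) auto
    then show "c b * pdet R (?W(j := v b)) = 0" by simp
  qed
  finally show ?thesis .
qed

text \<open>The matrix may have more rows than the rank, so its columns are first rewritten in
  coordinates with respect to a basis \<open>R\<close>. Then \<open>R\<close> itself indexes the
  rows, and the minors are square.\<close>

lemma pluecker_of_representable:
  fixes M :: "'a matroid_struct"
  assumes M: "matroid M" and rep: "representable TYPE('f) M"
  shows "\<exists>p :: 'a set \<Rightarrow> 'f. pluecker p \<and> (\<forall>B. p B \<noteq> 0 \<longleftrightarrow> B \<in> bases M)"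
proof -
  interpret matroid M by (rule M)
  obtain m and A :: "nat \<Rightarrow> 'a \<Rightarrow> 'f" where A: "indeps M = {X. X \<subseteq> ground M \<and> independent_columns m A X}"
    using rep unfolding representable_def by blast
  have indep0: "c b = 0" if "I \<in> indeps M" "\<And>i. i < m \<Longrightarrow> (\<Sum>b\<in>I. c b * A i b) = 0" "b \<in> I" for I c b
    using that unfolding A independent_columns_def by simp
  obtain R where R: "R \<in> bases M" using bases_nonempty by blast
  note R' = basesD[OF R]
  have span: "\<exists>k. (\<forall>i<m. A i e = (\<Sum>b\<in>R. k b * A i b)) \<and> (e \<in> R \<longrightarrow> k = (\<lambda>b. if b = e then 1 else 0))"
    if e: "e \<in> ground M" for e
  proof (cases "e \<in> R")
    case True
    have "A i e = (\<Sum>b\<in>R. (if b = e then 1 else 0) * A i b)" for i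
      using True R'(2) by (simp add: if_distrib[of "\<lambda>x. x * _"] cong: if_cong)
    then show ?thesis by (intro exI[of _ "\<lambda>b. if b = e then 1 else 0"]) simp
  next
    case False
    have "insert e R \<notin> indeps M" using R False unfolding bases_def by blast
    then have "\<not> independent_columns m A (insert e R)" using A e R'(3) by blast
    then obtain c where c: "\<And>i. i < m \<Longrightarrow> (\<Sum>b\<in>insert e R. c b * A i b) = 0" "\<exists>b\<in>insert e R. c b \<noteq> 0"
      unfolding independent_columns_def by blast
    have split: "(\<Sum>b\<in>insert e R. c b * A i b) = c e * A i e + (\<Sum>b\<in>R. c b * A i b)" for i
      using False R'(2) by simp
    have ce: "c e \<noteq> 0"
    proof
      assume 0: "c e = 0"
      have "(\<Sum>b\<in>R. c b * A i b) = 0" if "i < m" for i using c(1)[OF that] 0 unfolding split by simp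
      then have "\<forall>b\<in>R. c b = 0" using indep0[OF R'(1), of c] by simp
      then show False using c(2) 0 by blast
    qed
    have "A i e = (\<Sum>b\<in>R. (c b / c e) * A i b)" if "i < m" for i
    proof -
      have "c e * A i e = (\<Sum>b\<in>R. c b * A i b)"
        using c(1)[OF that] unfolding split by (rule char_2_eqI)
      then have "A i e = (\<Sum>b\<in>R. c b * A i b) / c e" using ce by (simp add: eq_divide_eq mult.commute)
      then show ?thesis by (simp add: sum_divide_distrib)
    qed
    then show ?thesis using False by (intro exI[of _ "\<lambda>b. c b / c e"]) simp
  qed
  \<comment> \<open>Elements of \<open>R\<close> are pinned to unit vectors also off
    \<open>R\<close>, so that the minor at \<open>R\<close> is 1 and starts the induction on
    bases.\<close>
  define v :: "'a \<Rightarrow> 'a \<Rightarrow> 'f" where "v e = (SOME k. (\<forall>i<m. A i e = (\<Sum>b\<in>R. k b * A i b)) \<and>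
      (e \<in> R \<longrightarrow> k = (\<lambda>b. if b = e then 1 else 0)))" for e
  have v': "(\<forall>i<m. A i e = (\<Sum>b\<in>R. v e b * A i b)) \<and> (e \<in> R \<longrightarrow> v e = (\<lambda>b. if b = e then 1 else 0))"
    if "e \<in> ground M" for e
    unfolding v_def by (rule someI_ex[OF span[OF that]])
  have v: "A i e = (\<Sum>b\<in>R. v e b * A i b)" if "e \<in> ground M" "i < m" for e i
    using v'[OF that(1)] that(2) by blast
  have vR: "v e = (\<lambda>b. if b = e then 1 else 0)" if "e \<in> R" for e
    using v'[of e] that R'(3) by blast
  have comb: "(\<Sum>e\<in>B. c e * A i e) = (\<Sum>b\<in>R. (\<Sum>e\<in>B. c e * v e b) * A i b)" if "B \<subseteq> ground M" "i < m" for B c i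
  proof -
    have "(\<Sum>e\<in>B. c e * A i e) = (\<Sum>e\<in>B. \<Sum>b\<in>R. c e * v e b * A i b)"
      using that v by (intro sum.cong) (auto simp: sum_distrib_left mult.assoc)
    also have "\<dots> = (\<Sum>b\<in>R. \<Sum>e\<in>B. c e * v e b * A i b)" by (rule sum.swap)
    finally show ?thesis by (simp add: sum_distrib_right)
  qed
  let ?p = "maximal_minor (ground M) R v"
  have "B \<in> bases M" if nz: "?p B \<noteq> 0" for B
  proof (rule ccontr)
    assume nB: "B \<notin> bases M"
    have B: "B \<subseteq> ground M" "card B = card R" using nz unfolding maximal_minor_def by (auto split: if_splits)
    then have "\<not> independent_columns m A B" using nB basis_iff_card[OF R] A by blast
    then obtain c e where c: "\<And>i. i < m \<Longrightarrow> (\<Sum>b\<in>B. c b * A i b) = 0" and e: "e \<in> B" "c e \<noteq> 0"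
      unfolding independent_columns_def by blast
    have "(\<Sum>b\<in>R. (\<Sum>e\<in>B. c e * v e b) * A i b) = 0" if "i < m" for i
      using comb[OF B(1) that, of c] c[OF that] by simp
    then have z: "(\<Sum>e\<in>B. c e * v e r) = 0" if "r \<in> R" for r
      using indep0[OF R'(1), of "\<lambda>b. \<Sum>e\<in>B. c e * v e b"] that by simp
    have fB: "finite B" using B finite_ground finite_subset by blast
    have "v e r = (\<Sum>b\<in>B-{e}. (c b / c e) * v b r)" if "r \<in> R" for r
    proof -
      have "c e * v e r + (\<Sum>b\<in>B-{e}. c b * v b r) = 0"
        using z[OF that] sum.remove[OF fB e(1), of "\<lambda>b. c b * v b r"] by simp
      then have "c e * v e r = (\<Sum>b\<in>B-{e}. c b * v b r)" by (rule char_2_eqI)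
      then have "v e r = (\<Sum>b\<in>B-{e}. c b * v b r) / c e" using e(2) by (simp add: eq_divide_eq mult.commute)
      then show ?thesis by (simp add: sum_divide_distrib)
    qed
    then have "?p B = 0" by (rule maximal_minor_dependent[OF finite_ground R'(2) B e(1)])
    then show False using nz by contradiction
  qed
  moreover have "?p B \<noteq> 0" if "B \<in> bases M" for B
    using that
  proof (induction "card (B - R)" arbitrary: B rule: less_induct)
    case less
    note B = basesD[OF less.prems]
    have cB: "card B = card R" using basis_iff_card[OF R] less.prems by blast
    show ?case
    proof (cases "B \<subseteq> R")
      case True
      then have "B = R" using cB R'(2) by (metis card_subset_eq)
      moreover have "?p R = pdet R (\<lambda>i. v (id i))" by (rule maximal_minor_eq[OF finite_ground R'(3) bij_betw_id])
      moreover have "\<dots> = pdet R (\<lambda>i r. if r = i then 1 else 0)" using vR by (intro pdet_cong) simp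
      ultimately show ?thesis by (simp add: pdet_unit[OF R'(2)])
    next
      case False
      then obtain x where x: "x \<in> B" "x \<notin> R" by blast
      obtain b where b: "b \<in> R - (B - {x})" "insert b (B - {x}) \<in> bases M"
        using basis_exchange[OF less.prems R x(1)] by blast
      let ?B = "insert b (B - {x})"
      have bx: "b \<noteq> x" "b \<notin> B" using b x by blast+
      have "?B - R = B - R - {x}" using b(1) by blast
      then have "card (?B - R) < card (B - R)"
        using x B(2) by (metis DiffI card_Diff1_less finite_Diff)
      then have nz: "?p ?B \<noteq> 0" using less.hyps b(2) by blast
      show ?thesis
      proof
        assume 0: "?p B = 0"
        note B2 = basesD[OF b(2)]
        have c2: "card ?B = card R" using basis_iff_card[OF R] b(2) by blast
        have xE: "x \<in> ground M" "x \<notin> ?B" using x B(3) bx by blast+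
        have swap: "insert x (?B - {b}) = B" using x bx by blast
        define c where "c e = ?p (insert x (?B - {e})) / ?p ?B" for e
        \<comment> \<open>Cramer's rule over \<open>?B\<close>, whose minor is nonzero. The term of
          \<open>b\<close> carries the minor of \<open>B\<close>, assumed to be 0, so
          \<open>x\<close> would depend on \<open>B - {x}\<close>.\<close>
        have vx: "v x r = (\<Sum>e\<in>B-{x}. c e * v e r)" if "r \<in> R" for r
        proof -
          have "?p ?B * v x r = (\<Sum>e\<in>?B. ?p (insert x (?B - {e})) * v e r)"
            by (rule maximal_minor_cramer[OF finite_ground R'(2) that B2(3) c2 xE])
          also have "\<dots> = ?p (insert x (?B - {b})) * v b r + (\<Sum>e\<in>B-{x}. ?p (insert x (?B - {e})) * v e r)"
            using bx B(2) by (subst sum.insert) auto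
          also have "\<dots> = (\<Sum>e\<in>B-{x}. ?p (insert x (?B - {e})) * v e r)" unfolding swap 0 by simp
          finally have "v x r = (\<Sum>e\<in>B-{x}. ?p (insert x (?B - {e})) * v e r) / ?p ?B"
            using nz by (simp add: eq_divide_eq mult.commute)
          then show ?thesis unfolding c_def by (simp add: sum_divide_distrib)
        qed
        define d where "d e = (if e = x then 1 else c e)" for e
        have "(\<Sum>e\<in>B. d e * v e r) = 0" if "r \<in> R" for r
        proof -
          have "(\<Sum>e\<in>B. d e * v e r) = d x * v x r + (\<Sum>e\<in>B-{x}. d e * v e r)"
            by (rule sum.remove[OF B(2) x(1)])
          also have "(\<Sum>e\<in>B-{x}. d e * v e r) = (\<Sum>e\<in>B-{x}. c e * v e r)"
            by (rule sum.cong) (auto simp: d_def)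
          finally show ?thesis using vx[OF that] by (simp add: d_def)
        qed
        then have "(\<Sum>e\<in>B. d e * A i e) = 0" if "i < m" for i using comb[OF B(3) that, of d] by simp
        then have "d x = 0" using indep0[OF B(1), of d] x(1) by simp
        then show False unfolding d_def by simp
      qed
    qed
  qed
  ultimately show ?thesis using pluecker_maximal_minor[OF finite_ground R'(2)] by blast
qed

end

section \<open>Uniform minors\<close>

text \<open>A uniform minor described by bases of \<open>M\<close> alone, so that it can be read off
  from the support of a Pluecker function.\<close>

definition has_uniform_points :: "'a matroid_struct \<Rightarrow> nat \<Rightarrow> nat \<Rightarrow> bool" where
  "has_uniform_points M k n \<longleftrightarrow> (\<exists>S P. S \<inter> P = {} \<and> card P = n \<and>
    (\<forall>Q. Q \<subseteq> P \<longrightarrow> card Q = k \<longrightarrow> S \<union> Q \<in> bases M))"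

lemma ground_contraction: "ground (contraction M C) = ground M - C"
  by (simp add: contraction_def dual_def deletion_def)

context matroid
begin

lemma card_basis_split:
  assumes "B \<in> bases M" "B' \<in> bases M"
  shows "card (B \<inter> C) + card (B - C) = card (B' \<inter> C) + card (B' - C)"
proof -
  have "card (B \<inter> C) + card (B - C) = card B" if "finite B" for B
    using card_Int_Diff[OF that] by simp
  then show ?thesis using basesD(2) assms basis_iff_card[OF assms(2)] by metis
qed

text \<open>The set \<open>C\<close> need be neither independent nor coindependent, hence the
  maximality of the intersection with \<open>C\<close>: a basis of the dual restricted to
  \<open>ground M - C\<close> is as large as possible when \<open>B\<close> uses as much of
  \<open>C\<close> as possible.\<close>

lemma bases_deletion_dual:
  "L \<in> bases (deletion (dual M) C) \<longleftrightarrow>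
    (\<exists>B\<in>bases M. L = ground M - C - B \<and> (\<forall>B'\<in>bases M. card (B' \<inter> C) \<le> card (B \<inter> C)))"
proof -
  let ?E = "ground M"
  have ind: "J \<in> indeps (deletion (dual M) C) \<longleftrightarrow> (\<exists>B\<in>bases M. J \<subseteq> ?E - C - B)" for J
    unfolding deletion_def dual_def by auto
  show ?thesis
  proof
    assume L: "L \<in> bases (deletion (dual M) C)"
    then obtain B where B: "B \<in> bases M" "L \<subseteq> ?E - C - B"
      using ind unfolding bases_def[of "deletion (dual M) C"] by blast
    have eq: "L = ?E - C - B'" if "B' \<in> bases M" "L \<subseteq> ?E - C - B'" for B'
      using L ind that unfolding bases_def[of "deletion (dual M) C"] by blast
    have "card (B' \<inter> C) \<le> card (B \<inter> C)" if B': "B' \<in> bases M" for B'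
    proof (rule ccontr)
      assume "\<not> ?thesis"
      then have lt: "card (B \<inter> C) < card (B' \<inter> C)" by simp
      have "B \<inter> C \<in> indeps M" "B' \<inter> C \<in> indeps M"
        using indep_subset basesD(1) B(1) B' by blast+
      then obtain e where e: "e \<in> B' \<inter> C - B \<inter> C" "insert e (B \<inter> C) \<in> indeps M"
        using indep_augment lt by blast
      then obtain B2 where B2: "B2 \<in> bases M" "insert e (B \<inter> C) \<subseteq> B2" "B2 \<subseteq> insert e (B \<inter> C) \<union> B"
        using augment_to_basis[OF e(2) B(1)] by blast
      have "L \<subseteq> ?E - C - B2" using B(2) B2(3) e(1) by blast
      then have "?E - C - B2 = ?E - C - B" using eq[OF B2(1)] eq[OF B] by blast
      then have "B \<subseteq> B2" using B2(2) basesD(3)[OF B(1)] by blast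
      moreover have "e \<in> B2 - B" using B2(2) e(1) by blast
      moreover have "B2 \<in> indeps M" using basesD(1)[OF B2(1)] .
      ultimately show False using B(1) unfolding bases_def by blast
    qed
    then show "\<exists>B\<in>bases M. L = ?E - C - B \<and> (\<forall>B'\<in>bases M. card (B' \<inter> C) \<le> card (B \<inter> C))"
      using B(1) eq[OF B] by blast
  next
    assume "\<exists>B\<in>bases M. L = ?E - C - B \<and> (\<forall>B'\<in>bases M. card (B' \<inter> C) \<le> card (B \<inter> C))"
    then obtain B where B: "B \<in> bases M" "L = ?E - C - B" "\<And>B'. B' \<in> bases M \<Longrightarrow> card (B' \<inter> C) \<le> card (B \<inter> C)"
      by blast
    have "J = L" if J: "J \<in> indeps (deletion (dual M) C)" "L \<subseteq> J" for J
    proof -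
      obtain B' where B': "B' \<in> bases M" "J \<subseteq> ?E - C - B'" using J(1) ind by blast
      have "B' - C \<subseteq> B - C" using J(2) B'(2) B(2) basesD(3)[OF B'(1)] by blast
      moreover have "card (B - C) \<le> card (B' - C)"
        using card_basis_split[OF B(1) B'(1), of C] B(3)[OF B'(1)] by linarith
      ultimately have "B' - C = B - C" using basesD(2)[OF B(1)] by (intro card_seteq) auto
      then have "?E - C - B' = ?E - C - B" by blast
      then show ?thesis using B(2) B'(2) J(2) by blast
    qed
    moreover have "L \<in> indeps (deletion (dual M) C)" unfolding ind using B(1,2) by blast
    ultimately show "L \<in> bases (deletion (dual M) C)" unfolding bases_def[of "deletion (dual M) C"]
      by (intro CollectI conjI ballI impI)
  qed
qed

lemma indeps_contraction:
  "I \<in> indeps (contraction M C) \<longleftrightarrow>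
    (\<exists>B\<in>bases M. I \<subseteq> B - C \<and> (\<forall>B'\<in>bases M. card (B' \<inter> C) \<le> card (B \<inter> C)))"
proof -
  have g: "ground (deletion (dual M) C) = ground M - C" by (simp add: deletion_def dual_def)
  have "ground M - C - (ground M - C - B) = B - C" if "B \<in> bases M" for B
    using basesD(3)[OF that] by blast
  then have "(\<exists>L\<in>bases (deletion (dual M) C). I \<subseteq> ground M - C - L) \<longleftrightarrow>
    (\<exists>B\<in>bases M. I \<subseteq> B - C \<and> (\<forall>B'\<in>bases M. card (B' \<inter> C) \<le> card (B \<inter> C)))"
    unfolding Bex_def bases_deletion_dual by blast
  then show ?thesis unfolding contraction_def dual_def[of "deletion (dual M) C"] g by simp
qed

text \<open>Contraction provides a separate basis for each \<open>Q\<close>, whereas one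
  \<open>S\<close> must serve all of them. \<open>S = B - Q0\<close> is taken from a single basis
  \<open>B\<close>; it may contain deleted elements, in case the minor has smaller rank than the
  contraction.\<close>

lemma uniform_points_of_minor:
  assumes minor: "minor N M" and iso: "isomorphic N (uniform k n)" and kn: "k \<le> n"
  shows "has_uniform_points M k n"
proof -
  obtain C D where CD: "C \<subseteq> ground M" "D \<subseteq> ground M" and N: "N = deletion (contraction M C) D"
    using minor unfolding minor_def by blast
  define P where "P = ground M - C - D"
  have gN: "ground N = P" unfolding N P_def by (simp add: deletion_def ground_contraction)
  have finP: "finite P" unfolding P_def using finite_ground by simp
  obtain f where f: "bij_betw f P {..<n}" "\<And>I. I \<subseteq> P \<Longrightarrow> I \<in> indeps N \<longleftrightarrow> f ` I \<in> indeps (uniform k n)"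
    using iso unfolding isomorphic_def gN by (auto simp: uniform_def)
  have cP: "card P = n" using bij_betw_same_card[OF f(1)] by simp
  have small: "I \<in> indeps (contraction M C) \<longleftrightarrow> card I \<le> k" if I: "I \<subseteq> P" for I
  proof -
    have "I \<in> indeps (contraction M C) \<longleftrightarrow> I \<in> indeps N"
      using I gN unfolding N deletion_def ground_contraction by (auto simp: P_def)
    moreover have "card (f ` I) = card I" "f ` I \<subseteq> {..<n}"
      using f(1) I unfolding bij_betw_def by (auto intro: card_image inj_on_subset)
    ultimately show ?thesis using f(2)[OF I] by (simp add: uniform_def)
  qed
  let ?max = "\<lambda>B. \<forall>B'\<in>bases M. card (B' \<inter> C) \<le> card (B \<inter> C)"
  have capP: "card (B \<inter> P) \<le> k" if "B \<in> bases M" "?max B" for B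
  proof -
    have "B \<inter> P \<subseteq> B - C" unfolding P_def by blast
    then show ?thesis using small[of "B \<inter> P"] that unfolding indeps_contraction by blast
  qed
  obtain Q0 where Q0: "Q0 \<subseteq> P" "card Q0 = k" "finite Q0"
    using obtain_subset_with_card_n[of k P] kn cP by metis
  then obtain B where B: "B \<in> bases M" "Q0 \<subseteq> B - C" "?max B"
    using small[OF Q0(1)] unfolding indeps_contraction by auto
  note B' = basesD[OF B(1)]
  have BP: "B \<inter> P = Q0"
    using capP[OF B(1,3)] Q0 B(2) B'(2) by (intro card_seteq[symmetric]) auto
  define J where "J = B \<inter> C"
  have CP: "C \<inter> P = {}" unfolding P_def by blast
  \<comment> \<open>Two augmentations: \<open>A\<close> first has its part in \<open>C\<close>
    replaced by \<open>J\<close>, which shows that \<open>J \<union> Q\<close> is independent. This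
    set is then completed from \<open>B\<close>, and \<open>capP\<close> prevents further elements
    of \<open>P\<close> from entering.\<close>
  have main: "(B - Q0) \<union> Q \<in> bases M" if Q: "Q \<subseteq> P" "card Q = k" for Q
  proof -
    obtain A where A: "A \<in> bases M" "Q \<subseteq> A - C" "?max A"
      using small[OF Q(1)] Q(2) unfolding indeps_contraction by auto
    have cJ: "card J = card (A \<inter> C)" using A(1,3) B(1,3) unfolding J_def by (meson le_antisym)
    have "J \<in> indeps M" using indep_subset[OF B'(1)] unfolding J_def by blast
    then obtain B1 where B1: "B1 \<in> bases M" "J \<subseteq> B1" "B1 \<subseteq> J \<union> A" using augment_to_basis A(1) by metis
    have "J \<subseteq> B1 \<inter> C" using B1(2) unfolding J_def by blast
    moreover have "card (B1 \<inter> C) \<le> card J" using B(3) B1(1) unfolding J_def by blast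
    moreover have "finite (B1 \<inter> C)" using basesD(2)[OF B1(1)] by blast
    ultimately have JB1: "B1 \<inter> C = J" by (metis card_seteq)
    have "B1 - C \<subseteq> A - C" using B1(3) unfolding J_def by blast
    moreover have "card (A - C) \<le> card (B1 - C)"
      using card_basis_split[OF A(1) B1(1), of C] cJ unfolding JB1 by linarith
    ultimately have "B1 - C = A - C" using basesD(2)[OF A(1)] by (metis card_seteq finite_Diff)
    then have "J \<union> Q \<subseteq> B1" using A(2) B1(2) by blast
    then have "J \<union> Q \<in> indeps M" using indep_subset basesD(1)[OF B1(1)] by blast
    then obtain B2 where B2: "B2 \<in> bases M" "J \<union> Q \<subseteq> B2" "B2 \<subseteq> J \<union> Q \<union> B" using augment_to_basis B(1) by metis
    have "B2 \<inter> C = J" using B2 Q(1) CP unfolding J_def by blast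
    then have "?max B2" using B(3) unfolding J_def by simp
    then have "card (B2 \<inter> P) \<le> card Q" using capP[OF B2(1)] Q(2) by simp
    moreover have "Q \<subseteq> B2 \<inter> P" using B2(2) Q(1) by blast
    ultimately have B2P: "B2 \<inter> P = Q" using finP by (metis card_seteq finite_Int)
    have sub: "B2 \<subseteq> (B - Q0) \<union> Q"
    proof
      fix z assume z: "z \<in> B2"
      show "z \<in> (B - Q0) \<union> Q"
      proof (cases "z \<in> P")
        case False
        then show ?thesis using z B2(3) Q0(1) unfolding J_def by blast
      qed (use z B2P in blast)
    qed
    have "finite Q" using Q(1) finP finite_subset by blast
    then have fin: "finite ((B - Q0) \<union> Q)" using B'(2) by simp
    have "Q0 \<subseteq> B" using B(2) by blast
    then have "card (B - Q0) + k = card B"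
      using card_Diff_subset[OF Q0(3)] card_mono[OF B'(2), of Q0] Q0(2) by simp
    then have "card ((B - Q0) \<union> Q) \<le> card B" using card_Un_le[of "B - Q0" Q] Q(2) by linarith
    moreover have "card B2 = card B" using basis_iff_card[OF B(1)] B2(1) by blast
    ultimately have "B2 = (B - Q0) \<union> Q" using sub fin by (metis card_seteq)
    then show ?thesis using B2(1) by simp
  qed
  have "(B - Q0) \<inter> P = {}" using BP by blast
  then show ?thesis using main cP unfolding has_uniform_points_def by blast
qed

text \<open>Since \<open>k\<close> is positive, each element of \<open>P\<close> occurs in some
  basis, which places \<open>P\<close> inside the ground set.\<close>

lemma minor_of_uniform_points:
  assumes u: "has_uniform_points M k n" and k: "1 \<le> k" "k \<le> n"
  shows "\<exists>N. minor N M \<and> isomorphic N (uniform k n)"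
proof -
  obtain S P where SP: "S \<inter> P = {}" "card P = n" and bas: "\<And>Q. Q \<subseteq> P \<Longrightarrow> card Q = k \<Longrightarrow> S \<union> Q \<in> bases M"
    using u unfolding has_uniform_points_def by blast
  have finP: "finite P" using SP(2) k card.infinite by fastforce
  obtain Q0 where Q0: "Q0 \<subseteq> P" "card Q0 = k" using obtain_subset_with_card_n[of k P] k SP by metis
  note Q0b = basesD[OF bas[OF Q0]]
  have fS: "finite S" using Q0b(2) by simp
  have rank: "card B = card S + k" if "B \<in> bases M" for B
  proof -
    have "card (S \<union> Q0) = card S + card Q0"
      using SP(1) Q0(1) finP fS by (intro card_Un_disjoint) (auto intro: finite_subset)
    then show ?thesis using basis_iff_card[OF bas[OF Q0]] that Q0(2) by simp
  qed
  have extend: "\<exists>Q. I \<subseteq> Q \<and> Q \<subseteq> P \<and> card Q = k" if I: "I \<subseteq> P" "card I \<le> k" for I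
  proof -
    have fI: "finite I" using I finP finite_subset by blast
    then have "k - card I \<le> card (P - I)" using I SP(2) k by (simp add: card_Diff_subset)
    then obtain R where R: "R \<subseteq> P - I" "card R = k - card I" using obtain_subset_with_card_n by metis
    have "finite R" using R(1) finP finite_subset by blast
    then have "card (I \<union> R) = k" using R fI I(2) by (subst card_Un_disjoint) auto
    then show ?thesis using R I by blast
  qed
  have PE: "P \<subseteq> ground M"
  proof
    fix i assume "i \<in> P"
    then obtain Q where "i \<in> Q" "Q \<subseteq> P" "card Q = k" using extend[of "{i}"] k by auto
    then show "i \<in> ground M" using basesD(3)[OF bas] by blast
  qed
  have SE: "S \<subseteq> ground M" using Q0b by blast
  let ?D = "ground M - S - P"
  let ?N = "deletion (contraction M S) ?D"
  have gN: "ground ?N = P" using PE SP(1) by (auto simp: deletion_def ground_contraction)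
  have minor: "minor ?N M" unfolding minor_def by (intro exI[of _ S] exI[of _ ?D]) (use SE in auto)
  have ind: "I \<in> indeps ?N \<longleftrightarrow> card I \<le> k" if I: "I \<subseteq> P" for I
  proof -
    have "I \<in> indeps ?N \<longleftrightarrow> I \<in> indeps (contraction M S)"
      using I gN unfolding deletion_def by auto
    also have "\<dots> \<longleftrightarrow> card I \<le> k"
    proof
      assume "I \<in> indeps (contraction M S)"
      then obtain B where B: "B \<in> bases M" "I \<subseteq> B - S" "\<forall>B'\<in>bases M. card (B' \<inter> S) \<le> card (B \<inter> S)"
        unfolding indeps_contraction by blast
      have "(S \<union> Q0) \<inter> S = S" by blast
      then have "card S \<le> card (B \<inter> S)" using B(3) bas[OF Q0] by metis
      then have "B \<inter> S = S" using fS by (intro card_seteq) auto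
      then have "I \<union> S \<subseteq> B" using B(2) by blast
      then have "card (I \<union> S) \<le> card S + k" using rank[OF B(1)] card_mono[OF basesD(2)[OF B(1)]] by metis
      moreover have "card (I \<union> S) = card I + card S"
        using B(2) fS basesD(2)[OF B(1)] by (intro card_Un_disjoint) (auto intro: finite_subset)
      ultimately show "card I \<le> k" by linarith
    next
      assume "card I \<le> k"
      then obtain Q where Q: "I \<subseteq> Q" "Q \<subseteq> P" "card Q = k" using extend[OF I] by blast
      have "I \<subseteq> (S \<union> Q) - S" using Q(1) I SP(1) by blast
      moreover have "card (B' \<inter> S) \<le> card ((S \<union> Q) \<inter> S)" for B'
        using fS by (intro card_mono) auto
      ultimately show "I \<in> indeps (contraction M S)"
        unfolding indeps_contraction using bas[OF Q(2,3)] by blast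
    qed
    finally show ?thesis .
  qed
  obtain f where f: "bij_betw f P {..<n}"
    using ex_bij_betw_finite_nat[OF finP] SP(2) by (auto simp: atLeast0LessThan)
  have "isomorphic ?N (uniform k n)"
    unfolding isomorphic_def gN
  proof (intro exI[of _ f] conjI allI impI)
    show "bij_betw f P (ground (uniform k n))" using f by (simp add: uniform_def)
    fix I assume I: "I \<subseteq> P"
    have "card (f ` I) = card I" "f ` I \<subseteq> {..<n}"
      using f I unfolding bij_betw_def by (auto intro: card_image inj_on_subset)
    then show "I \<in> indeps ?N \<longleftrightarrow> f ` I \<in> indeps (uniform k n)"
      unfolding ind[OF I] by (simp add: uniform_def)
  qed
  then show ?thesis using minor by blast
qed

lemma has_minor_uniform_iff:
  assumes "1 \<le> k" "k \<le> n"
  shows "(\<exists>N. minor N M \<and> isomorphic N (uniform k n)) \<longleftrightarrow> has_uniform_points M k n"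
  using uniform_points_of_minor minor_of_uniform_points assms by blast

section \<open>Deleting or contracting a single element\<close>

lemma matroid_deletion: "matroid (deletion M D)"
proof
  show "finite (ground (deletion M D))" using finite_ground by (simp add: deletion_def)
  show "I \<subseteq> ground (deletion M D)" if "I \<in> indeps (deletion M D)" for I
    using that by (simp add: deletion_def)
  show "{} \<in> indeps (deletion M D)" using indep_empty by (simp add: deletion_def)
  show "I \<in> indeps (deletion M D)" if "J \<in> indeps (deletion M D)" "I \<subseteq> J" for I J
    using that indep_subset by (auto simp: deletion_def)
  show "\<exists>e\<in>J - I. insert e I \<in> indeps (deletion M D)"
    if "I \<in> indeps (deletion M D)" "J \<in> indeps (deletion M D)" "card I < card J" for I J
    using that indep_augment[of I J] by (auto simp: deletion_def)
qed

lemma bases_deletion_single: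
  assumes "B \<in> bases (deletion M {x})" and B0: "B0 \<in> bases M" "x \<notin> B0"
  shows "B \<in> bases M" "x \<notin> B"
proof -
  have B: "B \<in> indeps M" "B \<subseteq> ground M - {x}"
    using assms(1) unfolding bases_def deletion_def by auto
  then show "x \<notin> B" by blast
  obtain B' where B': "B' \<in> bases M" "B \<subseteq> B'" "B' \<subseteq> B \<union> B0" using augment_to_basis[OF B(1) B0(1)] .
  have "B' \<subseteq> ground M - {x}" using B'(3) B(2) B0(2) basesD(3)[OF B'(1)] by blast
  then have "B' \<in> indeps (deletion M {x})" using basesD(1)[OF B'(1)] by (simp add: deletion_def)
  then have "B' = B" using assms(1) B'(2) unfolding bases_def by blast
  then show "B \<in> bases M" using B'(1) by simp
qed

lemma indeps_contraction_single:
  assumes B0: "B0 \<in> bases M" "y \<in> B0"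
  shows "I \<in> indeps (contraction M {y}) \<longleftrightarrow> y \<notin> I \<and> insert y I \<in> indeps M"
proof
  have c: "card (B \<inter> {y}) = (if y \<in> B then 1 else 0)" for B by simp
  assume "I \<in> indeps (contraction M {y})"
  then obtain B where B: "B \<in> bases M" "I \<subseteq> B - {y}" "card (B0 \<inter> {y}) \<le> card (B \<inter> {y})"
    using B0(1) unfolding indeps_contraction by blast
  then have "y \<in> B" using B0(2) unfolding c by (auto split: if_splits)
  then show "y \<notin> I \<and> insert y I \<in> indeps M" using B(2) indep_subset[OF basesD(1)[OF B(1)]] by blast
next
  assume I: "y \<notin> I \<and> insert y I \<in> indeps M"
  then obtain B where B: "B \<in> bases M" "insert y I \<subseteq> B" using exists_basis_containing by metis
  have "card (B' \<inter> {y}) \<le> card (B \<inter> {y})" for B' using B(2) by (intro card_mono) auto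
  then show "I \<in> indeps (contraction M {y})"
    unfolding indeps_contraction using I B by blast
qed

lemma matroid_contraction_single:
  assumes B0: "B0 \<in> bases M" "y \<in> B0"
  shows "matroid (contraction M {y})"
proof
  note ind = indeps_contraction_single[OF B0]
  show "finite (ground (contraction M {y}))" using finite_ground by (simp add: ground_contraction)
  show "I \<subseteq> ground (contraction M {y})" if "I \<in> indeps (contraction M {y})" for I
    using that indep_ground unfolding ind ground_contraction by blast
  show "{} \<in> indeps (contraction M {y})"
    unfolding ind using indep_subset[OF basesD(1)[OF B0(1)], of "{y}"] B0(2) by simp
  show "I \<in> indeps (contraction M {y})" if "J \<in> indeps (contraction M {y})" "I \<subseteq> J" for I J
    using that indep_subset[of "insert y J" "insert y I"] unfolding ind by blast
  show "\<exists>e\<in>J - I. insert e I \<in> indeps (contraction M {y})"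
    if "I \<in> indeps (contraction M {y})" "J \<in> indeps (contraction M {y})" "card I < card J" for I J
  proof -
    have IJ: "y \<notin> I" "insert y I \<in> indeps M" "y \<notin> J" "insert y J \<in> indeps M" using that(1,2) unfolding ind by blast+
    have "finite I" "finite J" using finite_indep[OF IJ(2)] finite_indep[OF IJ(4)] by simp_all
    then have "card (insert y I) < card (insert y J)" using IJ that(3) by simp
    then obtain e where "e \<in> insert y J - insert y I" "insert e (insert y I) \<in> indeps M"
      using indep_augment[OF IJ(2,4)] by blast
    then have "e \<in> J - I" "y \<notin> insert e I" "insert y (insert e I) \<in> indeps M"
      using IJ by (auto simp: insert_commute)
    then show ?thesis unfolding ind by blast
  qed
qed

lemma bases_contraction_single:
  assumes B0: "B0 \<in> bases M" "y \<in> B0" and B: "B \<in> bases (contraction M {y})"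
  shows "insert y B \<in> bases M" "y \<notin> B"
proof -
  note ind = indeps_contraction_single[OF B0]
  have BI: "y \<notin> B" "insert y B \<in> indeps M" using B unfolding bases_def ind by blast+
  then show "y \<notin> B" by blast
  have "J = insert y B" if J: "J \<in> indeps M" "insert y B \<subseteq> J" for J
  proof -
    have "insert y (J - {y}) = J" using J(2) by blast
    then have "J - {y} \<in> indeps (contraction M {y})" using J(1) unfolding ind by simp
    moreover have "B \<subseteq> J - {y}" using J(2) BI(1) by blast
    ultimately have "J - {y} = B" using B unfolding bases_def by blast
    then show ?thesis using J(2) by blast
  qed
  then show "insert y B \<in> bases M" using BI(2) unfolding bases_def by blast
qed

end

section \<open>Fragility of relaxations\<close>

context matroid
begin

lemma finite_card_indeps: "finite (card ` {I \<in> indeps M. I \<subseteq> A})"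
proof -
  have "{I \<in> indeps M. I \<subseteq> A} \<subseteq> Pow (ground M)" using indep_ground by blast
  then show ?thesis using finite_ground by (meson finite_Pow_iff finite_imageI finite_subset)
qed

lemma rk_ge: "I \<in> indeps M \<Longrightarrow> I \<subseteq> A \<Longrightarrow> card I \<le> rk M A"
  unfolding rk_def by (intro Max_ge finite_card_indeps) auto

lemma rk_obtain:
  obtains I where "I \<in> indeps M" "I \<subseteq> A" "card I = rk M A"
proof -
  have "card ` {I \<in> indeps M. I \<subseteq> A} \<noteq> {}" using indep_empty by blast
  then have "rk M A \<in> card ` {I \<in> indeps M. I \<subseteq> A}"
    unfolding rk_def by (rule Max_in[OF finite_card_indeps])
  then show thesis using that by auto
qed

lemma rk_mono: "A \<subseteq> B \<Longrightarrow> rk M A \<le> rk M B"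
proof -
  assume "A \<subseteq> B"
  obtain I where I: "I \<in> indeps M" "I \<subseteq> A" "card I = rk M A" by (rule rk_obtain)
  then show ?thesis using rk_ge[OF I(1), of B] \<open>A \<subseteq> B\<close> by simp
qed

text \<open>As \<open>X\<close> is a flat, adding \<open>y\<close> raises the rank, so
  \<open>X - {x}\<close> can be augmented inside \<open>insert y X\<close>. The new element is not
  \<open>x\<close>, because \<open>X\<close> is dependent.\<close>

lemma circuit_hyperplane_exchange:
  assumes X: "circuit_hyperplane M X" and x: "x \<in> X" and y: "y \<in> ground M - X"
  shows "insert y (X - {x}) \<in> indeps M"
proof -
  have circ: "X \<notin> indeps M" "\<And>D. D \<subset> X \<Longrightarrow> D \<in> indeps M" and XE: "X \<subseteq> ground M" and fl: "cl M X = X"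
    using X unfolding circuit_hyperplane_def circuits_def hyperplane_def flat_def by blast+
  have fX: "finite X" using XE finite_ground finite_subset by blast
  have Xx: "X - {x} \<in> indeps M" using circ(2) x by blast
  have "rk M (insert y X) \<noteq> rk M X" using fl y unfolding cl_def by blast
  then have "rk M X < rk M (insert y X)" using rk_mono[of X "insert y X"] by fastforce
  moreover have "card (X - {x}) \<le> rk M X" using rk_ge[OF Xx] by blast
  moreover obtain I where I: "I \<in> indeps M" "I \<subseteq> insert y X" "card I = rk M (insert y X)"
    by (rule rk_obtain)
  ultimately have "card (X - {x}) < card I" by linarith
  then obtain e where e: "e \<in> I - (X - {x})" "insert e (X - {x}) \<in> indeps M"
    using indep_augment[OF Xx I(1)] by blast
  have "e \<noteq> x" using e(2) circ(1) x by (metis insert_Diff)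
  then have "e = y" using e(1) I(2) by blast
  then show ?thesis using e(2) by blast
qed

text \<open>Take a circuit through some \<open>x\<close> in \<open>X\<close> and some
  \<open>y\<close> outside. If \<open>X = {x}\<close>, it properly contains the circuit
  \<open>X\<close>; if \<open>y\<close> is the only element outside, it lies in one of the
  independent sets of \<open>circuit_hyperplane_exchange\<close>.\<close>

lemma connected_circuit_hyperplane_card:
  assumes conn: "connected_matroid M" and X: "circuit_hyperplane M X"
  shows "2 \<le> card X" "2 \<le> card (ground M - X)"
proof -
  have circ: "X \<notin> indeps M" "\<And>D. D \<subset> X \<Longrightarrow> D \<in> indeps M" and XE: "X \<subseteq> ground M"
    and hyp: "rk M X + 1 = rk M (ground M)"
    using X unfolding circuit_hyperplane_def circuits_def hyperplane_def by blast+
  have fX: "finite X" using XE finite_ground finite_subset by blast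
  have "X \<noteq> {}" using circ(1) indep_empty by blast
  then obtain x where x: "x \<in> X" by blast
  have "X \<noteq> ground M" using hyp by auto
  then obtain y where y: "y \<in> ground M - X" using XE by blast
  have "x \<in> ground M" "y \<in> ground M" "x \<noteq> y" using x y XE by blast+
  then obtain C where C: "C \<in> circuits M" "x \<in> C" "y \<in> C" using conn unfolding connected_matroid_def by blast
  have C': "C \<subseteq> ground M" "C \<notin> indeps M" "\<And>D. D \<subset> C \<Longrightarrow> D \<in> indeps M"
    using C(1) unfolding circuits_def by blast+
  show "2 \<le> card X"
  proof (rule ccontr)
    assume "\<not> ?thesis"
    then have "card X \<le> card {x}" by simp
    then have "{x} = X" using x fX by (intro card_seteq) auto
    then have "X \<subset> C" using C y by blast
    then show False using C'(3) circ(1) by blast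
  qed
  show "2 \<le> card (ground M - X)"
  proof (rule ccontr)
    assume "\<not> ?thesis"
    then have "card (ground M - X) \<le> card {y}" by simp
    then have "{y} = ground M - X" using y finite_ground by (intro card_seteq) auto
    then have CX: "C \<subseteq> insert y X" using C'(1) by blast
    have "\<not> X \<subset> C" using C'(3) circ(1) by blast
    then obtain z where z: "z \<in> X" "z \<notin> C" using C y by blast
    then have "C \<subseteq> insert y (X - {z})" using CX by blast
    then show False using circuit_hyperplane_exchange[OF X z(1) y] indep_subset C'(2) by blast
  qed
qed

lemma basis_dual:
  assumes "B \<in> bases M"
  shows "ground M - B \<in> bases (dual M)"
proof -
  have "J = ground M - B" if B': "B' \<in> bases M" "J \<subseteq> ground M - B'" and J: "ground M - B \<subseteq> J" for J B'
  proof -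
    have "B' \<subseteq> B" using B' J basesD(3)[OF B'(1)] by blast
    then have "B = B'" using basesD(1)[OF assms] B'(1) unfolding bases_def by blast
    then show ?thesis using B'(2) J by blast
  qed
  then show ?thesis using assms unfolding bases_def[of "dual M"] by (auto simp: dual_def)
qed

end

section \<open>From Pluecker functions back to matroids\<close>

lemma has_uniform_points_coords:
  fixes p :: "'a set \<Rightarrow> 'f::zero"
  assumes "\<And>B. p B \<noteq> 0 \<longleftrightarrow> B \<in> bases M"
  shows "has_uniform_points M k n \<longleftrightarrow> (\<exists>S P. card P = n \<and> uniform_points p k S P)"
  unfolding has_uniform_points_def uniform_points_def assms by blast

locale relaxed_matroids = relaxed_pair F E X p p' + M': matroid M'
  for F :: "'f::field itself" and E X :: "'a set" and p p' :: "'a set \<Rightarrow> 'f" and M M' :: "'a matroid_struct" +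
  assumes ground: "ground M' = E"
    and bases: "\<And>B. p B \<noteq> 0 \<longleftrightarrow> B \<in> bases M" "\<And>B. p' B \<noteq> 0 \<longleftrightarrow> B \<in> bases M'"
    and card2: "2 \<le> card X" "2 \<le> card (E - X)"
begin

lemma bases_iff: "B \<noteq> X \<Longrightarrow> B \<in> bases M' \<longleftrightarrow> B \<in> bases M"
  using bases zero_iff by metis

text \<open>Because \<open>x\<close> is no coloop of \<open>M'\<close>, bases of the deletion are
  bases of \<open>M'\<close> avoiding \<open>x\<close>. They differ from \<open>X\<close> and so are
  bases of \<open>M\<close>.\<close>

lemma uniform_points_deletion:
  assumes x: "x \<in> X" and u: "has_uniform_points (deletion M' {x}) k n"
  shows "has_uniform_points M k n"
proof -
  have "E - X \<noteq> {}" using card2(2) by (metis card.empty not_numeral_le_zero)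
  then obtain y where y: "y \<in> E - X" by blast
  have B0: "insert y (X - {x}) \<in> bases M'" "x \<notin> insert y (X - {x})"
    using exchange_X[OF x y] bases(1) bases_iff[of "insert y (X - {x})"] x y by auto
  have b: "B \<in> bases M" if "B \<in> bases (deletion M' {x})" for B
    using M'.bases_deletion_single[OF that B0] x bases_iff by blast
  obtain S P where SP: "S \<inter> P = {}" "card P = n"
    and Q: "\<And>Q. Q \<subseteq> P \<Longrightarrow> card Q = k \<Longrightarrow> S \<union> Q \<in> bases (deletion M' {x})"
    using u unfolding has_uniform_points_def by blast
  show ?thesis
    unfolding has_uniform_points_def
    by (intro exI[of _ S] exI[of _ P] conjI allI impI SP b Q)
qed

text \<open>Each basis of the contraction becomes a basis of \<open>M'\<close> through
  \<open>y\<close>, hence different from \<open>X\<close>. So \<open>y\<close> can be added to the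
  contracted set.\<close>

lemma uniform_points_contraction:
  assumes y: "y \<in> E - X" and u: "has_uniform_points (contraction M' {y}) k n" and k: "1 \<le> k" "k \<le> n"
  shows "has_uniform_points M k n"
proof -
  have "X \<noteq> {}" using card2(1) by auto
  then obtain x where x: "x \<in> X" by blast
  have B0: "insert y (X - {x}) \<in> bases M'" "y \<in> insert y (X - {x})"
    using exchange_X[OF x y] bases(1) bases_iff[of "insert y (X - {x})"] x y by auto
  have b: "insert y B \<in> bases M \<and> y \<notin> B" if "B \<in> bases (contraction M' {y})" for B
    using M'.bases_contraction_single[OF B0 that] y bases_iff by blast
  obtain S P where SP: "S \<inter> P = {}" "card P = n"
    and Q: "\<And>Q. Q \<subseteq> P \<Longrightarrow> card Q = k \<Longrightarrow> S \<union> Q \<in> bases (contraction M' {y})"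
    using u unfolding has_uniform_points_def by blast
  have finP: "finite P" using SP(2) k card.infinite by fastforce
  obtain Q0 where Q0: "Q0 \<subseteq> P" "card Q0 = k" using obtain_subset_with_card_n[of k P] k SP by metis
  have yS: "y \<notin> S" using b[OF Q[OF Q0]] by blast
  have yP: "y \<notin> P"
  proof
    assume yP: "y \<in> P"
    then have "k - 1 \<le> card (P - {y})" using k SP(2) finP by simp
    then obtain R where R: "R \<subseteq> P - {y}" "card R = k - 1" using obtain_subset_with_card_n by metis
    have "finite R" using R(1) finP finite_subset by blast
    then have "card (insert y R) = k" using R k by (subst card_insert_disjoint) auto
    then show False using b[OF Q[of "insert y R"]] R(1) yP by blast
  qed
  have "insert y S \<union> Q' \<in> bases M" if "Q' \<subseteq> P" "card Q' = k" for Q'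
    using b[OF Q[OF that]] by simp
  moreover have "insert y S \<inter> P = {}" using SP(1) yP by blast
  ultimately show ?thesis using SP(2) unfolding has_uniform_points_def by blast
qed

text \<open>Each element lies in \<open>X\<close> or outside, and accordingly its deletion or its
  contraction has only uniform minors of \<open>M\<close>. Indexing the class by pairs in
  \<open>K\<close> covers both classes of the theorem at once.\<close>

lemma fragile_if_no_uniform_points:
  assumes minor: "has_minor (case_prod uniform ` K) M'"
    and K: "\<And>k n. (k, n) \<in> K \<Longrightarrow> 1 \<le> k \<and> k \<le> n \<and> \<not> has_uniform_points M k n"
  shows "fragile (case_prod uniform ` K) M' \<and> (\<forall>e\<in>X. nondeletable (case_prod uniform ` K) M' e) \<and>
    (\<forall>e\<in>E - X. noncontractible (case_prod uniform ` K) M' e)"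
proof -
  let ?N = "case_prod uniform ` K"
  have del: "\<not> has_minor ?N (deletion M' {e})" if e: "e \<in> X" for e
  proof
    assume "has_minor ?N (deletion M' {e})"
    then obtain k n where kn: "(k, n) \<in> K" "\<exists>N. minor N (deletion M' {e}) \<and> isomorphic N (uniform k n)"
      unfolding has_minor_def by auto
    then have "has_uniform_points (deletion M' {e}) k n"
      using matroid.has_minor_uniform_iff[OF M'.matroid_deletion] K by blast
    then show False using uniform_points_deletion[OF e] K kn(1) by blast
  qed
  have con: "\<not> has_minor ?N (contraction M' {e})" if e: "e \<in> E - X" for e
  proof
    assume "has_minor ?N (contraction M' {e})"
    then obtain k n where kn: "(k, n) \<in> K" "\<exists>N. minor N (contraction M' {e}) \<and> isomorphic N (uniform k n)"
      unfolding has_minor_def by auto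
    have "X \<noteq> {}" using card2(1) by auto
    then obtain x where x: "x \<in> X" by blast
    have B0: "insert e (X - {x}) \<in> bases M'" "e \<in> insert e (X - {x})"
      using exchange_X[OF x e] bases(1) bases_iff[of "insert e (X - {x})"] x e by auto
    have "has_uniform_points (contraction M' {e}) k n"
      using matroid.has_minor_uniform_iff[OF M'.matroid_contraction_single[OF B0]] K kn by blast
    then show False using uniform_points_contraction[OF e] K kn(1) by blast
  qed
  show ?thesis
    unfolding fragile_def nondeletable_def noncontractible_def ground
    using minor del con X_subset by blast
qed

text \<open>Otherwise \<open>E - X\<close> has rank at most 1 in \<open>M'\<close>. As
  \<open>X\<close> is a basis with at least two elements on either side, it would be a
  2-separation.\<close>

lemma has_minor_uniform_four:
  assumes "n_connected 3 M'"
  shows "has_minor {uniform 2 4} M'"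
proof (rule ccontr)
  assume no: "\<not> ?thesis"
  have "\<not> has_uniform_points M' 2 4"
    using no M'.minor_of_uniform_points[of 2 4] unfolding has_minor_def by auto
  then have no4: "\<not> uniform_points p' 2 S P" if "card P = 4" for S P
    using that unfolding has_uniform_points_coords[OF bases(2)] by blast
  have XB: "X \<in> bases M'" using pX(2) bases(2) by blast
  have le1: "rk M' (E - X) \<le> 1"
  proof -
    obtain I where I: "I \<in> indeps M'" "I \<subseteq> E - X" "card I = rk M' (E - X)" by (rule M'.rk_obtain)
    obtain B where B: "B \<in> bases M'" "I \<subseteq> B" using M'.exists_basis_containing[OF I(1)] .
    have "card I \<le> card (B - X)" using B I(2) M'.basesD(2)[OF B(1)] by (intro card_mono) auto
    moreover have "card (B - X) \<le> 1" using B(1) bases(2) by (intro card_outside_le_1 no4) auto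
    ultimately show ?thesis using I(3) by linarith
  qed
  have "rk M' X \<le> card X"
  proof -
    obtain I where "I \<in> indeps M'" "I \<subseteq> X" "card I = rk M' X" by (rule M'.rk_obtain)
    then show ?thesis using card_mono[OF finite_X] by metis
  qed
  moreover have "card X \<le> rk M' E" using M'.rk_ge[OF M'.basesD(1)[OF XB] X_subset] .
  ultimately have "separation 2 M' X"
    unfolding separation_def ground using card2 X_subset le1 by auto
  then show False using assms unfolding n_connected_def by force
qed

lemma fragile_class:
  assumes "n_connected 3 M'"
  shows "\<exists>\<N>\<in>{{uniform 2 4}, {uniform 2 5, uniform 3 5}}. fragile \<N> M' \<and>
    (\<forall>e\<in>X. nondeletable \<N> M' e) \<and> (\<forall>e\<in>E - X. noncontractible \<N> M' e)"
proof (cases "has_minor {uniform 2 5, uniform 3 5} M'")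
  case True
  have eq: "case_prod uniform ` {(2, 5), (3, 5)} = {uniform 2 5, uniform 3 5}" by simp
  have "1 \<le> k \<and> k \<le> n \<and> \<not> has_uniform_points M k n" if "(k, n) \<in> {(2, 5), (3, 5)}" for k n :: nat
    using that no_uniform_five unfolding has_uniform_points_coords[OF bases(1)] by auto
  from fragile_if_no_uniform_points[of "{(2, 5), (3, 5)}", OF _ this] True
  show ?thesis unfolding eq by auto
next
  case False
  have no5: "\<not> uniform_points p' k S P" if k: "k = 2 \<or> k = 3" and P: "card P = 5" for k S P
  proof
    assume "uniform_points p' k S P"
    then have "has_uniform_points M' k 5" using P unfolding has_uniform_points_coords[OF bases(2)] by blast
    then have "\<exists>N. minor N M' \<and> isomorphic N (uniform k 5)"
      using k by (intro M'.minor_of_uniform_points) auto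
    then show False using False k unfolding has_minor_def by auto
  qed
  have eq: "case_prod uniform ` {(2, 4)} = {uniform 2 4}" by simp
  have "1 \<le> k \<and> k \<le> n \<and> \<not> has_uniform_points M k n" if "(k, n) \<in> {(2, 4)}" for k n :: nat
    using that no_uniform_four[OF no5] unfolding has_uniform_points_coords[OF bases(1)] by auto
  from fragile_if_no_uniform_points[of "{(2, 4)}", OF _ this] has_minor_uniform_four[OF assms]
  show ?thesis unfolding eq by auto
qed

end

theorem theorem3p2:
  fixes M M' :: "'a matroid_struct" and X :: "'a set"
  assumes "CARD('f::field) = 4"
    and "matroid M" and "matroid M'"
    and "representable TYPE('f) M" and "representable TYPE('f) M'"
    and "connected_matroid M"
    and "n_connected 3 M'"
    and "relaxation M X M'"
  shows "\<exists>\<N> \<in> {{uniform 2 4}, {uniform 2 5, uniform 3 5}}.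
    fragile \<N> M' \<and>
    X \<in> bases M' \<and>
    (\<forall>e \<in> X. nondeletable \<N> M' e) \<and>
    ground M' - X \<in> bases (dual M') \<and>
    (\<forall>e \<in> ground M' - X. noncontractible \<N> M' e)"
proof -
  interpret gf4 "TYPE('f)" by standard (rule assms(1))
  interpret M: matroid M by (rule assms(2))
  interpret M': matroid M' by (rule assms(3))
  obtain p :: "'a set \<Rightarrow> 'f" where p: "pluecker p" "\<forall>B. p B \<noteq> 0 \<longleftrightarrow> B \<in> bases M"
    using pluecker_of_representable[OF assms(2,4)] by blast
  obtain p' :: "'a set \<Rightarrow> 'f" where p': "pluecker p'" "\<forall>B. p' B \<noteq> 0 \<longleftrightarrow> B \<in> bases M'"
    using pluecker_of_representable[OF assms(3,5)] by blast
  have ch: "circuit_hyperplane M X" and g: "ground M' = ground M" and b: "bases M' = bases M \<union> {X}"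
    using assms(8) unfolding relaxation_def by blast+
  have XI: "X \<notin> indeps M" and XE: "X \<subseteq> ground M"
    using ch unfolding circuit_hyperplane_def circuits_def by blast+
  have XB: "X \<in> bases M'" using b by blast
  have XnB: "X \<notin> bases M" using XI M.basesD(1) by blast
  \<comment> \<open>\<open>X\<close> is dependent in \<open>M\<close>, so the sizes are compared in
    \<open>M'\<close>, where both sets are bases.\<close>
  have cX: "card B = card X" if "B \<in> bases M" for B
    using M'.basis_iff_card[OF XB] that b by blast
  have ex: "insert y (X - {x}) \<in> bases M" if x: "x \<in> X" and y: "y \<in> ground M - X" for x y
  proof -
    have "finite X" using XE M.finite_ground finite_subset by blast
    then have "card (insert y (X - {x})) = card X" by (rule card_exchange) (use x y in auto)
    moreover obtain B where B: "B \<in> bases M" using M.bases_nonempty by blast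
    ultimately show ?thesis
      using M.circuit_hyperplane_exchange[OF ch x y] M.basis_iff_card[OF B] cX[OF B] by simp
  qed
  interpret relaxed_matroids "TYPE('f)" "ground M" X p p' M M'
  proof
    show "finite (ground M)" "X \<subseteq> ground M" by (rule M.finite_ground, rule XE)
    show "pluecker p" "pluecker p'" by (rule p(1), rule p'(1))
    show "B \<subseteq> ground M \<and> card B = card X" if "p B \<noteq> 0" for B
      using that p(2) M.basesD(3) cX by blast
    show "p X = 0" "p' X \<noteq> 0" using p(2) p'(2) XnB XB by blast+
    show "p' B = 0 \<longleftrightarrow> p B = 0" if "B \<noteq> X" for B using p(2) p'(2) b that by blast
    show "p (insert y (X - {x})) \<noteq> 0" if "x \<in> X" "y \<in> ground M - X" for x y
      using ex[OF that] p(2) by blast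
    show "ground M' = ground M" by (rule g)
    show "p B \<noteq> 0 \<longleftrightarrow> B \<in> bases M" "p' B \<noteq> 0 \<longleftrightarrow> B \<in> bases M'" for B using p(2) p'(2) by blast+
    show "2 \<le> card X" "2 \<le> card (ground M - X)"
      using M.connected_circuit_hyperplane_card[OF assms(6) ch] by blast+
  qed
  show ?thesis
    using fragile_class[OF assms(7)] XB M'.basis_dual[OF XB] unfolding g by blast
qed

end
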